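(* Fix $\theta\in(0,1)$, $d\ge1$ and integers $1\le i_1<\dots<i_d$, and let $p=\theta/(n-1)$. For $i\ge0$ let $V_i$ be the number of vertices of degree $i$ in the Erdős–Rényi random graph $\mathcal{G}(n,p)$ and put $F_i:=(V_i-\mathbb{E}[V_i])/\sqrt n$. Let $\mathbf{F}_{\mathbf{D}}:=(F_{i_1},\dots,F_{i_d})$. Let $\Sigma=(\Sigma_{ab})_{a,b=1}^d$ be the matrix given by $$\Sigma_{ab}=\frac{\theta^{i_a+i_b}}{i_a!\,i_b!}\,e^{-2\theta}\Big(\frac{(i_a-\theta)(i_b-\theta)}{\theta}-1\Big)+\mathbf{1}\{a=b\}\,\frac{\theta^{i_a}}{i_a!}\,e^{-\theta},\qquad a,b\in\{1,\dots,d\},$$ and let $\mathbf{N}_\Sigma$ be a $d$-dimensional centred Gaussian random vector with covariance matrix $\Sigma$. Then there exists a constant $c=c(i_1,\dots,i_d,\theta)>0$ depending only on $i_1,\dots,i_d$ and $\theta$ such that $$d_4(\mathbf{F}_{\mathbf{D}},\mathbf{N}_\Sigma)\le\frac{c}{\sqrt n}$$ for all sufficiently large $n$.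
   Context: $\mathcal{G}(n,p)$ is the random graph obtained from the complete graph $K_n$ on $n$ vertices by keeping each of its $\binom n2$ edges independently with probability $p$ and removing it otherwise. The degree of a vertex is the number of edges of $\mathcal{G}(n,p)$ emanating from it. For a function $g:\mathbb{R}^d\to\mathbb{R}$ put $M_k(g)=\max_{1\le j_1,\dots,j_k\le d}\big\|\frac{\partial^k g}{\partial x_{j_1}\cdots\partial x_{j_k}}\big\|_\infty$ (supremum norm). For $\mathbb{R}^d$-valued random vectors $\mathbf{X},\mathbf{Y}$, $d_4(\mathbf{X},\mathbf{Y})=\sup_g|\mathbb{E}[g(\mathbf{X})]-\mathbb{E}[g(\mathbf{Y})]|$, where the supremum runs over all four times partially differentiable $g:\mathbb{R}^d\to\mathbb{R}$ with bounded partial derivatives satisfying $M_1(g),M_2(g),M_3(g),M_4(g)\le1$. *)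

theory Defs
  imports "HOL-Probability.Probability"
begin

section \<open>The Erdos--Renyi random graph and its degree counts\<close>

definition complete_edges :: "nat \<Rightarrow> nat set set" where
  "complete_edges n = {e. e \<subseteq> {..<n} \<and> card e = 2}"

text \<open>The graph is identified with its random edge set. \<^const>\<open>bernoulli_pmf\<close> truncates its
  parameter to the unit interval, so the definition is the intended one for \<open>0 \<le> p \<le> 1\<close>.\<close>

definition erdos_renyi :: "nat \<Rightarrow> real \<Rightarrow> nat set set pmf" where
  "erdos_renyi n p =
     map_pmf (\<lambda>keep. {e \<in> complete_edges n. keep e})
       (Pi_pmf (complete_edges n) False (\<lambda>_. bernoulli_pmf p))"

definition vertex_degree :: "nat set set \<Rightarrow> nat \<Rightarrow> nat" where
  "vertex_degree E v = card {e \<in> E. v \<in> e}"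

definition num_degree :: "nat \<Rightarrow> nat \<Rightarrow> nat set set \<Rightarrow> nat" where
  "num_degree n k E = card {v \<in> {..<n}. vertex_degree E v = k}"

definition normalized_num_degree :: "nat \<Rightarrow> real \<Rightarrow> nat \<Rightarrow> nat set set \<Rightarrow> real" where
  "normalized_num_degree n p k E =
     (real (num_degree n k E) -
        measure_pmf.expectation (erdos_renyi n p) (\<lambda>E'. real (num_degree n k E'))) / sqrt (real n)"

text \<open>Vectors with \<open>d\<close> entries are indexed by an arbitrary type \<open>'d\<close> with \<open>d\<close> elements;
  the ordering of the entries is imposed through a linear order on \<open>'d\<close>.\<close>

definition degree_vector ::
  "nat \<Rightarrow> real \<Rightarrow> ('d::finite \<Rightarrow> nat) \<Rightarrow> nat set set \<Rightarrow> real ^ 'd" where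
  "degree_vector n p i E = (\<chi> a. normalized_num_degree n p (i a) E)"

definition limit_cov :: "real \<Rightarrow> ('d::finite \<Rightarrow> nat) \<Rightarrow> real ^ 'd ^ 'd" where
  "limit_cov \<theta> i = (\<chi> a b.
     \<theta> ^ (i a + i b) / (fact (i a) * fact (i b)) * exp (- 2 * \<theta>) *
       ((real (i a) - \<theta>) * (real (i b) - \<theta>) / \<theta> - 1)
     + (if a = b then \<theta> ^ i a / fact (i a) * exp (- \<theta>) else 0))"

section \<open>The distance \<open>d4\<close>\<close>

definition line_through :: "'d::finite \<Rightarrow> (real ^ 'd \<Rightarrow> real) \<Rightarrow> real ^ 'd \<Rightarrow> real \<Rightarrow> real" where
  "line_through j g x = (\<lambda>t. g (x + t *\<^sub>R axis j 1))"

definition partial_deriv :: "'d::finite \<Rightarrow> (real ^ 'd \<Rightarrow> real) \<Rightarrow> real ^ 'd \<Rightarrow> real" where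
  "partial_deriv j g x = deriv (line_through j g x) 0"

abbreviation iterated_partial ::
  "'d::finite list \<Rightarrow> (real ^ 'd \<Rightarrow> real) \<Rightarrow> real ^ 'd \<Rightarrow> real" where
  "iterated_partial js g \<equiv> foldr partial_deriv js g"

definition times_partially_differentiable ::
  "nat \<Rightarrow> (real ^ 'd::finite \<Rightarrow> real) \<Rightarrow> bool" where
  "times_partially_differentiable m g \<longleftrightarrow>
     (\<forall>js j x. length js < m \<longrightarrow> line_through j (iterated_partial js g) x differentiable (at 0))"

text \<open>Extended reals are used so that the supremum norm of an unbounded function is \<open>\<infinity>\<close> and
  not an unspecified real number.\<close>

definition sup_partials :: "nat \<Rightarrow> (real ^ 'd::finite \<Rightarrow> real) \<Rightarrow> ereal" where
  "sup_partials k g = (SUP js \<in> {js. length js = k}. SUP x. ereal \<bar>iterated_partial js g x\<bar>)"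

text \<open>Boundedness of the partial derivatives is contained in the bounds by 1.\<close>

definition d4_test_functions :: "(real ^ 'd::finite \<Rightarrow> real) set" where
  "d4_test_functions =
     {g. times_partially_differentiable 4 g \<and> (\<forall>k \<in> {1..4}. sup_partials k g \<le> 1)}"

definition d4 ::
  "'a measure \<Rightarrow> ('a \<Rightarrow> real ^ 'd::finite) \<Rightarrow> 'b measure \<Rightarrow> ('b \<Rightarrow> real ^ 'd) \<Rightarrow> ereal" where
  "d4 M X N Y =
     (SUP g \<in> d4_test_functions. ereal \<bar>(LINT \<omega>|M. g (X \<omega>)) - (LINT \<omega>|N. g (Y \<omega>))\<bar>)"

section \<open>Gaussian random vectors\<close>

text \<open>Point masses count as normal distributions with variance zero, so that singular covariance
  matrices (and zero linear combinations) are covered.\<close>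

definition normal_rv :: "'a measure \<Rightarrow> ('a \<Rightarrow> real) \<Rightarrow> bool" where
  "normal_rv M Y \<longleftrightarrow>
     (\<exists>m. distr M borel Y = return borel m) \<or>
     (\<exists>m s. s > 0 \<and> distributed M lborel Y (normal_density m s))"

definition gaussian_vector :: "'a measure \<Rightarrow> ('a \<Rightarrow> real ^ 'd::finite) \<Rightarrow> bool" where
  "gaussian_vector M X \<longleftrightarrow>
     prob_space M \<and> X \<in> borel_measurable M \<and> (\<forall>t. normal_rv M (\<lambda>\<omega>. t \<bullet> X \<omega>))"

definition covariance :: "'a measure \<Rightarrow> ('a \<Rightarrow> real) \<Rightarrow> ('a \<Rightarrow> real) \<Rightarrow> real" where
  "covariance M Y Z =
     (LINT \<omega>|M. (Y \<omega> - (LINT \<omega>'|M. Y \<omega>')) * (Z \<omega> - (LINT \<omega>'|M. Z \<omega>')))"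

definition centred_gaussian_vector ::
  "'a measure \<Rightarrow> ('a \<Rightarrow> real ^ 'd::finite) \<Rightarrow> real ^ 'd ^ 'd \<Rightarrow> bool" where
  "centred_gaussian_vector M X \<Sigma> \<longleftrightarrow>
     gaussian_vector M X \<and>
     (\<forall>a. (LINT \<omega>|M. X \<omega> $ a) = 0) \<and>
     (\<forall>a b. covariance M (\<lambda>\<omega>. X \<omega> $ a) (\<lambda>\<omega>. X \<omega> $ b) = \<Sigma> $ a $ b)"

subsection \<open>Existence for the covariance matrix \<open>limit_cov\<close>\<close>

text \<open>The matrix \<open>limit_cov \<theta> i\<close> has a factorization into explicit vectors, hence a centred
  Gaussian vector with this covariance matrix exists.\<close>

lemma std_normal_covariance_zero_mean:
  fixes Z :: "'k \<Rightarrow> 'a \<Rightarrow> real"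
  assumes "prob_space M" "prob_space.indep_vars M (\<lambda>_. borel) Z UNIV"
    and d: "\<And>k. distributed M lborel (Z k) std_normal_density"
  shows "integrable M (Z k)" "integrable M (\<lambda>\<omega>. Z k \<omega> * Z l \<omega>)"
    "(LINT \<omega>|M. Z k \<omega>) = 0"
    "(LINT \<omega>|M. Z k \<omega> * Z l \<omega>) = (if k = l then 1 else 0)"
proof -
  interpret prob_space M by fact
  have int: "integrable M (Z k)" for k
    using distributed_integrable[OF d[of k], of "\<lambda>x. x"] integrable_std_normal_moment[of 1]
    by simp
  have sq: "integrable M (\<lambda>\<omega>. Z k \<omega> * Z k \<omega>)" for k
    using distributed_integrable[OF d[of k], of "\<lambda>x. x * x"] integrable_std_normal_moment[of 2]
    by (simp add: power2_eq_square)
  have mean: "(LINT \<omega>|M. Z k \<omega>) = 0" for k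
    by (rule standard_normal_distributed_expectation[OF d])
  have "variance (Z k) = 1" for k
    by (rule standard_normal_distributed_variance[OF d])
  then have var: "(LINT \<omega>|M. Z k \<omega> * Z k \<omega>) = 1" for k
    by (simp add: mean power2_eq_square)
  have ind: "indep_var borel (Z k) borel (Z l)" if "k \<noteq> l" for k l
    using indep_vars_sum[of "{l}" k Z] indep_vars_subset[OF assms(2), of "{k, l}"] that by simp
  show "integrable M (Z k)" by (rule int)
  show "integrable M (\<lambda>\<omega>. Z k \<omega> * Z l \<omega>)"
    using sq indep_var_integrable[OF ind int int] by (cases "k = l") auto
  show "(LINT \<omega>|M. Z k \<omega>) = 0" by (rule mean)
  show "(LINT \<omega>|M. Z k \<omega> * Z l \<omega>) = (if k = l then 1 else 0)"
    using var indep_var_lebesgue_integral[OF ind int int] mean by auto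
qed

lemma normal_rv_linear_combination:
  fixes Z :: "'k::finite \<Rightarrow> 'a \<Rightarrow> real" and c :: "'k \<Rightarrow> real"
  assumes "prob_space M" "prob_space.indep_vars M (\<lambda>_. borel) Z UNIV"
    and d: "\<And>k. distributed M lborel (Z k) std_normal_density"
  shows "normal_rv M (\<lambda>\<omega>. \<Sum>k\<in>UNIV. c k * Z k \<omega>)"
proof -
  interpret prob_space M by fact
  define I where "I = {k. c k \<noteq> 0}"
  have eq: "(\<Sum>k\<in>UNIV. c k * Z k \<omega>) = (\<Sum>k\<in>I. c k * Z k \<omega>)" for \<omega>
    by (rule sum.mono_neutral_right) (auto simp: I_def)
  show ?thesis
  proof (cases "I = {}")
    case True
    have "distr M borel (\<lambda>_. 0 :: real) = return borel 0"
      by (rule distr_const) simp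
    then show ?thesis unfolding normal_rv_def eq True by auto
  next
    case False
    have ind: "indep_vars (\<lambda>_. borel) (\<lambda>k \<omega>. c k * Z k \<omega>) I"
      using indep_vars_compose2[OF indep_vars_subset[OF assms(2)], of I "\<lambda>k x. c k * x" "\<lambda>_. borel"]
      by simp
    have dd: "distributed M lborel (\<lambda>\<omega>. c k * Z k \<omega>) (normal_density 0 \<bar>c k\<bar>)" if "k \<in> I" for k
      using normal_density_affine[OF d[of k], of "c k" 0] that by (simp add: I_def)
    have "distributed M lborel (\<lambda>\<omega>. \<Sum>k\<in>I. c k * Z k \<omega>)
        (normal_density (\<Sum>k\<in>I. 0) (sqrt (\<Sum>k\<in>I. \<bar>c k\<bar>\<^sup>2)))"
      by (rule sum_indep_normal[OF _ False ind _ dd]) (auto simp: I_def)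
    moreover have "sqrt (\<Sum>k\<in>I. \<bar>c k\<bar>\<^sup>2) > 0"
      using False by (intro real_sqrt_gt_zero sum_pos) (auto simp: I_def)
    ultimately show ?thesis unfolding normal_rv_def eq by blast
  qed
qed

lemma centred_gaussian_vector_linear_map:
  fixes Z :: "'k::finite \<Rightarrow> 'a \<Rightarrow> real" and A :: "'k \<Rightarrow> real ^ 'd"
  assumes M: "prob_space M" "prob_space.indep_vars M (\<lambda>_. borel) Z UNIV"
    and d: "\<And>k. distributed M lborel (Z k) std_normal_density"
  shows "centred_gaussian_vector M (\<lambda>\<omega>. \<Sum>k\<in>UNIV. Z k \<omega> *\<^sub>R A k)
     (\<chi> a b. \<Sum>k\<in>UNIV. A k $ a * A k $ b)"
proof -
  interpret prob_space M by fact
  note Z = std_normal_covariance_zero_mean[OF M d]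
  have [measurable]: "Z k \<in> borel_measurable M" for k
    using Z(1) by blast
  have "normal_rv M (\<lambda>\<omega>. t \<bullet> (\<Sum>k\<in>UNIV. Z k \<omega> *\<^sub>R A k))" for t
    using normal_rv_linear_combination[OF M d, of "\<lambda>k. t \<bullet> A k"]
    by (simp add: inner_sum_right mult.commute)
  moreover have mean: "(LINT \<omega>|M. (\<Sum>k\<in>UNIV. Z k \<omega> * A k $ a)) = 0" for a
    by (simp add: Z)
  moreover have "(LINT \<omega>|M. (\<Sum>k\<in>UNIV. Z k \<omega> * A k $ a) * (\<Sum>l\<in>UNIV. Z l \<omega> * A l $ b))
      = (\<Sum>k\<in>UNIV. A k $ a * A k $ b)" for a b
  proof -
    have "(LINT \<omega>|M. (\<Sum>k\<in>UNIV. Z k \<omega> * A k $ a) * (\<Sum>l\<in>UNIV. Z l \<omega> * A l $ b))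
      = (LINT \<omega>|M. (\<Sum>k\<in>UNIV. \<Sum>l\<in>UNIV. (Z k \<omega> * Z l \<omega>) * (A k $ a * A l $ b)))"
      by (simp add: sum_product mult_ac)
    also have "\<dots> = (\<Sum>k\<in>UNIV. \<Sum>l\<in>UNIV. (if k = l then 1 else 0) * (A k $ a * A l $ b))"
      by (subst Bochner_Integration.integral_sum; (subst Bochner_Integration.integral_sum)?; simp add: Z)
    also have "\<dots> = (\<Sum>k\<in>UNIV. A k $ a * A k $ b)"
      by (simp add: if_distrib[of "\<lambda>x. x * _"] cong: if_cong)
    finally show ?thesis .
  qed
  ultimately show ?thesis
    unfolding centred_gaussian_vector_def gaussian_vector_def covariance_def
    using M(1) by simp
qed

lemma exists_std_normals:
  "\<exists>(M :: ('k::finite \<Rightarrow> real) measure) Z. prob_space M \<and>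
     prob_space.indep_vars M (\<lambda>_. borel) Z (UNIV :: 'k set) \<and>
     (\<forall>k. distributed M lborel (Z k) std_normal_density)"
proof -
  let ?N = "density lborel std_normal_density"
  define M where "M = PiM (UNIV :: 'k set) (\<lambda>_. ?N)"
  define Z where "Z = (\<lambda>(k::'k) (\<omega>::'k \<Rightarrow> real). \<omega> k)"
  have N: "prob_space ?N" by (rule prob_space_normal_density) simp
  have P: "prob_space M" unfolding M_def by (rule prob_space_PiM) (rule N)
  have sets_N: "sets ?N = sets borel" by simp
  have sM: "sets M = sets (PiM UNIV (\<lambda>_. borel))"
    unfolding M_def by (rule sets_PiM_cong) simp_all
  have Zm[measurable]: "Z k \<in> borel_measurable M" for k
    unfolding Z_def using sM by measurable
  have dist: "distr M borel (Z k) = ?N" for k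
  proof -
    have "distr M ?N (\<lambda>\<omega>. \<omega> k) = ?N"
      unfolding M_def by (rule distr_PiM_component) (auto intro: N)
    then show ?thesis unfolding Z_def by (metis distr_cong sets_N)
  qed
  have "prob_space.indep_vars M (\<lambda>_. borel) Z UNIV"
  proof (subst prob_space.indep_vars_iff_distr_eq_PiM[OF P])
    have "distr M (PiM UNIV (\<lambda>_. borel)) (\<lambda>\<omega>. \<lambda>k\<in>UNIV. Z k \<omega>) = distr M M (\<lambda>\<omega>. \<omega>)"
      by (rule distr_cong) (auto simp: sM Z_def)
    also have "\<dots> = PiM UNIV (\<lambda>k. distr M borel (Z k))"
      by (simp add: dist, simp add: M_def)
    finally show "distr M (PiM UNIV (\<lambda>_. borel)) (\<lambda>\<omega>. \<lambda>k\<in>UNIV. Z k \<omega>) 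
      = PiM UNIV (\<lambda>k. distr M borel (Z k))" .
  qed auto
  moreover have "distributed M lborel (Z k) std_normal_density" for k
    unfolding distributed_def using dist[of k] Zm by (simp cong: distr_cong)
  ultimately show ?thesis using P by blast
qed

lemma limit_cov_gaussian_exists:
  fixes i :: "'d::finite \<Rightarrow> nat"
  assumes "0 < \<theta>" "inj i"
  shows "\<exists>(M :: ('d option \<Rightarrow> real) measure) N. centred_gaussian_vector M N (limit_cov \<theta> i)"
proof -
  define w where "w k = \<theta> ^ k / fact k * exp (- \<theta>)" for k :: nat
  define q where "q = (\<Sum>a\<in>UNIV. w (i a))"
  have wpos: "w k > 0" for k using assms by (simp add: w_def)
  have "(\<lambda>k. w k) sums (exp \<theta> * exp (- \<theta>))"
    unfolding w_def using exp_converges[of \<theta>]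
    by (intro sums_mult2) (simp add: field_simps)
  then have ws: "summable w" "suminf w = 1"
    by (auto simp: sums_iff mult_exp_exp)
  have "q = sum w (range i)"
    unfolding q_def using assms by (simp add: sum.reindex)
  also have "\<dots> \<le> suminf w"
    by (rule sum_le_suminf) (use ws wpos less_imp_le in auto)
  finally have q1: "q \<le> 1" using ws by simp
  have q0: "q > 0" unfolding q_def by (rule sum_pos) (auto simp: wpos)
  define s where "s = (1 - sqrt (1 - q)) / q"
  have s: "q * s\<^sup>2 - 2 * s = -1"
  proof -
    have "(1 - sqrt (1 - q))\<^sup>2 - 2 * (1 - sqrt (1 - q)) = - q"
      using q1 by (simp add: power2_eq_square algebra_simps)
    then show ?thesis using q0 by (simp add: s_def field_simps power2_eq_square)
  qed
  define A :: "'d option \<Rightarrow> real ^ 'd" where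
    "A k = (case k of None \<Rightarrow> (\<chi> a. (real (i a) - \<theta>) * w (i a) / sqrt \<theta>)
       | Some l \<Rightarrow> (\<chi> a. (if a = l then sqrt (w (i a)) else 0) - s * w (i a) * sqrt (w (i l))))" for k
  have "(\<Sum>k\<in>UNIV. A k $ a * A k $ b) = limit_cov \<theta> i $ a $ b" for a b
  proof -
    let ?r = "\<lambda>a. sqrt (w (i a))"
    have r: "?r a * ?r a = w (i a)" for a using wpos[of "i a"] by simp
    have "(\<Sum>l\<in>UNIV. A (Some l) $ a * A (Some l) $ b) =
      (\<Sum>l\<in>UNIV. (if a = l then (if b = l then ?r a * ?r b else 0) else 0)
         - (if a = l then s * w (i b) * (?r a * ?r l) else 0)
         - (if b = l then s * w (i a) * (?r b * ?r l) else 0)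
         + s\<^sup>2 * w (i a) * w (i b) * (?r l * ?r l))"
      unfolding A_def by (intro sum.cong) (auto simp: algebra_simps power2_eq_square)
    also have "\<dots> = (if a = b then w (i a) else 0) + w (i a) * w (i b) * (q * s\<^sup>2 - 2 * s)"
      unfolding sum.distrib sum_subtractf r q_def sum_distrib_left[symmetric]
      using r by (auto simp: algebra_simps)
    finally have S: "(\<Sum>l\<in>UNIV. A (Some l) $ a * A (Some l) $ b) =
      (if a = b then w (i a) else 0) - w (i a) * w (i b)" using s by simp
    have "(\<Sum>k\<in>UNIV. A k $ a * A k $ b) =
      A None $ a * A None $ b + (\<Sum>l\<in>UNIV. A (Some l) $ a * A (Some l) $ b)"
      by (simp add: UNIV_option_conv sum.reindex)
    also have "A None $ a * A None $ b =
       (real (i a) - \<theta>) * (real (i b) - \<theta>) / \<theta> * (w (i a) * w (i b))"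
      using assms by (simp add: A_def field_simps)
    also have "\<dots> + (\<Sum>l\<in>UNIV. A (Some l) $ a * A (Some l) $ b) =
      w (i a) * w (i b) * ((real (i a) - \<theta>) * (real (i b) - \<theta>) / \<theta> - 1) + (if a = b then w (i a) else 0)"
      unfolding S by (simp add: algebra_simps)
    also have "w (i a) * w (i b) = \<theta> ^ (i a + i b) / (fact (i a) * fact (i b)) * exp (- 2 * \<theta>)"
    proof -
      have "exp (- 2 * \<theta>) = exp (- \<theta>) * exp (- \<theta>)" by (simp flip: exp_add)
      then show ?thesis by (simp add: w_def power_add)
    qed
    finally show ?thesis by (simp add: limit_cov_def w_def)
  qed
  then have *: "(\<chi> a b. \<Sum>k\<in>UNIV. A k $ a * A k $ b) = limit_cov \<theta> i"
    by (simp add: vec_eq_iff)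
  obtain M :: "('d option \<Rightarrow> real) measure" and Z where
    "prob_space M" "prob_space.indep_vars M (\<lambda>_. borel) Z (UNIV :: 'd option set)"
    "\<And>k. distributed M lborel (Z k) std_normal_density"
    using exists_std_normals[where 'k = "'d option"] by blast
  from centred_gaussian_vector_linear_map[OF this, of A] show ?thesis
    unfolding * by blast
qed

end

theory Submission
  imports Defs "HOL-Real_Asymp.Real_Asymp"
begin

text \<open>Let \<open>X\<close> be the normalized vector of degree counts. On the path
  \<open>s \<mapsto> E g (sin s X + cos s N)\<close>, with \<open>N\<close> independent of \<open>X\<close>, the derivative is controlled by the
  Stein discrepancy \<open>E (X\<^sub>a \<phi>(X)) - (\<Sum>b. \<Sigma>\<^sub>a\<^sub>b E (\<partial>\<^sub>b \<phi>(X)))\<close>, because the same expression with \<open>N\<close> in place of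
  \<open>X\<close> vanishes. To bound the discrepancy, write \<open>X\<^sub>a\<close> as a sum over vertices \<open>v\<close> of centred indicators
  \<open>\<xi>\<close> of \<open>deg v = i\<^sub>a\<close>, and expand \<open>\<phi>(X)\<close> around the degree counts of the graph \<open>G\<close> with \<open>v\<close> deleted. The
  neighbourhood of \<open>v\<close> is independent of \<open>G\<close>, so the zeroth order term vanishes, and the conditional
  expectation of \<open>\<xi>\<close> times the increment of the count of degree \<open>l\<close> is an explicit affine function of the
  counts of degrees \<open>l - 1\<close> and \<open>l\<close> in \<open>G\<close>. The same identity with linear \<open>\<phi>\<close> shows that the counts have
  variance \<open>O(n)\<close>, so this random covariance is within \<open>O(1/sqrt n)\<close> of its limit \<open>\<Sigma>\<close>.\<close>

section \<open>Functions with Lipschitz partial derivatives\<close>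

text \<open>The covariance matrix is not assumed invertible and Gaussian vectors are given only
  through their one-dimensional projections, so there is no density to integrate by parts against.
  Rotation invariance of the law replaces it, and proving that invariance is what calls for a
  multidimensional uniqueness theorem. Test functions are only partially differentiable, so
  expansions are obtained by moving along coordinate axes, which makes the l1 norm the natural
  gauge. The class \<open>C11\<close> is stable under \<open>x \<mapsto> f (y + s x)\<close> with
  \<open>\<bar>s\<bar> \<le> 1\<close>; hence the discrepancy bound for \<open>X\<close> applies on
  the path while the Gaussian argument is frozen. Origin of the rate: one vertex moves
  \<open>X\<close> by its degree plus one, divided by \<open>sqrt n\<close>, and degrees have
  bounded second moment, so the expansion at one vertex costs \<open>O(1/n)\<close>. Summing over
  \<open>n\<close> vertices with the factor \<open>1/sqrt n\<close> of the normalization leaves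
  \<open>O(1/sqrt n)\<close>. The conditional covariance first appears in terms of \<open>G\<close>,
  which depends on \<open>v\<close>; it is moved to the whole graph so that it can be collected over
  all \<open>v\<close>.\<close>

definition l1norm :: "real ^ 'd::finite \<Rightarrow> real" where
  "l1norm x = (\<Sum>a\<in>UNIV. \<bar>x $ a\<bar>)"

lemma l1norm_nonneg [simp]: "0 \<le> l1norm x"
  by (simp add: l1norm_def sum_nonneg)

lemma l1norm_triangle: "l1norm (x + y) \<le> l1norm x + l1norm y"
  unfolding l1norm_def sum.distrib[symmetric] by (intro sum_mono) (simp add: abs_triangle_ineq)

lemma l1norm_scale: "l1norm (t *\<^sub>R x) = \<bar>t\<bar> * l1norm x"
  by (simp add: l1norm_def abs_mult sum_distrib_left)

lemma l1norm_component: "\<bar>x $ a\<bar> \<le> l1norm x"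
  unfolding l1norm_def by (rule member_le_sum) auto

lemma l1norm_le_norm: "l1norm (x :: real ^ 'd::finite) \<le> real CARD('d) * norm x"
  unfolding l1norm_def by (rule sum_bounded_above) (simp add: component_le_norm_cart)

lemma continuous_on_l1norm [continuous_intros]: "continuous_on S l1norm"
  unfolding l1norm_def by (intro continuous_intros)

lemma measurable_l1norm [measurable]: "l1norm \<in> borel_measurable borel"
  using continuous_on_l1norm by (rule borel_measurable_continuous_onI)

text \<open>Changing one coordinate at a time reduces the estimate to the mean value inequality on
  axis-parallel segments, all of whose points lie within l1 distance \<open>l1norm D\<close> of
  \<open>x\<close>. The free coefficients \<open>c\<close> serve two uses: \<open>c = 0\<close>
  yields a Lipschitz bound, \<open>c a = F a x\<close> a Taylor remainder.\<close>

lemma coordinate_walk: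
  fixes f :: "real ^ 'd::finite \<Rightarrow> real"
  assumes d: "\<And>a z. ((\<lambda>t. f (z + t *\<^sub>R axis a 1)) has_real_derivative F a z) (at 0)"
    and L: "\<And>a h. l1norm h \<le> l1norm D \<Longrightarrow> \<bar>F a (x + h) - c a\<bar> \<le> K"
  shows "\<bar>f (x + D) - f x - (\<Sum>a\<in>UNIV. c a * D $ a)\<bar> \<le> K * l1norm D"
proof -
  define P where "P S = (\<chi> a. if a \<in> S then D $ a else 0)" for S
  have "\<bar>f (x + P S) - f x - (\<Sum>a\<in>S. c a * D $ a)\<bar> \<le> K * (\<Sum>a\<in>S. \<bar>D $ a\<bar>)" if "finite S" for S
    using that
  proof (induction S rule: finite_induct)
    case empty
    have "P {} = 0" by (simp add: P_def vec_eq_iff)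
    then show ?case by simp
  next
    case (insert b S)
    \<comment> \<open>The linear part is subtracted so that the derivative of \<open>q\<close> is
      exactly the quantity bounded by \<open>K\<close>.\<close>
    define q where "q t = f (x + P S + t *\<^sub>R axis b 1) - c b * t" for t
    have q: "(q has_real_derivative F b (x + P S + t *\<^sub>R axis b 1) - c b) (at t)" for t
    proof -
      have "((\<lambda>s. f (x + P S + t *\<^sub>R axis b 1 + s *\<^sub>R axis b 1)) has_real_derivative
          F b (x + P S + t *\<^sub>R axis b 1)) (at (t - t))"
        using d[of "x + P S + t *\<^sub>R axis b 1" b] by simp
      then have "((\<lambda>s. f (x + P S + t *\<^sub>R axis b 1 + (s - t) *\<^sub>R axis b 1)) has_real_derivative
          F b (x + P S + t *\<^sub>R axis b 1)) (at t)"
        using DERIV_shift[of "\<lambda>s. f (x + P S + t *\<^sub>R axis b 1 + s *\<^sub>R axis b 1)" _ t "-t"]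
        by (simp only: diff_conv_add_uminus)
      then have "((\<lambda>s. f (x + P S + s *\<^sub>R axis b 1)) has_real_derivative
          F b (x + P S + t *\<^sub>R axis b 1)) (at t)"
        by (simp add: add.assoc flip: scaleR_add_left)
      then show ?thesis unfolding q_def by (auto intro!: derivative_eq_intros)
    qed
    have small: "l1norm (P S + t *\<^sub>R axis b 1) \<le> l1norm D" if "\<bar>t\<bar> \<le> \<bar>D $ b\<bar>" for t
      unfolding l1norm_def using insert(2) that
      by (intro sum_mono) (auto simp: P_def axis_def)
    have step: "\<bar>q (D $ b) - q 0\<bar> \<le> K * \<bar>D $ b - 0\<bar>"
    proof -
      have "norm (q (D $ b) - q 0) \<le> K * norm (D $ b - 0)"
      proof (rule field_differentiable_bound[of "{- \<bar>D $ b\<bar>..\<bar>D $ b\<bar>}"])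
        fix t assume t: "t \<in> {- \<bar>D $ b\<bar>..\<bar>D $ b\<bar>}"
        show "(q has_field_derivative F b (x + P S + t *\<^sub>R axis b 1) - c b) (at t within {- \<bar>D $ b\<bar>..\<bar>D $ b\<bar>})"
          using q by (rule has_field_derivative_at_within)
        show "norm (F b (x + P S + t *\<^sub>R axis b 1) - c b) \<le> K"
          using L[OF small[of t], of b] t by (auto simp: add.assoc)
      qed auto
      then show ?thesis by simp
    qed
    have "P (insert b S) = P S + (D $ b) *\<^sub>R axis b 1"
      using insert(2) by (auto simp: P_def vec_eq_iff axis_def)
    then have "f (x + P (insert b S)) - f x - (\<Sum>a\<in>insert b S. c a * D $ a)
      = (f (x + P S) - f x - (\<Sum>a\<in>S. c a * D $ a)) + (q (D $ b) - q 0)"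
      using insert(1,2) by (simp add: q_def add.assoc)
    then show ?case using insert step by (simp add: algebra_simps)
  qed
  from this[of UNIV] show ?thesis
    by (simp add: P_def l1norm_def)
qed

text \<open>A remainder of order \<open>h\<^sup>2\<close> survives sums and integrals, so a
  derivative can be read off after integrating an expansion.\<close>

lemma real_derivative_quadratic_remainder:
  fixes q :: "real \<Rightarrow> real"
  assumes "\<And>h. \<bar>q (t + h) - q t - h * m\<bar> \<le> C * h\<^sup>2"
  shows "(q has_real_derivative m) (at t)"
proof -
  have "((\<lambda>h. (q (t + h) - q t) / h - m) \<longlongrightarrow> 0) (at 0)"
  proof (rule Lim_null_comparison)
    show "\<forall>\<^sub>F h in at 0. norm ((q (t + h) - q t) / h - m) \<le> C * \<bar>h\<bar>"
    proof (rule eventually_mono[OF eventually_neq_at_within[of 0]])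
      fix h :: real assume h: "h \<noteq> 0"
      have "norm ((q (t + h) - q t) / h - m) = \<bar>q (t + h) - q t - h * m\<bar> / \<bar>h\<bar>"
        using h by (simp add: field_simps flip: abs_divide)
      also have "\<dots> \<le> C * h\<^sup>2 / \<bar>h\<bar>" by (intro divide_right_mono assms) simp
      also have "\<dots> = C * \<bar>h\<bar>" using h by (simp add: field_simps power2_eq_square abs_mult_self_eq)
      finally show "norm ((q (t + h) - q t) / h - m) \<le> C * \<bar>h\<bar>" .
    qed
    show "((\<lambda>h. C * \<bar>h\<bar>) \<longlongrightarrow> 0) (at (0::real))"
      by (auto intro!: tendsto_eq_intros)
  qed
  then show ?thesis unfolding DERIV_def by (simp add: LIM_zero_iff)
qed

text \<open>The second condition forces \<open>f1 a\<close> to be the partial derivative of \<open>f\<close> in direction \<open>a\<close>; stating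
  it with the remainder bound keeps all constants equal to 1.\<close>

definition C11 :: "(real ^ 'd::finite \<Rightarrow> real) \<Rightarrow> ('d \<Rightarrow> real ^ 'd \<Rightarrow> real) \<Rightarrow> bool" where
  "C11 f f1 \<longleftrightarrow>
     (\<forall>x D. \<bar>f (x + D) - f x\<bar> \<le> l1norm D) \<and>
     (\<forall>x D. \<bar>f (x + D) - f x - (\<Sum>a\<in>UNIV. f1 a x * D $ a)\<bar> \<le> (l1norm D)\<^sup>2) \<and>
     (\<forall>a x. \<bar>f1 a x\<bar> \<le> 1) \<and>
     (\<forall>a x D. \<bar>f1 a (x + D) - f1 a x\<bar> \<le> l1norm D)"

lemma C11_lipschitz: "C11 f f1 \<Longrightarrow> \<bar>f (x + D) - f x\<bar> \<le> l1norm D"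
  and C11_taylor:
    "C11 f f1 \<Longrightarrow> \<bar>f (x + D) - f x - (\<Sum>a\<in>UNIV. f1 a x * D $ a)\<bar> \<le> (l1norm D)\<^sup>2"
  and C11_partial_bound: "C11 f f1 \<Longrightarrow> \<bar>f1 a x\<bar> \<le> 1"
  and C11_partial_lipschitz: "C11 f f1 \<Longrightarrow> \<bar>f1 a (x + D) - f1 a x\<bar> \<le> l1norm D"
  unfolding C11_def by blast+

text \<open>Bounded second partials make each \<open>F a\<close> Lipschitz in the l1 norm. Along the
  coordinate walk \<open>F a\<close> then differs from \<open>F a x\<close> by at most
  \<open>l1norm D\<close>, which gives the quadratic remainder.\<close>

lemma C11_partials:
  fixes f :: "real ^ 'd::finite \<Rightarrow> real"
  assumes d: "\<And>a z. ((\<lambda>t. f (z + t *\<^sub>R axis a 1)) has_real_derivative F a z) (at 0)"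
    and d2: "\<And>a b z. ((\<lambda>t. F a (z + t *\<^sub>R axis b 1)) has_real_derivative G a b z) (at 0)"
    and F: "\<And>a z. \<bar>F a z\<bar> \<le> 1" and G: "\<And>a b z. \<bar>G a b z\<bar> \<le> 1"
  shows "C11 f F"
proof -
  have lip: "\<bar>F a (x + D) - F a x\<bar> \<le> l1norm D" for a x D
    using coordinate_walk[OF d2, where D = D and x = x and c = "\<lambda>_. 0" and K = 1] G by simp
  show ?thesis unfolding C11_def
  proof (intro conjI allI lip F)
    fix x D :: "real ^ 'd"
    show "\<bar>f (x + D) - f x\<bar> \<le> l1norm D"
      using coordinate_walk[OF d, where D = D and x = x and c = "\<lambda>_. 0" and K = 1] F by simp
    show "\<bar>f (x + D) - f x - (\<Sum>a\<in>UNIV. F a x * D $ a)\<bar> \<le> (l1norm D)\<^sup>2"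
      unfolding power2_eq_square
    proof (rule coordinate_walk[OF d])
      fix a and h :: "real ^ 'd" assume "l1norm h \<le> l1norm D"
      then show "\<bar>F a (x + h) - F a x\<bar> \<le> l1norm D" using lip[of a x h] by linarith
    qed
  qed
qed

text \<open>Inner scaling multiplies increments and gradients by \<open>s\<close>, and
  \<open>\<bar>s\<bar> \<le> 1\<close> keeps every constant at 1. It is used with \<open>s\<close>
  equal to a sine or cosine of the path parameter.\<close>

lemma C11_affine:
  assumes "C11 f f1" "\<bar>s\<bar> \<le> 1"
  shows "C11 (\<lambda>x. f (y + s *\<^sub>R x)) (\<lambda>a x. s * f1 a (y + s *\<^sub>R x))"
proof -
  have s2: "s\<^sup>2 \<le> 1" using assms(2) by (simp add: abs_square_le_1)
  have l: "\<bar>s\<bar> * l1norm D \<le> l1norm D" for D :: "real ^ 'a"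
    using mult_right_mono[OF assms(2), of "l1norm D"] by simp
  show ?thesis unfolding C11_def
  proof (intro conjI allI)
    fix x D :: "real ^ 'a" and a
    note * =
      C11_lipschitz[OF assms(1), of "y + s *\<^sub>R x" "s *\<^sub>R D", unfolded l1norm_scale]
      C11_taylor[OF assms(1), of "y + s *\<^sub>R x" "s *\<^sub>R D", unfolded l1norm_scale]
      C11_partial_bound[OF assms(1), where x = "y + s *\<^sub>R x"]
      C11_partial_lipschitz[OF assms(1), where x = "y + s *\<^sub>R x" and D = "s *\<^sub>R D", unfolded l1norm_scale]
    have e: "y + s *\<^sub>R (x + D) = y + s *\<^sub>R x + s *\<^sub>R D" by (simp add: algebra_simps)
    show "\<bar>f (y + s *\<^sub>R (x + D)) - f (y + s *\<^sub>R x)\<bar> \<le> l1norm D"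
      unfolding e using *(1) l[of D] by linarith
    have "\<bar>f (y + s *\<^sub>R (x + D)) - f (y + s *\<^sub>R x) - (\<Sum>a\<in>UNIV. s * f1 a (y + s *\<^sub>R x) * D $ a)\<bar>
        \<le> (\<bar>s\<bar> * l1norm D)\<^sup>2"
      unfolding e using *(2) by (simp add: mult_ac)
    also have "\<dots> \<le> (l1norm D)\<^sup>2" using l[of D] by (intro power_mono) auto
    finally show "\<bar>f (y + s *\<^sub>R (x + D)) - f (y + s *\<^sub>R x) - (\<Sum>a\<in>UNIV. s * f1 a (y + s *\<^sub>R x) * D $ a)\<bar>
        \<le> (l1norm D)\<^sup>2" .
    show "\<bar>s * f1 a (y + s *\<^sub>R x)\<bar> \<le> 1"
      using mult_mono[OF assms(2) *(3)[of a]] by (simp add: abs_mult)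
    have "\<bar>s * f1 a (y + s *\<^sub>R (x + D)) - s * f1 a (y + s *\<^sub>R x)\<bar>
        = \<bar>s\<bar> * \<bar>f1 a (y + s *\<^sub>R x + s *\<^sub>R D) - f1 a (y + s *\<^sub>R x)\<bar>"
      unfolding e by (simp add: abs_mult flip: right_diff_distrib)
    also have "\<dots> \<le> 1 * l1norm D"
      using *(4)[of a] l[of D] by (intro mult_mono assms) auto
    finally show "\<bar>s * f1 a (y + s *\<^sub>R (x + D)) - s * f1 a (y + s *\<^sub>R x)\<bar> \<le> l1norm D" by simp
  qed
qed

lemma C11_derivative_line:
  assumes "C11 f f1"
  shows "((\<lambda>t. f (x + t *\<^sub>R D)) has_real_derivative (\<Sum>a\<in>UNIV. f1 a (x + t *\<^sub>R D) * D $ a)) (at t)"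
proof (rule real_derivative_quadratic_remainder)
  fix h
  show "\<bar>f (x + (t + h) *\<^sub>R D) - f (x + t *\<^sub>R D) - h * (\<Sum>a\<in>UNIV. f1 a (x + t *\<^sub>R D) * D $ a)\<bar>
      \<le> (l1norm D)\<^sup>2 * h\<^sup>2"
    using C11_taylor[OF assms, of "x + t *\<^sub>R D" "h *\<^sub>R D"]
    by (simp add: l1norm_scale power_mult_distrib algebra_simps sum_distrib_left)
qed

text \<open>On the segment from \<open>x\<close> to \<open>x + D\<close>, the derivative of
  \<open>f\<close> minus its quadratic polynomial is a combination of first-order remainders of the
  \<open>f1 a\<close>, each at most the squared l1 norm of the step. The mean value theorem
  finishes; no sharp constant is sought.\<close>

lemma second_order_taylor:
  assumes f: "C11 f f1" and f1: "\<And>a. C11 (f1 a) (f2 a)"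
  shows "\<bar>f (x + D) - f x - (\<Sum>a\<in>UNIV. f1 a x * D $ a)
      - (\<Sum>a\<in>UNIV. \<Sum>b\<in>UNIV. f2 a b x * D $ a * D $ b) / 2\<bar> \<le> (l1norm D) ^ 3"
proof -
  define S1 where "S1 = (\<Sum>a\<in>UNIV. f1 a x * D $ a)"
  define S2 where "S2 = (\<Sum>a\<in>UNIV. \<Sum>b\<in>UNIV. f2 a b x * D $ a * D $ b)"
  define r where "r t = f (x + t *\<^sub>R D) - t * S1 - t\<^sup>2 / 2 * S2" for t
  define r' where "r' t = (\<Sum>a\<in>UNIV. (f1 a (x + t *\<^sub>R D) - f1 a x - (\<Sum>b\<in>UNIV. f2 a b x * (t *\<^sub>R D) $ b)) * D $ a)" for t
  have r'_eq: "r' t = (\<Sum>a\<in>UNIV. f1 a (x + t *\<^sub>R D) * D $ a) - S1 - t * S2" for t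
    unfolding r'_def S1_def S2_def
    by (simp add: left_diff_distrib right_diff_distrib sum_subtractf sum_distrib_left sum_distrib_right mult_ac)
  have d: "(r has_real_derivative r' t) (at t)" for t
    unfolding r_def r'_eq
    by (auto intro!: derivative_eq_intros C11_derivative_line[OF f])
  have b: "\<bar>r' t\<bar> \<le> l1norm D ^ 3" if "0 \<le> t" "t \<le> 1" for t
  proof -
    have "\<bar>r' t\<bar> \<le> (\<Sum>a\<in>UNIV. (l1norm (t *\<^sub>R D))\<^sup>2 * \<bar>D $ a\<bar>)"
      unfolding r'_def using C11_taylor[OF f1, where x = x and D = "t *\<^sub>R D"]
      by (intro order_trans[OF sum_abs] sum_mono) (simp only: abs_mult, intro mult_right_mono, auto)
    also have "\<dots> = t\<^sup>2 * l1norm D ^ 3"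
      by (simp add: l1norm_scale power_mult_distrib power3_eq_cube power2_eq_square flip: sum_distrib_left l1norm_def)
    also have "\<dots> \<le> 1 * l1norm D ^ 3"
      using that by (intro mult_right_mono) (auto simp: power_le_one)
    finally show ?thesis by simp
  qed
  obtain z where z: "0 < z" "z < 1" "r 1 - r 0 = (1 - 0) * r' z"
    using MVT2[of 0 1 r r'] d by auto
  then have "\<bar>r 1 - r 0\<bar> \<le> l1norm D ^ 3" using b[of z] by simp
  then show ?thesis by (simp add: r_def S1_def S2_def)
qed

lemma continuous_on_l1_lipschitz:
  fixes f :: "real ^ 'd::finite \<Rightarrow> real"
  assumes "\<And>x D. \<bar>f (x + D) - f x\<bar> \<le> l1norm D"
  shows "continuous_on UNIV f"
proof -
  have "\<bar>f y - f x\<bar> \<le> real CARD('d) * dist y x" for x y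
    using assms[of x "y - x"] l1norm_le_norm[of "y - x"] by (simp add: dist_norm)
  then have "(real CARD('d))-lipschitz_on UNIV f"
    by (intro lipschitz_onI) (auto simp: dist_real_def dist_commute)
  then show ?thesis by (rule lipschitz_on_continuous_on)
qed

text \<open>The supremum bounds give pointwise bounds by 1 on iterated partials, and
  \<open>C11_partials\<close> converts bounds on the derivatives of the next orders into Lipschitz
  estimates and expansions.\<close>

lemma d4_test_functions_C11:
  fixes g :: "real ^ 'd::finite \<Rightarrow> real"
  assumes "g \<in> d4_test_functions"
  shows "C11 g (\<lambda>a. partial_deriv a g)"
    "\<And>a. C11 (partial_deriv a g) (\<lambda>b. partial_deriv b (partial_deriv a g))"
proof -
  have bound: "\<bar>iterated_partial js g x\<bar> \<le> 1" if "length js \<in> {1..4}" for js x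
  proof -
    have "ereal \<bar>iterated_partial js g x\<bar> \<le> (SUP x. ereal \<bar>iterated_partial js g x\<bar>)"
      by (rule SUP_upper) simp
    also have "\<dots> \<le> sup_partials (length js) g"
      unfolding sup_partials_def by (rule SUP_upper) simp
    also have "\<dots> \<le> 1" using assms that unfolding d4_test_functions_def by blast
    finally show ?thesis by (simp flip: one_ereal_def)
  qed
  have diff: "((\<lambda>t. iterated_partial js g (x + t *\<^sub>R axis j 1)) has_real_derivative
      iterated_partial (j # js) g x) (at 0)" if "length js < 4" for js j x
  proof -
    have "line_through j (iterated_partial js g) x differentiable (at 0)"
      using assms that unfolding d4_test_functions_def times_partially_differentiable_def by blast
    then show ?thesis
      by (simp add: DERIV_deriv_iff_real_differentiable[symmetric] partial_deriv_def line_through_def)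
  qed
  show "C11 g (\<lambda>a. partial_deriv a g)"
    by (rule C11_partials[where G = "\<lambda>a b. partial_deriv b (partial_deriv a g)"])
      (use diff[of "[]"] diff[of "[_]"] bound[of "[_]"] bound[of "[_,_]"] in simp_all)
  show "C11 (partial_deriv a g) (\<lambda>b. partial_deriv b (partial_deriv a g))" for a
    by (rule C11_partials[where G = "\<lambda>b c. partial_deriv c (partial_deriv b (partial_deriv a g))"])
      (use diff[of "[_]"] diff[of "[_,_]"] bound[of "[_,_]"] bound[of "[_,_,_]"] in simp_all)
qed

section \<open>A law on a Euclidean space is determined by its trigonometric moments\<close>

lemma (in prob_space) integrable_bounded_real:
  fixes f :: "'a \<Rightarrow> real"
  assumes "f \<in> borel_measurable M" "\<And>x. \<bar>f x\<bar> \<le> B"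
  shows "integrable M f"
  by (rule integrable_const_bound[of _ B]) (use assms in auto)

lemma char_distr_density:
  fixes X :: "'a \<Rightarrow> real" and w :: "'a \<Rightarrow> real"
  assumes "prob_space M" and [measurable]: "X \<in> borel_measurable M" "w \<in> borel_measurable M"
    and w: "\<And>x. 0 \<le> w x" "\<And>x. w x \<le> B"
  shows "char (distr (density M w) borel X) s =
    Complex (\<integral>x. w x * cos (s * X x) \<partial>M) (\<integral>x. w x * sin (s * X x) \<partial>M)"
proof -
  interpret prob_space M by fact
  have i: "integrable M (\<lambda>x. w x *\<^sub>R iexp (s * X x))"
    by (rule integrable_const_bound[of _ B]) (use w in \<open>auto simp: norm_mult\<close>)
  have re: "Re (w x *\<^sub>R iexp (s * X x)) = w x * cos (s * X x)"
    and im: "Im (w x *\<^sub>R iexp (s * X x)) = w x * sin (s * X x)" for x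
    by (simp_all add: Re_exp Im_exp)
  have "char (distr (density M w) borel X) s = (\<integral>x. iexp (s * X x) \<partial>density M w)"
    unfolding char_def by (subst integral_distr) auto
  also have "\<dots> = (\<integral>x. w x *\<^sub>R iexp (s * X x) \<partial>M)"
    by (subst integral_density) (use w in auto)
  also have "\<dots> = Complex (\<integral>x. w x * cos (s * X x) \<partial>M) (\<integral>x. w x * sin (s * X x) \<partial>M)"
    using integral_Re[OF i] integral_Im[OF i] unfolding re im by (simp add: complex_eq_iff)
  finally show ?thesis .
qed

text \<open>Weights turn the one-dimensional uniqueness theorem into a statement about one coordinate
  at a time, which makes the multidimensional uniqueness theorem accessible by induction on
  the coordinates.\<close>

lemma weighted_Levy_uniqueness:
  fixes X w :: "'a \<Rightarrow> real"
  assumes P: "prob_space M" "prob_space N" and sets: "sets N = sets M"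
    and m [measurable]: "X \<in> borel_measurable M" "w \<in> borel_measurable M"
    and w: "\<And>x. 0 \<le> w x" "\<And>x. w x \<le> B"
    and c: "\<And>s. (\<integral>x. w x * cos (s * X x) \<partial>M) = (\<integral>x. w x * cos (s * X x) \<partial>N)"
    and s: "\<And>s. (\<integral>x. w x * sin (s * X x) \<partial>M) = (\<integral>x. w x * sin (s * X x) \<partial>N)"
    and A: "A \<in> sets borel"
  shows "(\<integral>x. w x * indicator A (X x) \<partial>M) = (\<integral>x. w x * indicator A (X x) \<partial>N)"
proof -
  define r where "r = (\<integral>x. w x \<partial>M)"
  \<comment> \<open>At frequency 0 the cosine moment is the total weight, so both measures give
    \<open>w\<close> the same mass.\<close>
  have rN: "r = (\<integral>x. w x \<partial>N)" using c[of 0] by (simp add: r_def)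
  have mN [measurable]: "X \<in> borel_measurable N" "w \<in> borel_measurable N"
    using m unfolding measurable_cong_sets[OF sets refl] .
  have int: "integrable K w" if "prob_space K" "w \<in> borel_measurable K" for K
    by (rule prob_space.integrable_bounded_real[OF that, of B]) (use w in \<open>auto simp: abs_of_nonneg\<close>)
  have intMN: "integrable M w" "integrable N w" using int[OF P(1) m(2)] int[OF P(2) mN(2)] .
  show ?thesis
  proof (cases "r = 0")
    case True
    have "AE x in M. w x = 0" "AE x in N. w x = 0"
      using True rN integral_nonneg_eq_0_iff_AE[OF intMN(1)] integral_nonneg_eq_0_iff_AE[OF intMN(2)] w
      by (auto simp: r_def)
    then have "(\<integral>x. w x * indicator A (X x) \<partial>M) = 0" "(\<integral>x. w x * indicator A (X x) \<partial>N) = 0"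
      using A by (auto intro!: integral_eq_zero_AE elim: eventually_mono)
    then show ?thesis by simp
  next
    case False
    have r0: "r > 0" using False w Bochner_Integration.integral_nonneg[of M w] by (simp add: r_def order_less_le)
    \<comment> \<open>Normalizing the weight makes both weighted laws of \<open>X\<close>
      probability measures, as the one-dimensional theorem requires.\<close>
    define v where "v x = w x / r" for x
    have v: "0 \<le> v x" "v x \<le> B / r" for x using w r0 by (auto simp: v_def divide_right_mono)
    have [measurable]: "v \<in> borel_measurable M" "v \<in> borel_measurable N"
      unfolding v_def by measurable
    have rd: "real_distribution (distr (density K v) borel X)"
      if K: "prob_space K" "integrable K w" "(\<integral>x. w x \<partial>K) = r" "X \<in> borel_measurable K" "v \<in> borel_measurable K" for K
    proof -
      have "emeasure (density K v) (space K) = (\<integral>\<^sup>+x. v x \<partial>K)"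
        using K by (subst emeasure_density) (auto intro!: nn_integral_cong)
      also have "\<dots> = ennreal (\<integral>x. v x \<partial>K)"
        using K v by (intro nn_integral_eq_integral) (auto simp: v_def)
      also have "(\<integral>x. v x \<partial>K) = 1" using K r0 by (simp add: v_def)
      finally have "prob_space (density K v)" by (intro prob_spaceI) simp
      from prob_space.prob_space_distr[OF this, of X borel] K
      show ?thesis by (auto simp: real_distribution_def real_distribution_axioms_def)
    qed
    have vc: "(\<integral>x. v x * f x \<partial>K) = (\<integral>x. w x * f x \<partial>K) / r" for f and K :: "'a measure"
      by (simp add: v_def)
    have "distr (density M v) borel X = distr (density N v) borel X"
    proof (rule Levy_uniqueness)
      show "char (distr (density M v) borel X) = char (distr (density N v) borel X)"
      proof
        fix u
        show "char (distr (density M v) borel X) u = char (distr (density N v) borel X) u"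
          unfolding char_distr_density[OF P(1) \<open>X \<in> borel_measurable M\<close> \<open>v \<in> borel_measurable M\<close> v]
            char_distr_density[OF P(2) \<open>X \<in> borel_measurable N\<close> \<open>v \<in> borel_measurable N\<close> v] vc c s ..
      qed
    qed (use rd P intMN rN in \<open>auto simp: r_def\<close>)
    then have "measure (distr (density M v) borel X) A = measure (distr (density N v) borel X) A"
      by simp
    moreover have "measure (distr (density K v) borel X) A = (\<integral>x. v x * indicator A (X x) \<partial>K)"
      if K: "X \<in> borel_measurable K" "v \<in> borel_measurable K" for K
    proof -
      have "measure (distr (density K v) borel X) A = (\<integral>x. indicator A x \<partial>distr (density K v) borel X)"
        using A by simp
      also have "\<dots> = (\<integral>x. indicator A (X x) \<partial>density K v)"
        using A K by (subst integral_distr) auto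
      also have "\<dots> = (\<integral>x. v x * indicator A (X x) \<partial>K)"
        using A K v by (subst integral_density) auto
      finally show ?thesis .
    qed
    ultimately show ?thesis using r0 by (simp add: vc)
  qed
qed

text \<open>Induction on a set \<open>S\<close> of coordinates: the trigonometric moments still
  agree when weighted by the indicator product \<open>R S A\<close>. Each step exchanges the
  frequency in one coordinate for an indicator. With all coordinates included, the measures agree on
  boxes, which generate the Borel sets.\<close>

lemma law_unique_trigonometric:
  fixes M N :: "(real ^ 'd::finite) measure"
  assumes P: "prob_space M" "prob_space N" and sM [measurable_cong]: "sets M = sets borel" and sN [measurable_cong]: "sets N = sets borel"
    and c: "\<And>t. (\<integral>x. cos (t \<bullet> x) \<partial>M) = (\<integral>x. cos (t \<bullet> x) \<partial>N)"
    and s: "\<And>t. (\<integral>x. sin (t \<bullet> x) \<partial>M) = (\<integral>x. sin (t \<bullet> x) \<partial>N)"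
  shows "M = N"
proof -
  define R where "R S A x = (\<Prod>j\<in>S. indicator (A j) (x $ j) :: real)" for S A and x :: "real ^ 'd"
  have Rb: "0 \<le> R S A x" "R S A x \<le> 1" for S A x
    unfolding R_def by (auto intro!: prod_nonneg prod_le_1)
  have agree: "\<forall>t. (\<integral>x. R S A x * cos (t \<bullet> x) \<partial>M) = (\<integral>x. R S A x * cos (t \<bullet> x) \<partial>N) \<and>
      (\<integral>x. R S A x * sin (t \<bullet> x) \<partial>M) = (\<integral>x. R S A x * sin (t \<bullet> x) \<partial>N)"
    if "finite S" and A: "\<And>j. A j \<in> sets borel" for S and A :: "'d \<Rightarrow> real set"
    using that(1)
  proof (induction S rule: finite_induct)
    case empty
    then show ?case by (simp add: R_def c s)
  next
    case (insert k S)
    have Rm [measurable]: "R S A \<in> borel_measurable borel"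
      unfolding R_def using A by measurable
    have RmM [measurable]: "R S A \<in> borel_measurable K" if "sets K = sets borel" for K
      using Rm unfolding measurable_cong_sets[OF that refl] .
    have e: "(s *\<^sub>R axis k 1 :: real ^ 'd) \<bullet> x = s * x $ k" for s x
      by (simp add: inner_axis' )
    have int: "integrable K (\<lambda>x. R S A x * cos (h x))" "integrable K (\<lambda>x. R S A x * sin (h x))"
        "integrable K (R S A)"
        "integrable K (\<lambda>x. R S A x * indicator (A k) (x $ k))"
        "integrable K (\<lambda>x. R S A x * cos (h x) * indicator (A k) (x $ k))"
        "integrable K (\<lambda>x. R S A x * sin (h x) * indicator (A k) (x $ k))"
      if K: "prob_space K" "sets K = sets borel" and "h \<in> borel_measurable borel"
      for K and h :: "real ^ 'd \<Rightarrow> real"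
    proof -
      note [measurable_cong] = K(2)
      have [measurable]: "h \<in> borel_measurable K" using that(3) unfolding measurable_cong_sets[OF K(2) refl] .
      note [measurable] = RmM[OF K(2)] A
      have b: "\<bar>R S A x * cos (h x)\<bar> \<le> 1" "\<bar>R S A x * sin (h x)\<bar> \<le> 1" for x
        using mult_mono[OF Rb(2)[of S A x] abs_cos_le_one[of "h x"]]
          mult_mono[OF Rb(2)[of S A x] abs_sin_le_one[of "h x"]] Rb(1)[of S A x]
        by (auto simp: abs_mult)
      show "integrable K (\<lambda>x. R S A x * cos (h x))" "integrable K (\<lambda>x. R S A x * sin (h x))"
        "integrable K (R S A)"
        "integrable K (\<lambda>x. R S A x * indicator (A k) (x $ k))"
        "integrable K (\<lambda>x. R S A x * cos (h x) * indicator (A k) (x $ k))"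
        "integrable K (\<lambda>x. R S A x * sin (h x) * indicator (A k) (x $ k))"
        by (rule prob_space.integrable_bounded_real[OF K(1), of _ 1];
            (use b Rb in \<open>auto simp: indicator_def\<close>))+
    qed
    have lm: "(\<lambda>x. t \<bullet> x) \<in> borel_measurable borel" for t :: "real ^ 'd" by measurable
    note i = int[OF P(1) sM lm] int[OF P(2) sN lm]
    \<comment> \<open>Weights must be nonnegative, so \<open>1 + cos\<close> and
      \<open>1 + sin\<close> replace the bare functions. The choice \<open>f = 0\<close> provides
      the contribution of the 1, to be subtracted afterwards.\<close>
    have step: "(\<integral>x. R S A x * (1 + f (t \<bullet> x)) * indicator (A k) (x $ k) \<partial>M)
       = (\<integral>x. R S A x * (1 + f (t \<bullet> x)) * indicator (A k) (x $ k) \<partial>N)"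
      if f: "f = cos \<or> f = sin \<or> f = (\<lambda>_. 0)" for f :: "real \<Rightarrow> real" and t
    proof (rule weighted_Levy_uniqueness[OF P, where B = 2 and X = "\<lambda>x. x $ k"])
      have fb: "\<bar>f u\<bar> \<le> 1" for u using f by auto
      have [measurable]: "f \<in> borel_measurable borel" using f by auto
      show "(\<lambda>x. R S A x * (1 + f (t \<bullet> x))) \<in> borel_measurable M"
        using RmM[OF sM] by measurable
      show "0 \<le> R S A x * (1 + f (t \<bullet> x))" "R S A x * (1 + f (t \<bullet> x)) \<le> 2" for x
      proof -
        have "0 \<le> 1 + f (t \<bullet> x)" "1 + f (t \<bullet> x) \<le> 2"
          using fb[of "t \<bullet> x"] by linarith+
        then show "0 \<le> R S A x * (1 + f (t \<bullet> x))" "R S A x * (1 + f (t \<bullet> x)) \<le> 2"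
          using mult_mono[OF Rb(2)[of S A x], of "1 + f (t \<bullet> x)" 2] Rb(1)[of S A x] by simp_all
      qed
      fix u
      \<comment> \<open>Products of trigonometric functions in the directions \<open>t\<close> and
        \<open>axis k 1\<close> become sums over these three frequencies, where the induction
        hypothesis applies.\<close>
      define p m o' :: "real ^ 'd" where pmo: "p = u *\<^sub>R axis k 1 + t" "m = u *\<^sub>R axis k 1 - t" "o' = u *\<^sub>R axis k 1"
      note ih = insert.IH[rule_format, of p] insert.IH[rule_format, of m] insert.IH[rule_format, of o']
      have C: "R S A x * (1 + f (t \<bullet> x)) * cos (u * x $ k) =
         (if f = cos then R S A x * cos (o' \<bullet> x) + R S A x * cos (p \<bullet> x) / 2 + R S A x * cos (m \<bullet> x) / 2
          else if f = sin then R S A x * cos (o' \<bullet> x) + R S A x * sin (p \<bullet> x) / 2 - R S A x * sin (m \<bullet> x) / 2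
          else R S A x * cos (o' \<bullet> x))" for x
        using f unfolding pmo inner_add_left inner_diff_left e
        by (auto simp: cos_add cos_diff sin_add sin_diff algebra_simps add_divide_distrib diff_divide_distrib)
      have S: "R S A x * (1 + f (t \<bullet> x)) * sin (u * x $ k) =
         (if f = cos then R S A x * sin (o' \<bullet> x) + R S A x * sin (p \<bullet> x) / 2 + R S A x * sin (m \<bullet> x) / 2
          else if f = sin then R S A x * sin (o' \<bullet> x) + R S A x * cos (m \<bullet> x) / 2 - R S A x * cos (p \<bullet> x) / 2
          else R S A x * sin (o' \<bullet> x))" for x
        using f unfolding pmo inner_add_left inner_diff_left e
        by (auto simp: cos_add cos_diff sin_add sin_diff algebra_simps add_divide_distrib diff_divide_distrib)
      show "(\<integral>x. R S A x * (1 + f (t \<bullet> x)) * cos (u * x $ k) \<partial>M) =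
         (\<integral>x. R S A x * (1 + f (t \<bullet> x)) * cos (u * x $ k) \<partial>N)"
        unfolding C using f by (cases "f = cos"; cases "f = sin") (simp_all add: i ih)
      show "(\<integral>x. R S A x * (1 + f (t \<bullet> x)) * sin (u * x $ k) \<partial>M) =
         (\<integral>x. R S A x * (1 + f (t \<bullet> x)) * sin (u * x $ k) \<partial>N)"
        unfolding S using f by (cases "f = cos"; cases "f = sin") (simp_all add: i ih)
    qed (use A sM sN in \<open>simp_all add: measurable_cong_sets[OF sM refl]\<close>)
    have R': "R (insert k S) A x = R S A x * indicator (A k) (x $ k)" for x
      using insert by (simp add: R_def)
    have z: "(\<integral>x. R S A x * indicator (A k) (x $ k) \<partial>M) = (\<integral>x. R S A x * indicator (A k) (x $ k) \<partial>N)"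
      using step[of "\<lambda>_. 0"] by simp
    show ?case
    proof (intro allI conjI)
      fix t :: "real ^ 'd"
      have "(\<integral>x. R S A x * f (t \<bullet> x) * indicator (A k) (x $ k) \<partial>M) = (\<integral>x. R S A x * f (t \<bullet> x) * indicator (A k) (x $ k) \<partial>N)"
        if "f = cos \<or> f = sin" for f
        using that step[of f t] z by (elim disjE) (simp_all add: distrib_left distrib_right i)
      from this[of cos] this[of sin]
      show "(\<integral>x. R (insert k S) A x * cos (t \<bullet> x) \<partial>M) = (\<integral>x. R (insert k S) A x * cos (t \<bullet> x) \<partial>N)"
        "(\<integral>x. R (insert k S) A x * sin (t \<bullet> x) \<partial>M) = (\<integral>x. R (insert k S) A x * sin (t \<bullet> x) \<partial>N)"
        unfolding R' by (simp_all add: mult_ac)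
    qed
  qed
  show ?thesis
  proof (rule measure_eqI_generator_eq)
    let ?E = "range (\<lambda>(a, b). box a b :: (real ^ 'd) set)"
    show "Int_stable ?E"
      by (auto simp: Int_stable_def box_Int_box)
    show "?E \<subseteq> Pow UNIV" "sets M = sigma_sets UNIV ?E" "sets N = sigma_sets UNIV ?E"
      by (simp_all add: borel_eq_box sM sN)
    let ?A = "\<lambda>n::nat. box (- (real n *\<^sub>R One)) (real n *\<^sub>R One) :: (real ^ 'd) set"
    show "range ?A \<subseteq> ?E" "(\<Union>i. ?A i) = UNIV"
      unfolding UN_box_eq_UNIV by auto
    show "emeasure M (?A i) \<noteq> \<infinity>" for i
      using prob_space.emeasure_le_1[OF P(1), of "?A i"] by (auto simp: top_unique)
    fix X assume "X \<in> ?E"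
    then obtain a b where X: "X = box a b" by auto
    have e: "R UNIV (\<lambda>j. {a $ j<..<b $ j}) x = indicator X x" for x
      unfolding R_def X by (auto simp: indicator_def mem_box_cart)
    have "measure M X = measure N X"
      using agree[of UNIV "\<lambda>j. {a $ j<..<b $ j}", rule_format, of 0]
      unfolding e by (simp add: X sM sN sets_eq_imp_space_eq)
    then show "emeasure M X = emeasure N X"
      using P by (simp add: finite_measure.emeasure_eq_measure prob_space.finite_measure)
  qed
qed

section \<open>Centred Gaussian laws\<close>

text \<open>A point mass must sit at 0 by the mean condition; a proper normal variable is rescaled
  to the standard one, whose characteristic function is known. Expressing the cosine moment through
  the second moment covers both cases at once, so degenerate projections need no separate treatment
  later.\<close>

lemma normal_rv_centred:
  assumes K: "prob_space K" and n: "normal_rv K Y" and m [measurable]: "Y \<in> borel_measurable K"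
    and mean: "(\<integral>x. Y x \<partial>K) = 0"
  shows "integrable K (\<lambda>x. \<bar>Y x\<bar> ^ k)"
    "(\<integral>x. cos (u * Y x) \<partial>K) = exp (- (u\<^sup>2 * (\<integral>x. (Y x)\<^sup>2 \<partial>K)) / 2)"
    "(\<integral>x. sin (u * Y x) \<partial>K) = 0"
proof -
  interpret prob_space K by fact
  have "integrable K (\<lambda>x. \<bar>Y x\<bar> ^ k) \<and>
    (\<integral>x. cos (u * Y x) \<partial>K) = exp (- (u\<^sup>2 * (\<integral>x. (Y x)\<^sup>2 \<partial>K)) / 2) \<and> (\<integral>x. sin (u * Y x) \<partial>K) = 0"
    using n unfolding normal_rv_def
  proof (elim disjE exE conjE)
    fix m0 assume "distr K borel Y = return borel m0"
    then have "AE y in distr K borel Y. y = m0"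
      by (simp only:) (subst AE_return, auto)
    then have AE: "AE x in K. Y x = m0"
      by (subst (asm) AE_distr_iff) auto
    have e: "(\<integral>x. f (Y x) \<partial>K) = f m0" if [measurable]: "f \<in> borel_measurable borel" for f :: "real \<Rightarrow> real"
    proof -
      have "(\<integral>x. f (Y x) \<partial>K) = (\<integral>x. f m0 \<partial>K)"
      proof (rule integral_cong_AE)
        show "AE x in K. f (Y x) = f m0" using AE by eventually_elim simp
      qed auto
      then show ?thesis by (simp add: prob_space)
    qed
    have "m0 = 0" using e[of "\<lambda>x. x"] mean by simp
    moreover have "integrable K (\<lambda>x. \<bar>Y x\<bar> ^ k)"
    proof (rule integrable_cong_AE_imp[of _ "\<lambda>_. \<bar>m0\<bar> ^ k"])
      show "AE x in K. \<bar>m0\<bar> ^ k = \<bar>Y x\<bar> ^ k" using AE by eventually_elim simp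
    qed auto
    ultimately show ?thesis
      using e[of "\<lambda>x. cos (u * x)"] e[of "\<lambda>x. sin (u * x)"] e[of "\<lambda>x. x\<^sup>2"] by simp
  next
    fix m0 \<sigma> :: real assume s: "0 < \<sigma>" and D: "distributed K lborel Y (normal_density m0 \<sigma>)"
    have m0: "m0 = 0" using normal_distributed_expectation[OF s D] mean by simp
    have var: "(\<integral>x. (Y x)\<^sup>2 \<partial>K) = \<sigma>\<^sup>2"
      using normal_distributed_variance[OF s D] mean by simp
    have int: "integrable K (\<lambda>x. \<bar>Y x\<bar> ^ k)"
      using distributed_integrable[OF D, of "\<lambda>x. \<bar>x\<bar> ^ k"] integrable_normal_moment_abs[OF s, of m0 k]
      by (simp add: m0)
    have "distributed K lborel (\<lambda>x. (Y x - m0) / \<sigma>) std_normal_density"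
      using D normal_standard_normal_convert[OF s] by simp
    then have "distributed K lborel (\<lambda>x. Y x / \<sigma>) std_normal_density" by (simp add: m0)
    then have "distr K lborel (\<lambda>x. Y x / \<sigma>) = std_normal_distribution"
      by (auto dest: distributed_distr_eq_density)
    then have d: "distr K borel (\<lambda>x. Y x / \<sigma>) = std_normal_distribution"
      using distr_cong[OF refl sets_lborel[symmetric] refl, of K "\<lambda>x. Y x / \<sigma>"] by simp
    have "complex_of_real (exp (- ((u * \<sigma>)\<^sup>2) / 2)) = char (distr K borel (\<lambda>x. Y x / \<sigma>)) (u * \<sigma>)"
      unfolding d char_std_normal_distribution ..
    also have "\<dots> = (\<integral>x. iexp (u * Y x) \<partial>K)"
      unfolding char_def using s by (subst integral_distr) auto
    finally have c: "(\<integral>x. iexp (u * Y x) \<partial>K) = complex_of_real (exp (- ((u * \<sigma>)\<^sup>2) / 2))" ..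
    have i: "integrable K (\<lambda>x. iexp (u * Y x))" by (rule integrable_iexp) auto
    have re: "Re (iexp (u * Y x)) = cos (u * Y x)" and im: "Im (iexp (u * Y x)) = sin (u * Y x)" for x
      by (simp_all add: Re_exp Im_exp)
    show ?thesis
      using integral_Re[OF i] integral_Im[OF i] int unfolding re im c var by (simp add: power_mult_distrib)
  qed
  then show "integrable K (\<lambda>x. \<bar>Y x\<bar> ^ k)"
    "(\<integral>x. cos (u * Y x) \<partial>K) = exp (- (u\<^sup>2 * (\<integral>x. (Y x)\<^sup>2 \<partial>K)) / 2)"
    "(\<integral>x. sin (u * Y x) \<partial>K) = 0" by auto
qed

lemma C11_measurable:
  assumes "C11 f f1"
  shows "f \<in> borel_measurable borel" "f1 a \<in> borel_measurable borel"
  using C11_lipschitz[OF assms] C11_partial_lipschitz[OF assms]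
  by (auto intro!: borel_measurable_continuous_onI continuous_on_l1_lipschitz)

text \<open>All coordinates are compared with a largest one. Integrability of powers of the norm is
  thereby reduced to moments of one-dimensional normal variables.\<close>

lemma l1norm_power_le:
  fixes y :: "real ^ 'd::finite"
  shows "l1norm y ^ k \<le> real CARD('d) ^ k * (\<Sum>a\<in>UNIV. \<bar>y $ a\<bar> ^ k)"
proof -
  have "Max (range (\<lambda>a. \<bar>y $ a\<bar>)) \<in> range (\<lambda>a. \<bar>y $ a\<bar>)" by (rule Max_in) auto
  then obtain b where "Max (range (\<lambda>a. \<bar>y $ a\<bar>)) = \<bar>y $ b\<bar>"
    unfolding image_iff by blast
  then have b: "\<bar>y $ a\<bar> \<le> \<bar>y $ b\<bar>" for a
    using Max_ge[of "range (\<lambda>a. \<bar>y $ a\<bar>)" "\<bar>y $ a\<bar>"] by simp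
  have "l1norm y ^ k \<le> (real CARD('d) * \<bar>y $ b\<bar>) ^ k"
    unfolding l1norm_def by (intro power_mono sum_bounded_above b sum_nonneg) auto
  also have "\<dots> \<le> real CARD('d) ^ k * (\<Sum>a\<in>UNIV. \<bar>y $ a\<bar> ^ k)"
    unfolding power_mult_distrib by (intro mult_left_mono member_le_sum) auto
  finally show ?thesis .
qed

text \<open>The Gaussian is taken as a law on the space itself, because \<open>d4\<close> depends
  only on laws. As the means vanish, the covariances are plain second moments.\<close>

locale centred_gaussian_law = prob_space M for M :: "(real ^ 'd::finite) measure" +
  fixes C :: "real ^ 'd ^ 'd"
  assumes sets_eq [simp, measurable_cong]: "sets M = sets borel"
    and normal: "\<And>t. normal_rv M (\<lambda>y. t \<bullet> y)"
    and mean [simp]: "\<And>a. (\<integral>y. y $ a \<partial>M) = 0"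
    and cov [simp]: "\<And>a b. (\<integral>y. y $ a * y $ b \<partial>M) = C $ a $ b"
begin

lemma integrable_abs_component_power: "integrable M (\<lambda>y. \<bar>y $ a\<bar> ^ k)"
proof -
  have "(\<lambda>y. axis a 1 \<bullet> y) = (\<lambda>y::real ^ 'd. y $ a)" by (simp add: inner_axis')
  then show ?thesis
    using normal_rv_centred(1)[OF prob_space_axioms normal[of "axis a 1"], of k] by simp
qed

lemma integrable_l1norm_power [simp]: "integrable M (\<lambda>y. l1norm y ^ k)"
proof (rule Bochner_Integration.integrable_bound)
  show "integrable M (\<lambda>y. real CARD('d) ^ k * (\<Sum>a\<in>UNIV. \<bar>y $ a\<bar> ^ k))"
    by (intro integrable_mult_right Bochner_Integration.integrable_sum integrable_abs_component_power)
  show "AE y in M. norm (l1norm y ^ k) \<le> norm (real CARD('d) ^ k * (\<Sum>a\<in>UNIV. \<bar>y $ a\<bar> ^ k))"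
  proof (rule AE_I2)
    fix y :: "real ^ 'd"
    show "norm (l1norm y ^ k) \<le> norm (real CARD('d) ^ k * (\<Sum>a\<in>UNIV. \<bar>y $ a\<bar> ^ k))"
      using l1norm_power_le[of y k] abs_ge_self[of "real CARD('d) ^ k * (\<Sum>a\<in>UNIV. \<bar>y $ a\<bar> ^ k)"]
      by simp
  qed
qed simp

lemma integrable_polynomial_growth:
  assumes [measurable]: "f \<in> borel_measurable borel"
    and "\<And>y. \<bar>f y\<bar> \<le> A + B * l1norm y ^ k"
  shows "integrable M f"
proof (rule Bochner_Integration.integrable_bound)
  show "integrable M (\<lambda>y. A + B * l1norm y ^ k)" by simp
  show "AE y in M. norm (f y) \<le> norm (A + B * l1norm y ^ k)"
    by (intro AE_I2) (use assms(2) in \<open>simp add: order_trans[OF _ abs_ge_self]\<close>)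
qed simp

lemma integrable_component [simp]: "integrable M (\<lambda>y. y $ a)"
  by (rule integrable_polynomial_growth[of _ 0 1 1]) (use l1norm_component in auto)

lemma integrable_bounded_mult_component:
  assumes [measurable]: "f \<in> borel_measurable borel" and "\<And>y. \<bar>f y\<bar> \<le> 1"
  shows "integrable M (\<lambda>y. f y * y $ a)"
  by (rule integrable_polynomial_growth[of _ 0 1 1])
    (use mult_mono[OF assms(2) l1norm_component] in \<open>auto simp: abs_mult\<close>)

lemma integrable_bounded_mult_component2:
  assumes [measurable]: "f \<in> borel_measurable borel" and "\<And>y. \<bar>f y\<bar> \<le> 1"
  shows "integrable M (\<lambda>y. f y * (y $ a * y $ b))"
proof (rule integrable_polynomial_growth[of _ 0 1 2])
  fix y
  have "\<bar>f y\<bar> * (\<bar>y $ a\<bar> * \<bar>y $ b\<bar>) \<le> 1 * (l1norm y * l1norm y)"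
    by (intro mult_mono assms l1norm_component) auto
  then show "\<bar>f y * (y $ a * y $ b)\<bar> \<le> 0 + 1 * (l1norm y)\<^sup>2"
    by (simp add: abs_mult power2_eq_square)
qed simp

lemma integrable_component2 [simp]: "integrable M (\<lambda>y. y $ a * y $ b)"
  using integrable_bounded_mult_component2[of "\<lambda>_. 1" a b] by simp

lemma integrable_lipschitz:
  assumes "C11 f f1"
  shows "integrable M (\<lambda>y. f (x + c *\<^sub>R y))"
proof (rule integrable_polynomial_growth[of _ "\<bar>f x\<bar>" "\<bar>c\<bar>" 1])
  show "(\<lambda>y. f (x + c *\<^sub>R y)) \<in> borel_measurable borel"
    using C11_measurable(1)[OF assms] by measurable
  show "\<bar>f (x + c *\<^sub>R y)\<bar> \<le> \<bar>f x\<bar> + \<bar>c\<bar> * l1norm y ^ 1" for y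
    using C11_lipschitz[OF assms, of x "c *\<^sub>R y"] unfolding l1norm_scale power_one_right
    by linarith
qed

lemma trigonometric_moments:
  "(\<integral>y. cos (t \<bullet> y) \<partial>M) = exp (- (\<integral>y. (t \<bullet> y)\<^sup>2 \<partial>M) / 2)" "(\<integral>y. sin (t \<bullet> y) \<partial>M) = 0"
proof -
  have "(\<integral>y. t \<bullet> y \<partial>M) = 0"
    unfolding inner_vec_def by simp
  then show "(\<integral>y. cos (t \<bullet> y) \<partial>M) = exp (- (\<integral>y. (t \<bullet> y)\<^sup>2 \<partial>M) / 2)" "(\<integral>y. sin (t \<bullet> y) \<partial>M) = 0"
    using normal_rv_centred(2,3)[OF prob_space_axioms normal[of t], where u = 1] by simp_all
qed

text \<open>By independence the cosine moment of the combination in direction \<open>t\<close> is a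
  product of two exponentials, whose exponents add up with the factor
  \<open>a\<^sup>2 + b\<^sup>2 = 1\<close>; the sine moments vanish. Uniqueness of the law does the
  rest.\<close>

lemma rotation_invariant:
  assumes ab: "a\<^sup>2 + b\<^sup>2 = 1"
  shows "distr (M \<Otimes>\<^sub>M M) borel (\<lambda>(y, z). a *\<^sub>R y + b *\<^sub>R z) = M"
proof -
  interpret P: pair_prob_space M M ..
  have trig: "(\<integral>p. h (t \<bullet> (a *\<^sub>R fst p + b *\<^sub>R snd p)) \<partial>(M \<Otimes>\<^sub>M M))
      = (\<integral>y. \<integral>z. h (a * (t \<bullet> y) + b * (t \<bullet> z)) \<partial>M \<partial>M)"
    if [measurable]: "h \<in> borel_measurable borel" and "\<And>x. \<bar>h x\<bar> \<le> 1" for h :: "real \<Rightarrow> real" and t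
  proof (subst P.integral_fst'[symmetric])
    show "integrable (M \<Otimes>\<^sub>M M) (\<lambda>p. h (t \<bullet> (a *\<^sub>R fst p + b *\<^sub>R snd p)))"
      by (rule P.integrable_bounded_real[of _ 1]) (use that(2) in auto)
  qed (simp add: inner_add_right)
  have b: "integrable M (\<lambda>z. cos (b * (t \<bullet> z)))" "integrable M (\<lambda>z. sin (b * (t \<bullet> z)))" for b t
    by (rule integrable_bounded_real[of _ 1]; auto)+
  have s: "(a *\<^sub>R t) \<bullet> y = a * (t \<bullet> y)" for a and t y :: "real ^ 'd" by simp
  note m = trigonometric_moments[of "_ *\<^sub>R _", unfolded s]
  have "(\<integral>y. \<integral>z. cos (a * (t \<bullet> y) + b * (t \<bullet> z)) \<partial>M \<partial>M) = (\<integral>y. cos (t \<bullet> y) \<partial>M)" for t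
  proof -
    have "(\<integral>y. \<integral>z. cos (a * (t \<bullet> y) + b * (t \<bullet> z)) \<partial>M \<partial>M) =
      exp (- (\<integral>y. (a * (t \<bullet> y))\<^sup>2 \<partial>M) / 2) * exp (- (\<integral>y. (b * (t \<bullet> y))\<^sup>2 \<partial>M) / 2)"
      unfolding cos_add by (simp add: b m)
    also have "\<dots> = exp (- ((a\<^sup>2 + b\<^sup>2) * (\<integral>y. (t \<bullet> y)\<^sup>2 \<partial>M)) / 2)"
      unfolding power_mult_distrib by (simp add: algebra_simps add_divide_distrib flip: exp_add)
    finally show ?thesis using trigonometric_moments(1)[of t] by (simp add: ab)
  qed
  moreover have "(\<integral>y. \<integral>z. sin (a * (t \<bullet> y) + b * (t \<bullet> z)) \<partial>M \<partial>M) = (\<integral>y. sin (t \<bullet> y) \<partial>M)" for t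
    unfolding sin_add by (simp add: b m trigonometric_moments)
  ultimately show ?thesis
    by (intro law_unique_trigonometric P.prob_space_distr prob_space_axioms)
      (simp_all add: integral_distr trig split_beta)
qed

lemma integral_rotation:
  assumes f: "C11 f f1" and ab: "a\<^sup>2 + b\<^sup>2 = 1"
  shows "integrable M (\<lambda>y. \<integral>z. f (a *\<^sub>R y + b *\<^sub>R z) \<partial>M)"
    "(\<integral>y. \<integral>z. f (a *\<^sub>R y + b *\<^sub>R z) \<partial>M \<partial>M) = (\<integral>y. f y \<partial>M)"
proof -
  interpret P: pair_prob_space M M ..
  have [measurable]: "f \<in> borel_measurable borel" by (rule C11_measurable[OF f])
  have "integrable M f" using integrable_lipschitz[OF f, of 0 1] by simp
  then have "integrable (distr (M \<Otimes>\<^sub>M M) borel (\<lambda>(y, z). a *\<^sub>R y + b *\<^sub>R z)) f"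
    by (simp only: rotation_invariant[OF ab])
  then have i: "integrable (M \<Otimes>\<^sub>M M) (\<lambda>p. f (a *\<^sub>R fst p + b *\<^sub>R snd p))"
    by (subst (asm) integrable_distr_eq) (auto simp: split_beta)
  show "integrable M (\<lambda>y. \<integral>z. f (a *\<^sub>R y + b *\<^sub>R z) \<partial>M)"
    using P.integrable_fst'[OF i] by simp
  have "(\<integral>y. f y \<partial>M) = (\<integral>y. f y \<partial>distr (M \<Otimes>\<^sub>M M) borel (\<lambda>(y, z). a *\<^sub>R y + b *\<^sub>R z))"
    by (simp only: rotation_invariant[OF ab])
  also have "\<dots> = (\<integral>p. f (a *\<^sub>R fst p + b *\<^sub>R snd p) \<partial>(M \<Otimes>\<^sub>M M))"
    by (subst integral_distr) (auto simp: split_beta)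
  also have "\<dots> = (\<integral>y. \<integral>z. f (a *\<^sub>R y + b *\<^sub>R z) \<partial>M \<partial>M)"
    using P.integral_fst'[OF i] by simp
  finally show "(\<integral>y. \<integral>z. f (a *\<^sub>R y + b *\<^sub>R z) \<partial>M \<partial>M) = (\<integral>y. f y \<partial>M)" ..
qed

text \<open>The law of \<open>a N + b N'\<close> does not depend on \<open>a\<close> and \<open>b\<close> as long as \<open>a\<^sup>2 + b\<^sup>2 = 1\<close>; the identity is the
  coefficient of \<open>b\<^sup>2\<close> in the expansion of \<open>E f(a N + b N')\<close> as \<open>b\<close> tends to 0.\<close>

lemma stein_identity:
  assumes f: "C11 f f1" and f1: "\<And>a. C11 (f1 a) (f2 a)"
  shows "(\<Sum>a\<in>UNIV. \<integral>y. f1 a y * y $ a \<partial>M) = (\<Sum>a\<in>UNIV. \<Sum>b\<in>UNIV. C $ a $ b * (\<integral>y. f2 a b y \<partial>M))"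
proof -
  note [measurable] = C11_measurable[OF f] C11_measurable(2)[OF f1]
  note bound = C11_partial_bound[OF f] C11_partial_bound[OF f1]
  have if1 [simp]: "integrable M (\<lambda>y. f1 a y * y $ a)" for a
    by (rule integrable_bounded_mult_component) (auto simp: bound)
  have if2 [simp]: "integrable M (\<lambda>y. f2 a b y * (y $ a * y $ b))" for a b
    by (rule integrable_bounded_mult_component2) (auto simp: bound)
  have if2' [simp]: "integrable M (f2 a b)" for a b
    by (rule integrable_bounded_real[of _ 1]) (auto simp: bound)
  have iff [simp]: "integrable M f" using integrable_lipschitz[OF f, of 0 1] by simp
  define S1 where "S1 y = (\<Sum>a\<in>UNIV. f1 a y * y $ a)" for y
  define S2 where "S2 y = (\<Sum>a\<in>UNIV. \<Sum>b\<in>UNIV. f2 a b y * (y $ a * y $ b))" for y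
  define S3 where "S3 y = (\<Sum>a\<in>UNIV. \<Sum>b\<in>UNIV. C $ a $ b * f2 a b y)" for y
  have iS [simp]: "integrable M S1" "integrable M S2" "integrable M S3"
    unfolding S1_def S2_def S3_def by simp_all
  \<comment> \<open>The Taylor error is at most \<open>4 * b ^ 3\<close> times the sum of two cubed
    norms; integrating both arguments gives twice the third moment, hence 8.\<close>
  define K where "K = 8 * (\<integral>y. l1norm y ^ 3 \<partial>M)"
  have main: "\<bar>- (1 - a) * (\<integral>y. S1 y \<partial>M) + (1 - a)\<^sup>2 / 2 * (\<integral>y. S2 y \<partial>M) + b\<^sup>2 / 2 * (\<integral>y. S3 y \<partial>M)\<bar> \<le> K * b ^ 3"
    if ab: "a\<^sup>2 + b\<^sup>2 = 1" "0 \<le> a" "0 \<le> b" "1 - a \<le> b" for a b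
  proof -
    have a1: "a \<le> 1" using ab(1) zero_le_power2[of b] abs_square_le_1[of a] by linarith
    \<comment> \<open>The second-order Taylor polynomial at \<open>y\<close> of the point
      \<open>a y + b z\<close>, that is, for the increment \<open>(a - 1) y + b z\<close>.\<close>
    define T where "T y z = f y + (\<Sum>k\<in>UNIV. f1 k y * ((a - 1) * y $ k + b * z $ k))
       + (\<Sum>k\<in>UNIV. \<Sum>l\<in>UNIV. f2 k l y * ((a - 1) * y $ k + b * z $ k) * ((a - 1) * y $ l + b * z $ l)) / 2" for y z
    define U where "U y = f y - (1 - a) * S1 y + (1 - a)\<^sup>2 / 2 * S2 y + b\<^sup>2 / 2 * S3 y" for y
    have T_eq: "T y z = f y + (\<Sum>k\<in>UNIV. f1 k y * (a - 1) * y $ k + f1 k y * b * z $ k)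
       + (\<Sum>k\<in>UNIV. \<Sum>l\<in>UNIV. f2 k l y * (a - 1)\<^sup>2 * (y $ k * y $ l) + f2 k l y * (a - 1) * b * y $ k * z $ l
           + f2 k l y * (a - 1) * b * y $ l * z $ k + f2 k l y * b\<^sup>2 * (z $ k * z $ l)) / 2" for y z
      unfolding T_def by (simp add: algebra_simps power2_eq_square)
    have iT: "integrable M (T y)" for y
      unfolding T_eq by simp
    \<comment> \<open>Terms linear in \<open>z\<close> vanish since \<open>z\<close> is centred, and
      \<open>z $ k * z $ l\<close> integrates to the covariance; this is how \<open>C\<close> enters
      the identity.\<close>
    have T: "(\<integral>z. T y z \<partial>M) = U y" for y
    proof -
      have "(\<integral>z. T y z \<partial>M) = f y + (\<Sum>k\<in>UNIV. f1 k y * (a - 1) * y $ k)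
         + (\<Sum>k\<in>UNIV. \<Sum>l\<in>UNIV. f2 k l y * (a - 1)\<^sup>2 * (y $ k * y $ l) + f2 k l y * b\<^sup>2 * C $ k $ l) / 2"
        unfolding T_eq by (simp add: prob_space)
      also have "(\<Sum>k\<in>UNIV. f1 k y * (a - 1) * y $ k) = - (1 - a) * S1 y"
        unfolding S1_def sum_distrib_left by (intro sum.cong) (simp_all add: algebra_simps)
      also have "(\<Sum>k\<in>UNIV. \<Sum>l\<in>UNIV. f2 k l y * (a - 1)\<^sup>2 * (y $ k * y $ l) + f2 k l y * b\<^sup>2 * C $ k $ l)
          = (1 - a)\<^sup>2 * S2 y + b\<^sup>2 * S3 y"
        unfolding S2_def S3_def sum_distrib_left sum.distrib[symmetric]
        by (intro sum.cong refl) (simp add: power2_commute[of a 1] mult_ac)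
      finally show ?thesis unfolding U_def by (simp add: add_divide_distrib left_diff_distrib)
    qed
    have ifz: "integrable M (\<lambda>z. f (a *\<^sub>R y + b *\<^sub>R z))" for y
      by (rule integrable_lipschitz[OF f])
    have close: "\<bar>f (a *\<^sub>R y + b *\<^sub>R z) - T y z\<bar> \<le> 4 * b ^ 3 * (l1norm y ^ 3 + l1norm z ^ 3)" for y z
    proof -
      define D where "D = (a - 1) *\<^sub>R y + b *\<^sub>R z"
      have "l1norm D \<le> (1 - a) * l1norm y + b * l1norm z"
        unfolding D_def using l1norm_triangle[of "(a - 1) *\<^sub>R y" "b *\<^sub>R z"] a1 ab
        by (simp add: l1norm_scale)
      also have "\<dots> \<le> b * (l1norm y + l1norm z)"
        using mult_right_mono[OF ab(4) l1norm_nonneg[of y]] by (simp add: algebra_simps)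
      finally have "l1norm D ^ 3 \<le> (b * (l1norm y + l1norm z)) ^ 3"
        by (intro power_mono) auto
      also have "\<dots> \<le> b ^ 3 * (4 * (l1norm y ^ 3 + l1norm z ^ 3))"
      proof -
        have "(u + v) ^ 3 \<le> 4 * (u ^ 3 + v ^ 3)" if "0 \<le> u" "0 \<le> v" for u v :: real
        proof -
          have "4 * (u ^ 3 + v ^ 3) - (u + v) ^ 3 = 3 * ((u + v) * (u - v)\<^sup>2)"
            by (simp add: power3_eq_cube power2_eq_square algebra_simps)
          moreover have "0 \<le> 3 * ((u + v) * (u - v)\<^sup>2)" using that by simp
          ultimately show ?thesis by linarith
        qed
        then show ?thesis unfolding power_mult_distrib using ab by (intro mult_left_mono) auto
      qed
      finally have D3: "l1norm D ^ 3 \<le> 4 * b ^ 3 * (l1norm y ^ 3 + l1norm z ^ 3)"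
        by (simp add: algebra_simps)
      have yD: "y + D = a *\<^sub>R y + b *\<^sub>R z"
        by (simp add: D_def algebra_simps)
      have Dk: "D $ k = (a - 1) * y $ k + b * z $ k" for k by (simp add: D_def)
      show ?thesis
        using second_order_taylor[OF f f1, of y D] D3 unfolding yD Dk T_def
        by (simp only: diff_diff_eq)
    qed
    have inner: "\<bar>(\<integral>z. f (a *\<^sub>R y + b *\<^sub>R z) \<partial>M) - U y\<bar> \<le> 4 * b ^ 3 * (l1norm y ^ 3 + (\<integral>z. l1norm z ^ 3 \<partial>M))" for y
    proof -
      have "\<bar>(\<integral>z. f (a *\<^sub>R y + b *\<^sub>R z) \<partial>M) - U y\<bar> = \<bar>\<integral>z. f (a *\<^sub>R y + b *\<^sub>R z) - T y z \<partial>M\<bar>"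
        by (simp add: ifz iT T)
      also have "\<dots> \<le> (\<integral>z. \<bar>f (a *\<^sub>R y + b *\<^sub>R z) - T y z\<bar> \<partial>M)"
        by (rule integral_abs_bound)
      also have "\<dots> \<le> (\<integral>z. 4 * b ^ 3 * (l1norm y ^ 3 + l1norm z ^ 3) \<partial>M)"
        by (intro integral_mono integrable_abs Bochner_Integration.integrable_diff ifz iT close) auto
      also have "\<dots> = 4 * b ^ 3 * (l1norm y ^ 3 + (\<integral>z. l1norm z ^ 3 \<partial>M))"
        by (simp add: prob_space)
      finally show ?thesis .
    qed
    have iU: "integrable M U" unfolding U_def by simp
    note rot = integral_rotation[OF f ab(1)]
    have "\<bar>(\<integral>y. f y \<partial>M) - (\<integral>y. U y \<partial>M)\<bar> = \<bar>\<integral>y. (\<integral>z. f (a *\<^sub>R y + b *\<^sub>R z) \<partial>M) - U y \<partial>M\<bar>"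
      using rot iU by simp
    also have "\<dots> \<le> (\<integral>y. \<bar>(\<integral>z. f (a *\<^sub>R y + b *\<^sub>R z) \<partial>M) - U y\<bar> \<partial>M)"
      by (rule integral_abs_bound)
    also have "\<dots> \<le> (\<integral>y. 4 * b ^ 3 * (l1norm y ^ 3 + (\<integral>z. l1norm z ^ 3 \<partial>M)) \<partial>M)"
      by (intro integral_mono integrable_abs Bochner_Integration.integrable_diff rot iU inner) auto
    also have "\<dots> = K * b ^ 3" by (simp add: prob_space K_def)
    finally show ?thesis
      unfolding U_def by (simp add: abs_minus_commute algebra_simps)
  qed
  let ?A = "\<integral>y. S1 y \<partial>M" and ?A2 = "\<integral>y. S2 y \<partial>M" and ?B = "\<integral>y. S3 y \<partial>M"
  \<comment> \<open>This is \<open>main\<close> divided by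
    \<open>b\<^sup>2 = (1 - a) * (1 + a)\<close> with \<open>a = sqrt (1 - b\<^sup>2)\<close>. The
    bound becomes \<open>K * b\<close>, the coefficient of \<open>?A2\<close> tends to 0 and that of
    \<open>?A\<close> to \<open>- 1 / 2\<close>.\<close>
  have "((\<lambda>b. - ?A / (1 + sqrt (1 - b\<^sup>2)) + (1 - sqrt (1 - b\<^sup>2)) / (1 + sqrt (1 - b\<^sup>2)) / 2 * ?A2 + ?B / 2) \<longlongrightarrow> 0) (at_right 0)"
  proof (rule Lim_null_comparison)
    show "((\<lambda>b. K * b) \<longlongrightarrow> 0) (at_right (0::real))" by (auto intro!: tendsto_eq_intros)
    have "\<forall>\<^sub>F b in at_right 0. 0 < b \<and> b < (1::real)"
      using eventually_at_right_real[of 0 "1::real"] by simp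
    then show "\<forall>\<^sub>F b in at_right 0. norm (- ?A / (1 + sqrt (1 - b\<^sup>2)) + (1 - sqrt (1 - b\<^sup>2)) / (1 + sqrt (1 - b\<^sup>2)) / 2 * ?A2 + ?B / 2) \<le> K * b"
    proof (rule eventually_mono)
      fix b :: real assume b: "0 < b \<and> b < 1"
      define a where "a = sqrt (1 - b\<^sup>2)"
      have b2: "b\<^sup>2 < 1" using b by (simp add: power_less_one_iff)
      have a2: "a\<^sup>2 = 1 - b\<^sup>2" and a0: "0 < a" using b2 by (simp_all add: a_def)
      have fac: "b\<^sup>2 = (1 - a) * (1 + a)" using a2 by (simp add: algebra_simps power2_eq_square)
      have "1 - a = b\<^sup>2 / (1 + a)" using fac a0 by (simp add: field_simps)
      also have "\<dots> \<le> b\<^sup>2 / 1" using a0 by (intro divide_left_mono) auto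
      also have "\<dots> \<le> b" using b mult_left_le[of b b] by (simp add: power2_eq_square)
      finally have ab: "1 - a \<le> b" .
      have "- ?A / (1 + a) + (1 - a) / (1 + a) / 2 * ?A2 + ?B / 2
         = (- (1 - a) * ?A + (1 - a)\<^sup>2 / 2 * ?A2 + b\<^sup>2 / 2 * ?B) / b\<^sup>2"
      proof -
        have *: "- A / v + u / v / 2 * A2 + B / 2 = (- u * A + u\<^sup>2 / 2 * A2 + u * v / 2 * B) / (u * v)"
          if "u \<noteq> 0" "v \<noteq> 0" for u v A A2 B :: real
          using that by (simp add: field_simps power2_eq_square)
        have "1 - a \<noteq> 0" "1 + a \<noteq> 0" using fac b by auto
        then show ?thesis unfolding fac by (rule *)
      qed
      also have "\<bar>\<dots>\<bar> \<le> K * b ^ 3 / b\<^sup>2"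
        unfolding abs_divide using main[of a b] a2 a0 b ab by (intro frac_le) auto
      also have "\<dots> = K * b" using b by (simp add: power3_eq_cube power2_eq_square)
      finally show "norm (- ?A / (1 + sqrt (1 - b\<^sup>2)) + (1 - sqrt (1 - b\<^sup>2)) / (1 + sqrt (1 - b\<^sup>2)) / 2 * ?A2 + ?B / 2) \<le> K * b"
        by (simp add: a_def)
    qed
  qed
  moreover have "((\<lambda>b. - ?A / (1 + sqrt (1 - b\<^sup>2)) + (1 - sqrt (1 - b\<^sup>2)) / (1 + sqrt (1 - b\<^sup>2)) / 2 * ?A2 + ?B / 2)
      \<longlongrightarrow> - ?A / 2 + ?B / 2) (at_right 0)"
    by (auto intro!: tendsto_eq_intros)
  ultimately have "- ?A / 2 + ?B / 2 = 0"
    by (rule tendsto_unique[OF trivial_limit_at_right_real, rotated])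
  then have "?A = ?B" by simp
  then show ?thesis unfolding S1_def S3_def by simp
qed

end

section \<open>The interpolation path\<close>

lemma sin_cos_increment:
  "\<bar>sin (s + h) - sin s\<bar> \<le> \<bar>h\<bar>" "\<bar>cos (s + h) - cos s\<bar> \<le> \<bar>h\<bar>"
  "\<bar>sin (s + h) - sin s - h * cos s\<bar> \<le> h\<^sup>2" "\<bar>cos (s + h) - cos s + h * sin s\<bar> \<le> h\<^sup>2"
  for s h :: real
proof -
  have lip: "\<bar>f (s + h) - f s - h * c\<bar> \<le> K * \<bar>h\<bar>"
    if d: "\<And>x. (f has_real_derivative f' x) (at x)" and b: "\<And>x. \<bar>x - s\<bar> \<le> \<bar>h\<bar> \<Longrightarrow> \<bar>f' x - c\<bar> \<le> K"
    for f f' :: "real \<Rightarrow> real" and c K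
  proof -
    have "norm ((f (s + h) - c * (s + h)) - (f s - c * s)) \<le> K * norm ((s + h) - s)"
    proof (rule field_differentiable_bound[of "{s - \<bar>h\<bar>..s + \<bar>h\<bar>}"])
      fix x assume x: "x \<in> {s - \<bar>h\<bar>..s + \<bar>h\<bar>}"
      show "((\<lambda>x. f x - c * x) has_field_derivative f' x - c) (at x within {s - \<bar>h\<bar>..s + \<bar>h\<bar>})"
        by (auto intro!: derivative_eq_intros DERIV_subset[OF d])
      show "norm (f' x - c) \<le> K" using b[of x] x by auto
    qed auto
    then show ?thesis by (simp add: algebra_simps)
  qed
  have lip1: "\<bar>f (s + h) - f s\<bar> \<le> \<bar>h\<bar>"
    if d: "\<And>x. (f has_real_derivative f' x) (at x)" and b: "\<And>x. \<bar>f' x\<bar> \<le> 1"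
    for f f' :: "real \<Rightarrow> real" and s h
  proof -
    have "norm (f (s + h) - f s) \<le> 1 * norm ((s + h) - s)"
      by (rule field_differentiable_bound[of UNIV _ f']) (use that in auto)
    then show ?thesis by simp
  qed
  have ls: "\<bar>sin (s + h) - sin s\<bar> \<le> \<bar>h\<bar>" for s h :: real
    by (rule lip1[of sin cos]) (auto intro: DERIV_sin)
  have lc: "\<bar>cos (s + h) - cos s\<bar> \<le> \<bar>h\<bar>" for s h :: real
    by (rule lip1[of cos "\<lambda>x. - sin x"]) (auto intro: DERIV_cos)
  show "\<bar>sin (s + h) - sin s\<bar> \<le> \<bar>h\<bar>" "\<bar>cos (s + h) - cos s\<bar> \<le> \<bar>h\<bar>" by (rule ls lc)+
  have "\<bar>cos x - cos s\<bar> \<le> \<bar>h\<bar>" if "\<bar>x - s\<bar> \<le> \<bar>h\<bar>" for x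
    using lc[of s "x - s"] that by simp
  from lip[of sin cos, OF DERIV_sin this] show "\<bar>sin (s + h) - sin s - h * cos s\<bar> \<le> h\<^sup>2"
    by (simp add: power2_eq_square)
  have "\<bar>- sin x - - sin s\<bar> \<le> \<bar>h\<bar>" if "\<bar>x - s\<bar> \<le> \<bar>h\<bar>" for x
    using ls[of s "x - s"] that by simp
  from lip[of cos "\<lambda>x. - sin x", OF DERIV_cos this] show "\<bar>cos (s + h) - cos s + h * sin s\<bar> \<le> h\<^sup>2"
    by (simp add: power2_eq_square)
qed

context centred_gaussian_law
begin

text \<open>Differentiation under the integral: the integrand has a first-order expansion in
  \<open>h\<close> with error at most \<open>h\<^sup>2 * q y\<close> and \<open>q\<close>
  integrable, so the expansion can be integrated.\<close>

lemma gaussian_path_derivative: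
  assumes g: "C11 g g1" and g1: "\<And>a. C11 (g1 a) (g2 a)"
  shows "((\<lambda>s. \<integral>y. g (sin s *\<^sub>R x + cos s *\<^sub>R y) \<partial>M) has_real_derivative
     (\<Sum>a\<in>UNIV. cos s * (x $ a * (\<integral>y. g1 a (sin s *\<^sub>R x + cos s *\<^sub>R y) \<partial>M))
        - sin s * (\<integral>y. g1 a (sin s *\<^sub>R x + cos s *\<^sub>R y) * y $ a \<partial>M))) (at s)"
proof (rule real_derivative_quadratic_remainder)
  fix h
  define z where "z s y = sin s *\<^sub>R x + cos s *\<^sub>R y" for s y
  \<comment> \<open>The linear part pays for replacing the increments of sine and cosine by their
    derivatives, the square for the Taylor remainder of \<open>g\<close>.\<close>
  define q where "q y = l1norm x + l1norm y + (l1norm x + l1norm y)\<^sup>2" for y :: "real ^ 'd"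
  have iq: "integrable M q"
    unfolding q_def power2_sum using integrable_l1norm_power[of 1] by simp
  have ig: "integrable M (\<lambda>y. g (z s y))" for s
    unfolding z_def by (rule integrable_lipschitz[OF g])
  note [measurable] = C11_measurable[OF g]
  have m: "(\<lambda>y. g1 a (z s y)) \<in> borel_measurable borel" for a
    unfolding z_def by measurable
  have ig1 [simp]: "integrable M (\<lambda>y. g1 a (z s y))" for a
    by (rule integrable_bounded_real[of _ 1]) (use m C11_partial_bound[OF g] in auto)
  have ig1' [simp]: "integrable M (\<lambda>y. g1 a (z s y) * y $ a)" for a
    by (rule integrable_bounded_mult_component[OF m C11_partial_bound[OF g]])
  define L where "L y = (\<Sum>a\<in>UNIV. cos s * (x $ a * g1 a (z s y)) - sin s * (g1 a (z s y) * y $ a))" for y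
  have iL: "integrable M L" unfolding L_def by simp
  have pointwise: "\<bar>g (z (s + h) y) - g (z s y) - h * L y\<bar> \<le> h\<^sup>2 * q y" for y
  proof -
    define D where "D = z (s + h) y - z s y"
    have Dk: "D $ k = (sin (s + h) - sin s) * x $ k + (cos (s + h) - cos s) * y $ k" for k
      by (simp add: D_def z_def algebra_simps)
    have "l1norm D = l1norm ((sin (s + h) - sin s) *\<^sub>R x + (cos (s + h) - cos s) *\<^sub>R y)"
      by (rule arg_cong[of _ _ l1norm]) (simp add: vec_eq_iff Dk)
    also have "\<dots> \<le> \<bar>sin (s + h) - sin s\<bar> * l1norm x + \<bar>cos (s + h) - cos s\<bar> * l1norm y"
      using l1norm_triangle by (simp flip: l1norm_scale)
    also have "\<dots> \<le> \<bar>h\<bar> * l1norm x + \<bar>h\<bar> * l1norm y"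
      by (intro add_mono mult_right_mono sin_cos_increment) auto
    finally have "(l1norm D)\<^sup>2 \<le> (\<bar>h\<bar> * (l1norm x + l1norm y))\<^sup>2"
      by (intro power_mono) (auto simp: algebra_simps)
    then have D2: "(l1norm D)\<^sup>2 \<le> h\<^sup>2 * (l1norm x + l1norm y)\<^sup>2" by (simp add: power_mult_distrib)
    have "\<bar>(\<Sum>a\<in>UNIV. g1 a (z s y) * D $ a) - h * L y\<bar>
       = \<bar>\<Sum>a\<in>UNIV. g1 a (z s y) * ((sin (s + h) - sin s - h * cos s) * x $ a
           + (cos (s + h) - cos s + h * sin s) * y $ a)\<bar>"
      unfolding L_def Dk sum_distrib_left sum_subtractf[symmetric]
      by (intro arg_cong[where f = abs] sum.cong) (simp_all add: algebra_simps)
    also have "\<dots> \<le> (\<Sum>a\<in>UNIV. 1 * (h\<^sup>2 * \<bar>x $ a\<bar> + h\<^sup>2 * \<bar>y $ a\<bar>))"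
    proof (intro order_trans[OF sum_abs] sum_mono)
      fix a
      have "\<bar>(sin (s + h) - sin s - h * cos s) * x $ a + (cos (s + h) - cos s + h * sin s) * y $ a\<bar>
        \<le> h\<^sup>2 * \<bar>x $ a\<bar> + h\<^sup>2 * \<bar>y $ a\<bar>"
        by (intro order_trans[OF abs_triangle_ineq] add_mono; unfold abs_mult;
            intro mult_right_mono sin_cos_increment) auto
      then show "\<bar>g1 a (z s y) * ((sin (s + h) - sin s - h * cos s) * x $ a
           + (cos (s + h) - cos s + h * sin s) * y $ a)\<bar> \<le> 1 * (h\<^sup>2 * \<bar>x $ a\<bar> + h\<^sup>2 * \<bar>y $ a\<bar>)"
        unfolding abs_mult[of "g1 a (z s y)"] by (intro mult_mono C11_partial_bound[OF g]) auto
    qed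
    also have "\<dots> = h\<^sup>2 * (l1norm x + l1norm y)"
      by (simp add: l1norm_def sum.distrib sum_distrib_left distrib_left)
    finally have lin: "\<bar>(\<Sum>a\<in>UNIV. g1 a (z s y) * D $ a) - h * L y\<bar> \<le> h\<^sup>2 * (l1norm x + l1norm y)" .
    have "\<bar>g (z s y + D) - g (z s y) - (\<Sum>a\<in>UNIV. g1 a (z s y) * D $ a)\<bar> \<le> h\<^sup>2 * (l1norm x + l1norm y)\<^sup>2"
      using C11_taylor[OF g, of "z s y" D] D2 by linarith
    then have "\<bar>g (z (s + h) y) - g (z s y) - (\<Sum>a\<in>UNIV. g1 a (z s y) * D $ a)\<bar> \<le> h\<^sup>2 * (l1norm x + l1norm y)\<^sup>2"
      by (simp add: D_def)
    then show ?thesis using lin unfolding q_def distrib_left by linarith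
  qed
  have L: "(\<integral>y. L y \<partial>M) = (\<Sum>a\<in>UNIV. cos s * (x $ a * (\<integral>y. g1 a (z s y) \<partial>M))
        - sin s * (\<integral>y. g1 a (z s y) * y $ a \<partial>M))"
    unfolding L_def by simp
  have "\<bar>(\<integral>y. g (z (s + h) y) \<partial>M) - (\<integral>y. g (z s y) \<partial>M) - h * (\<integral>y. L y \<partial>M)\<bar>
      = \<bar>\<integral>y. g (z (s + h) y) - g (z s y) - h * L y \<partial>M\<bar>"
    using ig iL by simp
  also have "\<dots> \<le> (\<integral>y. \<bar>g (z (s + h) y) - g (z s y) - h * L y\<bar> \<partial>M)"
    by (rule integral_abs_bound)
  also have "\<dots> \<le> (\<integral>y. h\<^sup>2 * q y \<partial>M)"
    using iq by (intro integral_mono integrable_abs Bochner_Integration.integrable_diff ig integrable_mult_right iL pointwise) auto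
  also have "\<dots> = (\<integral>y. q y \<partial>M) * h\<^sup>2" by simp
  finally show "\<bar>(\<integral>y. g (sin (s + h) *\<^sub>R x + cos (s + h) *\<^sub>R y) \<partial>M) - (\<integral>y. g (sin s *\<^sub>R x + cos s *\<^sub>R y) \<partial>M)
      - h * (\<Sum>a\<in>UNIV. cos s * (x $ a * (\<integral>y. g1 a (sin s *\<^sub>R x + cos s *\<^sub>R y) \<partial>M))
        - sin s * (\<integral>y. g1 a (sin s *\<^sub>R x + cos s *\<^sub>R y) * y $ a \<partial>M))\<bar> \<le> (\<integral>y. q y \<partial>M) * h\<^sup>2"
    unfolding L by (simp only: z_def)
qed

text \<open>The Stein identity is applied to \<open>y \<mapsto> g (x + c y)\<close>. Its gradient
  carries one factor \<open>c\<close> and its second derivatives two, so one factor cancels because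
  \<open>c > 0\<close>. The local fact \<open>sc\<close> keeps the scaled gradient in
  \<open>C11\<close>.\<close>

lemma stein_identity_affine:
  assumes g: "C11 g g1" and g1: "\<And>a. C11 (g1 a) (g2 a)" and c: "0 < c" "c \<le> 1"
  shows "(\<Sum>a\<in>UNIV. \<integral>y. g1 a (x + c *\<^sub>R y) * y $ a \<partial>M)
    = c * (\<Sum>a\<in>UNIV. \<Sum>b\<in>UNIV. C $ a $ b * (\<integral>y. g2 a b (x + c *\<^sub>R y) \<partial>M))"
proof -
  have c': "\<bar>c\<bar> \<le> 1" using c by simp
  have sc: "C11 (\<lambda>y. c * f y) (\<lambda>a y. c * f1 a y)" if "C11 f f1" for f :: "real ^ 'd \<Rightarrow> real" and f1
  proof -
    have l: "\<bar>c * u\<bar> \<le> v" if "\<bar>u\<bar> \<le> v" for u v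
      using that mult_mono[OF c' that] by (simp add: abs_mult)
    show ?thesis unfolding C11_def
    proof (intro conjI allI)
      fix x D :: "real ^ 'd" and a
      show "\<bar>c * f (x + D) - c * f x\<bar> \<le> l1norm D"
        using l[OF C11_lipschitz[OF that, of x D]] by (simp add: right_diff_distrib)
      show "\<bar>c * f (x + D) - c * f x - (\<Sum>a\<in>UNIV. c * f1 a x * D $ a)\<bar> \<le> (l1norm D)\<^sup>2"
        using l[OF C11_taylor[OF that, of x D]] by (simp add: right_diff_distrib sum_distrib_left mult.assoc)
      show "\<bar>c * f1 a x\<bar> \<le> 1" by (rule l[OF C11_partial_bound[OF that]])
      show "\<bar>c * f1 a (x + D) - c * f1 a x\<bar> \<le> l1norm D"
        using l[OF C11_partial_lipschitz[OF that, where a = a and x = x and D = D]] by (simp add: right_diff_distrib)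
    qed
  qed
  have "(\<Sum>a\<in>UNIV. \<integral>y. c * g1 a (x + c *\<^sub>R y) * y $ a \<partial>M)
     = (\<Sum>a\<in>UNIV. \<Sum>b\<in>UNIV. C $ a $ b * (\<integral>y. c * (c * g2 a b (x + c *\<^sub>R y)) \<partial>M))"
    by (rule stein_identity[OF C11_affine[OF g c'] sc[OF C11_affine[OF g1 c']]])
  then have "c * (\<Sum>a\<in>UNIV. \<integral>y. g1 a (x + c *\<^sub>R y) * y $ a \<partial>M)
     = c * (c * (\<Sum>a\<in>UNIV. \<Sum>b\<in>UNIV. C $ a $ b * (\<integral>y. g2 a b (x + c *\<^sub>R y) \<partial>M)))"
    by (simp add: mult.assoc sum_distrib_left mult.left_commute)
  then show ?thesis using c by simp
qed

text \<open>The weights sine and cosine have squares summing to 1, so the path from \<open>N\<close>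
  at 0 to \<open>X\<close> at \<open>pi / 2\<close> preserves the covariance to leading order. In
  the derivative the Gaussian term becomes \<open>sin s * cos s\<close> times second partials;
  \<open>sin s * g2 a b\<close> is the partial of
  \<open>x \<mapsto> g1 a (cos s y + sin s x)\<close>, so for fixed \<open>y\<close> what remains is
  a Stein discrepancy of \<open>X\<close>. The factor \<open>pi / 2\<close> is the length of the
  path, and \<open>CARD('d)\<close> comes from the sum over \<open>a\<close>.\<close>

lemma smart_path_bound:
  fixes P :: "'x pmf" and X :: "'x \<Rightarrow> real ^ 'd"
  assumes fin: "finite (set_pmf P)"
    and g: "C11 g g1" and g1: "\<And>a. C11 (g1 a) (g2 a)"
    and stein: "\<And>a \<phi> \<phi>1. C11 \<phi> \<phi>1 \<Longrightarrow>
      \<bar>measure_pmf.expectation P (\<lambda>\<omega>. X \<omega> $ a * \<phi> (X \<omega>))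
        - (\<Sum>b\<in>UNIV. C $ a $ b * measure_pmf.expectation P (\<lambda>\<omega>. \<phi>1 b (X \<omega>)))\<bar> \<le> \<epsilon>"
  shows "\<bar>measure_pmf.expectation P (\<lambda>\<omega>. g (X \<omega>)) - (\<integral>y. g y \<partial>M)\<bar> \<le> pi / 2 * real CARD('d) * \<epsilon>"
proof -
  have E: "measure_pmf.expectation P f = (\<Sum>\<omega>\<in>set_pmf P. f \<omega> * pmf P \<omega>)" for f :: "'x \<Rightarrow> real"
    by (rule integral_measure_pmf_real[OF fin]) auto
  have sum1: "(\<Sum>\<omega>\<in>set_pmf P. pmf P \<omega>) = 1" using E[of "\<lambda>_. 1"] by simp
  define \<Psi> where "\<Psi> s = (\<Sum>\<omega>\<in>set_pmf P. (\<integral>y. g (sin s *\<^sub>R X \<omega> + cos s *\<^sub>R y) \<partial>M) * pmf P \<omega>)" for s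
  define z where "z s \<omega> y = sin s *\<^sub>R X \<omega> + cos s *\<^sub>R y" for s \<omega> y
  define \<Psi>' where "\<Psi>' s = (\<Sum>\<omega>\<in>set_pmf P. (\<Sum>a\<in>UNIV. cos s * (X \<omega> $ a * (\<integral>y. g1 a (z s \<omega> y) \<partial>M))
        - sin s * (\<integral>y. g1 a (z s \<omega> y) * y $ a \<partial>M)) * pmf P \<omega>)" for s
  have d: "(\<Psi> has_real_derivative \<Psi>' s) (at s)" for s
    unfolding \<Psi>_def \<Psi>'_def z_def
    by (intro DERIV_sum DERIV_cmult_right gaussian_path_derivative[OF g g1])
  \<comment> \<open>The intermediate point lies in the open interval, so \<open>cos s > 0\<close> as
    \<open>stein_identity_affine\<close> demands.\<close>
  obtain s where s: "0 < s" "s < pi / 2" and mvt: "\<Psi> (pi / 2) - \<Psi> 0 = (pi / 2 - 0) * \<Psi>' s"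
    using MVT2[of 0 "pi / 2" \<Psi> \<Psi>'] d by auto
  have c: "0 < cos s" "cos s \<le> 1" using s cos_gt_zero by auto
  note [measurable] = C11_measurable[OF g] C11_measurable(2)[OF g1]
  have i1 [simp]: "integrable M (\<lambda>y. g1 a (z s \<omega> y))" for a \<omega>
    unfolding z_def by (rule integrable_bounded_real[of _ 1]) (auto simp: C11_partial_bound[OF g])
  have i2 [simp]: "integrable M (\<lambda>y. g2 a b (z s \<omega> y))" for a b \<omega>
    unfolding z_def by (rule integrable_bounded_real[of _ 1]) (auto simp: C11_partial_bound[OF g1])
  \<comment> \<open>The total discrepancy of \<open>X\<close> with the Gaussian argument frozen at
    \<open>y\<close>; it is bounded before integrating over \<open>y\<close>.\<close>
  define R where "R y = (\<Sum>a\<in>UNIV. measure_pmf.expectation P (\<lambda>\<omega>. X \<omega> $ a * g1 a (z s \<omega> y))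
     - (\<Sum>b\<in>UNIV. C $ a $ b * measure_pmf.expectation P (\<lambda>\<omega>. sin s * g2 a b (z s \<omega> y))))" for y
  have R: "\<bar>R y\<bar> \<le> real CARD('d) * \<epsilon>" for y
  proof -
    have "\<bar>R y\<bar> \<le> (\<Sum>a::'d\<in>UNIV. \<epsilon>)"
      unfolding R_def
    proof (intro order_trans[OF sum_abs] sum_mono)
      fix a :: 'd
      have "C11 (\<lambda>x. g1 a (cos s *\<^sub>R y + sin s *\<^sub>R x)) (\<lambda>b x. sin s * g2 a b (cos s *\<^sub>R y + sin s *\<^sub>R x))"
        by (rule C11_affine[OF g1]) simp
      from stein[OF this, of a]
      show "\<bar>measure_pmf.expectation P (\<lambda>\<omega>. X \<omega> $ a * g1 a (z s \<omega> y))
         - (\<Sum>b\<in>UNIV. C $ a $ b * measure_pmf.expectation P (\<lambda>\<omega>. sin s * g2 a b (z s \<omega> y)))\<bar> \<le> \<epsilon>"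
        by (simp add: z_def add.commute)
    qed
    then show ?thesis by simp
  qed
  have iR: "integrable M R" unfolding R_def E by simp
  have "\<Psi>' s = cos s * (\<integral>y. R y \<partial>M)"
  proof -
    have "\<Psi>' s = (\<Sum>\<omega>\<in>set_pmf P. (cos s * (\<Sum>a\<in>UNIV. X \<omega> $ a * (\<integral>y. g1 a (z s \<omega> y) \<partial>M))
        - sin s * (cos s * (\<Sum>a\<in>UNIV. \<Sum>b\<in>UNIV. C $ a $ b * (\<integral>y. g2 a b (z s \<omega> y) \<partial>M)))) * pmf P \<omega>)"
      unfolding \<Psi>'_def z_def stein_identity_affine[OF g g1 c, symmetric]
      by (simp only: sum_subtractf sum_distrib_left)
    also have "\<dots> = cos s * ((\<Sum>\<omega>\<in>set_pmf P. \<Sum>a\<in>UNIV. X \<omega> $ a * (\<integral>y. g1 a (z s \<omega> y) \<partial>M) * pmf P \<omega>)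
        - (\<Sum>\<omega>\<in>set_pmf P. \<Sum>a\<in>UNIV. \<Sum>b\<in>UNIV. C $ a $ b * (sin s * (\<integral>y. g2 a b (z s \<omega> y) \<partial>M) * pmf P \<omega>)))"
      by (simp add: sum_subtractf[symmetric] sum_distrib_left sum_distrib_right left_diff_distrib right_diff_distrib mult_ac)
    also have "(\<Sum>\<omega>\<in>set_pmf P. \<Sum>a\<in>UNIV. X \<omega> $ a * (\<integral>y. g1 a (z s \<omega> y) \<partial>M) * pmf P \<omega>)
       = (\<Sum>a\<in>UNIV. \<Sum>\<omega>\<in>set_pmf P. X \<omega> $ a * (\<integral>y. g1 a (z s \<omega> y) \<partial>M) * pmf P \<omega>)"
      by (rule sum.swap)
    also have "(\<Sum>\<omega>\<in>set_pmf P. \<Sum>a\<in>UNIV. \<Sum>b\<in>UNIV. C $ a $ b * (sin s * (\<integral>y. g2 a b (z s \<omega> y) \<partial>M) * pmf P \<omega>))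
      = (\<Sum>a\<in>UNIV. \<Sum>b\<in>UNIV. \<Sum>\<omega>\<in>set_pmf P. C $ a $ b * (sin s * (\<integral>y. g2 a b (z s \<omega> y) \<partial>M) * pmf P \<omega>))"
      by (subst sum.swap) (intro sum.cong refl sum.swap)
    finally show ?thesis unfolding R_def E by (simp add: sum_subtractf sum_distrib_left)
  qed
  moreover have "\<bar>\<integral>y. R y \<partial>M\<bar> \<le> real CARD('d) * \<epsilon>"
  proof -
    have "\<bar>\<integral>y. R y \<partial>M\<bar> \<le> (\<integral>y. \<bar>R y\<bar> \<partial>M)" by (rule integral_abs_bound)
    also have "\<dots> \<le> (\<integral>y. real CARD('d) * \<epsilon> \<partial>M)" using iR R by (intro integral_mono) auto
    finally show ?thesis by (simp add: prob_space)
  qed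
  ultimately have "\<bar>\<Psi>' s\<bar> \<le> 1 * (real CARD('d) * \<epsilon>)"
    using c by (simp only: abs_mult) (intro mult_mono, auto)
  then have "\<bar>\<Psi> (pi / 2) - \<Psi> 0\<bar> \<le> pi / 2 * (real CARD('d) * \<epsilon>)"
    unfolding mvt abs_mult using pi_gt_zero by (intro mult_mono) auto
  moreover have "\<Psi> (pi / 2) = measure_pmf.expectation P (\<lambda>\<omega>. g (X \<omega>))"
    by (simp add: \<Psi>_def E prob_space)
  moreover have "\<Psi> 0 = (\<integral>y. g y \<partial>M)"
    by (simp add: \<Psi>_def sum1 flip: sum_distrib_left)
  ultimately show ?thesis by (simp add: mult.assoc)
qed

end

section \<open>Random subsets and deletion of a vertex\<close>

text \<open>One notion serves both the edge set of the graph and the neighbourhood of a vertex; its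
  expectations are computed by induction on the ground set.\<close>

definition random_subset :: "'a set \<Rightarrow> real \<Rightarrow> 'a set pmf" where
  "random_subset A p = map_pmf (\<lambda>keep. {x \<in> A. keep x}) (Pi_pmf A False (\<lambda>_. bernoulli_pmf p))"

abbreviation subset_exp :: "real \<Rightarrow> 'a set \<Rightarrow> ('a set \<Rightarrow> real) \<Rightarrow> real" where
  "subset_exp p A f \<equiv> measure_pmf.expectation (random_subset A p) f"

lemma erdos_renyi_random_subset: "erdos_renyi n p = random_subset (complete_edges n) p"
  by (simp add: erdos_renyi_def random_subset_def)

lemma set_random_subset: "set_pmf (random_subset A p) \<subseteq> Pow A"
  by (auto simp: random_subset_def)

lemma finite_set_random_subset: "finite A \<Longrightarrow> finite (set_pmf (random_subset A p))"
  using set_random_subset by (rule finite_subset) simp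

lemma integrable_random_subset [simp]:
  fixes f :: "'a set \<Rightarrow> real"
  shows "finite A \<Longrightarrow> integrable (measure_pmf (random_subset A p)) f"
  by (intro integrable_measure_pmf_finite finite_set_random_subset)

lemma subset_exp_cong:
  assumes "\<And>S. S \<subseteq> A \<Longrightarrow> f S = g S"
  shows "subset_exp p A f = subset_exp p A g"
proof (rule integral_cong_AE)
  show "AE S in measure_pmf (random_subset A p). f S = g S"
    unfolding AE_measure_pmf_iff using assms set_random_subset by blast
qed simp_all

lemma subset_exp_mono:
  assumes "finite A" "\<And>S. S \<subseteq> A \<Longrightarrow> f S \<le> g S"
  shows "subset_exp p A f \<le> subset_exp p A g"
proof (rule integral_mono_AE)
  show "AE S in measure_pmf (random_subset A p). f S \<le> g S"
    unfolding AE_measure_pmf_iff using assms set_random_subset by blast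
qed (use assms in simp_all)

lemma subset_exp_empty: "subset_exp p {} f = f {}"
  by (simp add: random_subset_def)

text \<open>Conditioning on whether \<open>x\<close> is chosen. This recursion drives the inductions
  for disjoint unions and injective images.\<close>

lemma subset_exp_insert:
  assumes "finite A" "x \<notin> A" "0 \<le> p" "p \<le> 1"
  shows "subset_exp p (insert x A) f = p * subset_exp p A (\<lambda>S. f (insert x S)) + (1 - p) * subset_exp p A f"
proof -
  have A: "set_pmf (Pi_pmf A False (\<lambda>_. bernoulli_pmf p)) \<subseteq> {f. \<forall>x. x \<notin> A \<longrightarrow> f x = False}"
    using assms by (intro set_Pi_pmf_subset)
  have "random_subset (insert x A) p = bind_pmf (bernoulli_pmf p) (\<lambda>y.
      map_pmf (\<lambda>S. if y then insert x S else S) (random_subset A p))"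
    unfolding random_subset_def Pi_pmf_insert[OF assms(1,2)] pair_pmf_def
      map_bind_pmf map_pmf_comp o_def bind_return_pmf map_pmf_def[symmetric]
    using A assms(2)
    by (intro bind_pmf_cong refl) (auto simp: map_pmf_comp intro!: map_pmf_cong split: if_splits)
  then have "subset_exp p (insert x A) f = (\<Sum>y\<in>UNIV. pmf (bernoulli_pmf p) y *\<^sub>R
      measure_pmf.expectation (map_pmf (\<lambda>S. if y then insert x S else S) (random_subset A p)) f)"
  proof (simp only:, intro pmf_expectation_bind)
    show "finite (set_pmf (map_pmf (\<lambda>S. if y then insert x S else S) (random_subset A p)))" for y
      using finite_set_random_subset[OF assms(1), of p] unfolding set_map_pmf by (rule finite_imageI)
  qed simp_all
  then show ?thesis using assms by (simp add: UNIV_bool)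
qed

text \<open>Independence of the parts of a random subset in two disjoint sets, in the form of an
  iterated expectation.\<close>

lemma subset_exp_Un:
  assumes "finite A" "finite B" "A \<inter> B = {}" "0 \<le> p" "p \<le> 1"
  shows "subset_exp p (A \<union> B) f = subset_exp p A (\<lambda>S. subset_exp p B (\<lambda>T. f (S \<union> T)))"
  using assms(1,3)
proof (induction A arbitrary: f rule: finite_induct)
  case empty
  then show ?case by (simp add: subset_exp_empty)
next
  case (insert x A)
  have "subset_exp p (insert x A \<union> B) f =
      p * subset_exp p (A \<union> B) (\<lambda>S. f (insert x S)) + (1 - p) * subset_exp p (A \<union> B) f"
    using insert assms by (simp add: subset_exp_insert)
  also have "\<dots> = subset_exp p (insert x A) (\<lambda>S. subset_exp p B (\<lambda>T. f (S \<union> T)))"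
    using insert assms by (simp add: subset_exp_insert)
  finally show ?case .
qed

lemma subset_exp_image:
  assumes "finite A" "inj_on h A" "0 \<le> p" "p \<le> 1"
  shows "subset_exp p (h ` A) f = subset_exp p A (\<lambda>S. f (h ` S))"
  using assms(1,2)
  by (induction A arbitrary: f rule: finite_induct) (use assms in \<open>auto simp: subset_exp_empty subset_exp_insert\<close>)

lemma subset_exp_member:
  assumes "finite A" "u \<in> A" "0 \<le> p" "p \<le> 1"
  shows "subset_exp p A (\<lambda>S. of_bool (u \<in> S) * f S) = p * subset_exp p (A - {u}) (\<lambda>S. f (insert u S))"
proof -
  have "subset_exp p (A - {u}) (\<lambda>S. of_bool (u \<in> S) * f S) = subset_exp p (A - {u}) (\<lambda>_. 0)"
    by (rule subset_exp_cong) auto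
  moreover have "insert u (A - {u}) = A" using assms by auto
  ultimately show ?thesis
    using subset_exp_insert[of "A - {u}" u p "\<lambda>S. of_bool (u \<in> S) * f S"] assms by simp
qed

definition binom :: "nat \<Rightarrow> real \<Rightarrow> nat \<Rightarrow> real" where
  "binom m p k = real (m choose k) * p ^ k * (1 - p) ^ (m - k)"

lemma subset_exp_card:
  assumes "finite A" "0 \<le> p" "p \<le> 1"
  shows "subset_exp p A (\<lambda>S. of_bool (card S = k)) = binom (card A) p k"
proof -
  have "subset_exp p A (\<lambda>S. of_bool (card S = k)) = measure_pmf.expectation (binomial_pmf (card A) p) (\<lambda>c. of_bool (c = k))"
    using assms by (subst binomial_pmf_altdef'[of A]) (auto simp: random_subset_def)
  also have "\<dots> = measure_pmf.expectation (binomial_pmf (card A) p) (indicator {k})"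
    by (intro Bochner_Integration.integral_cong) auto
  also have "\<dots> = pmf (binomial_pmf (card A) p) k"
    by (simp add: pmf.rep_eq)
  finally show ?thesis using assms by (simp add: binom_def)
qed

lemma binom_bounds: "0 \<le> p \<Longrightarrow> p \<le> 1 \<Longrightarrow> 0 \<le> binom m p k" "0 \<le> p \<Longrightarrow> p \<le> 1 \<Longrightarrow> binom m p k \<le> 1"
  using pmf_nonneg[of "binomial_pmf m p" k] pmf_le_1[of "binomial_pmf m p" k] by (auto simp: binom_def)

text \<open>By symmetry each element lies in a fraction \<open>k / card A\<close> of the sets of
  size \<open>k\<close>. The computation uses the absorption identity for binomial
  coefficients.\<close>

lemma subset_exp_card_member:
  assumes "finite A" "u \<in> A" "0 \<le> p" "p \<le> 1"
  shows "subset_exp p A (\<lambda>S. of_bool (u \<in> S) * of_bool (card S = k)) = real k / real (card A) * binom (card A) p k"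
proof -
  obtain m where m: "card A = Suc m" using assms by (metis card_gt_0_iff empty_iff gr0_implies_Suc)
  then have m': "card (A - {u}) = m" using assms by simp
  have "subset_exp p A (\<lambda>S. of_bool (u \<in> S) * of_bool (card S = k))
      = p * subset_exp p (A - {u}) (\<lambda>S. of_bool (card (insert u S) = k))"
    by (rule subset_exp_member[OF assms])
  also have "subset_exp p (A - {u}) (\<lambda>S. of_bool (card (insert u S) = k)) = subset_exp p (A - {u}) (\<lambda>S. of_bool (Suc (card S) = k))"
  proof (rule subset_exp_cong)
    fix S assume "S \<subseteq> A - {u}"
    then have "finite S" "u \<notin> S" using assms(1) finite_subset by auto
    then show "of_bool (card (insert u S) = k) = (of_bool (Suc (card S) = k) :: real)" by simp
  qed
  also have "p * \<dots> = real k / real (card A) * binom (card A) p k"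
  proof (cases k)
    case 0
    then show ?thesis by simp
  next
    case (Suc j)
    then have "p * subset_exp p (A - {u}) (\<lambda>S. of_bool (Suc (card S) = k)) = p * binom m p j"
      using assms m' by (simp add: subset_exp_card)
    also have "\<dots> = real k / real (card A) * binom (card A) p k"
    proof -
      have "real (Suc j) * real (Suc m choose Suc j) = real (Suc m) * real (m choose j)"
        unfolding of_nat_mult[symmetric] Suc_times_binomial_eq by (simp only: mult.commute)
      then have "real (m choose j) = real (Suc j) * real (Suc m choose Suc j) / real (Suc m)"
        by (simp add: field_simps)
      then show ?thesis unfolding m Suc binom_def by (simp del: binomial_Suc_Suc of_nat_Suc)
    qed
    finally show ?thesis .
  qed
  finally show ?thesis .
qed

text \<open>The size is a sum of membership indicators. Given that \<open>u\<close> is chosen, the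
  rest is a random subset of \<open>A - {u}\<close>, which yields the factor
  \<open>1 + (card A - 1) * p\<close>.\<close>

lemma subset_exp_size:
  assumes "finite A" "0 \<le> p" "p \<le> 1"
  shows "subset_exp p A (\<lambda>S. real (card S)) = real (card A) * p"
    "subset_exp p A (\<lambda>S. (real (card S))\<^sup>2) = real (card A) * p * (1 + (real (card A) - 1) * p)"
proof -
  have card: "real (card S) = (\<Sum>u\<in>A. of_bool (u \<in> S) * 1)" if "finite A" "S \<subseteq> A" for S A :: "'a set"
    using that
    by (simp add: of_bool_def sum.If_cases Int_absorb1)
  have one: "subset_exp p A (\<lambda>S. real (card S)) = real (card A) * p" if "finite A" for A :: "'a set"
  proof -
    have "subset_exp p A (\<lambda>S. real (card S)) = subset_exp p A (\<lambda>S. \<Sum>u\<in>A. of_bool (u \<in> S) * 1)"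
      using that by (intro subset_exp_cong card)
    also have "\<dots> = (\<Sum>u\<in>A. p)"
      using that assms by (subst Bochner_Integration.integral_sum; simp add: subset_exp_member[where f = "\<lambda>_. 1", simplified])
    finally show ?thesis by simp
  qed
  show "subset_exp p A (\<lambda>S. real (card S)) = real (card A) * p" by (rule one[OF assms(1)])
  have "subset_exp p A (\<lambda>S. (real (card S))\<^sup>2) = subset_exp p A (\<lambda>S. \<Sum>u\<in>A. of_bool (u \<in> S) * real (card S))"
  proof (rule subset_exp_cong)
    fix S assume "S \<subseteq> A"
    then show "(real (card S))\<^sup>2 = (\<Sum>u\<in>A. of_bool (u \<in> S) * real (card S))"
      using card[OF assms(1)] by (simp add: power2_eq_square sum_distrib_right)
  qed
  also have "\<dots> = (\<Sum>u\<in>A. p * (1 + (real (card A) - 1) * p))"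
  proof (subst Bochner_Integration.integral_sum, use assms in simp, rule sum.cong[OF refl])
    fix u assume u: "u \<in> A"
    have "subset_exp p A (\<lambda>S. of_bool (u \<in> S) * real (card S)) = p * subset_exp p (A - {u}) (\<lambda>S. real (card (insert u S)))"
      by (rule subset_exp_member[OF assms(1) u assms(2,3)])
    also have "subset_exp p (A - {u}) (\<lambda>S. real (card (insert u S))) = subset_exp p (A - {u}) (\<lambda>S. 1 + real (card S))"
    proof (rule subset_exp_cong)
      fix S assume "S \<subseteq> A - {u}"
      then have "finite S" "u \<notin> S" using assms(1) finite_subset by auto
      then show "real (card (insert u S)) = 1 + real (card S)" by simp
    qed
    also have "\<dots> = 1 + (real (card A) - 1) * p"
    proof -
      have "card A \<ge> 1" using u assms(1) by (metis One_nat_def Suc_leI card_gt_0_iff empty_iff)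
      then show ?thesis using assms(1) one[of "A - {u}"] u by (simp add: of_nat_diff)
    qed
    finally show "subset_exp p A (\<lambda>S. of_bool (u \<in> S) * real (card S)) = p * (1 + (real (card A) - 1) * p)" .
  qed
  finally show "subset_exp p A (\<lambda>S. (real (card S))\<^sup>2) = real (card A) * p * (1 + (real (card A) - 1) * p)"
    by simp
qed

section \<open>Splitting the complete graph at a vertex\<close>

definition edges_on :: "nat set \<Rightarrow> nat set set" where
  "edges_on U = {e. e \<subseteq> U \<and> card e = 2}"

lemma finite_edges_on [simp]: "finite U \<Longrightarrow> finite (edges_on U)"
  unfolding edges_on_def by (rule finite_subset[of _ "Pow U"]) auto

lemma finite_complete_edges [simp]: "finite (complete_edges n)"
  unfolding complete_edges_def by (rule finite_subset[of _ "Pow {..<n}"]) auto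

lemma complete_edges_split:
  assumes "v < n"
  shows "complete_edges n = edges_on ({..<n} - {v}) \<union> (\<lambda>u. {v, u}) ` ({..<n} - {v})"
proof (rule set_eqI)
  fix e
  show "e \<in> complete_edges n \<longleftrightarrow> e \<in> edges_on ({..<n} - {v}) \<union> (\<lambda>u. {v, u}) ` ({..<n} - {v})"
  proof (cases "v \<in> e")
    case True
    have "e \<in> complete_edges n \<longleftrightarrow> (\<exists>u. u < n \<and> u \<noteq> v \<and> e = {v, u})"
    proof
      assume e: "e \<in> complete_edges n"
      then obtain x y where xy: "e = {x, y}" "x \<noteq> y"
        unfolding complete_edges_def card_2_iff by blast
      define u where "u = (if v = x then y else x)"
      have "e = {v, u}" "u \<noteq> v" using xy True by (auto simp: u_def)
      then show "\<exists>u. u < n \<and> u \<noteq> v \<and> e = {v, u}"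
        using e by (auto simp: complete_edges_def)
    next
      assume "\<exists>u. u < n \<and> u \<noteq> v \<and> e = {v, u}"
      then show "e \<in> complete_edges n"
        using assms by (auto simp: complete_edges_def)
    qed
    then show ?thesis using True by (auto simp: edges_on_def)
  next
    case False
    then show ?thesis by (auto simp: edges_on_def complete_edges_def)
  qed
qed

text \<open>An edge at \<open>v\<close> is determined by its other endpoint, so the edges at
  \<open>v\<close> form the image of a random set \<open>S\<close> of vertices, independent of the
  graph \<open>G\<close> on the remaining ones.\<close>

lemma subset_exp_split_vertex:
  assumes "v < n" "0 \<le> p" "p \<le> 1"
  shows "subset_exp p (complete_edges n) f
    = subset_exp p (edges_on ({..<n} - {v}))
        (\<lambda>G. subset_exp p ({..<n} - {v}) (\<lambda>S. f (G \<union> (\<lambda>u. {v, u}) ` S)))"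
proof -
  let ?U = "{..<n} - {v}"
  have inj: "inj_on (\<lambda>u. {v, u}) S" for S by (auto simp: inj_on_def doubleton_eq_iff)
  have disj: "edges_on ?U \<inter> (\<lambda>u. {v, u}) ` ?U = {}" by (auto simp: edges_on_def)
  have "subset_exp p (complete_edges n) f
      = subset_exp p (edges_on ?U) (\<lambda>G. subset_exp p ((\<lambda>u. {v, u}) ` ?U) (\<lambda>T. f (G \<union> T)))"
    unfolding complete_edges_split[OF assms(1)] by (rule subset_exp_Un[OF _ _ disj assms(2,3)]) simp_all
  also have "\<dots> = subset_exp p (edges_on ?U) (\<lambda>G. subset_exp p ?U (\<lambda>S. f (G \<union> (\<lambda>u. {v, u}) ` S)))"
    by (simp add: subset_exp_image[OF _ inj assms(2,3)])
  finally show ?thesis .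
qed

lemma vertex_degree_split:
  assumes G: "G \<subseteq> edges_on U" and S: "S \<subseteq> U" and U: "finite U" "v \<notin> U"
  shows "vertex_degree (G \<union> (\<lambda>u. {v, u}) ` S) v = card S"
    "u \<in> U \<Longrightarrow> vertex_degree (G \<union> (\<lambda>u. {v, u}) ` S) u = vertex_degree G u + of_bool (u \<in> S)"
proof -
  have inj: "inj_on (\<lambda>u. {v, u}) S" by (auto simp: inj_on_def doubleton_eq_iff)
  have "{e \<in> G \<union> (\<lambda>u. {v, u}) ` S. v \<in> e} = (\<lambda>u. {v, u}) ` S"
    using G U by (auto simp: edges_on_def)
  then show "vertex_degree (G \<union> (\<lambda>u. {v, u}) ` S) v = card S"
    by (simp add: vertex_degree_def card_image[OF inj])
  assume u: "u \<in> U"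
  have fin: "finite G" using G U finite_subset finite_edges_on by blast
  have "{e \<in> G \<union> (\<lambda>u. {v, u}) ` S. u \<in> e} = {e \<in> G. u \<in> e} \<union> (if u \<in> S then {{v, u}} else {})"
    using u U by auto
  moreover have "{v, u} \<notin> G" using G U by (auto simp: edges_on_def)
  ultimately show "vertex_degree (G \<union> (\<lambda>u. {v, u}) ` S) u = vertex_degree G u + of_bool (u \<in> S)"
    using fin by (auto simp: vertex_degree_def)
qed

section \<open>Stein discrepancy of the degree counts\<close>

lemma subset_exp_affine:
  "finite A \<Longrightarrow> subset_exp p A (\<lambda>S. c + s * (f S + g S)) = c + s * (subset_exp p A f + subset_exp p A g)"
  by simp

locale sparse_graph =
  fixes n :: nat and p \<theta> :: real
  assumes n: "2 \<le> n" and theta: "0 < \<theta>" "\<theta> < 1" and p_eq: "p = \<theta> / (real n - 1)"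
begin

lemma p: "0 \<le> p" "p \<le> 1" and mean_degree: "(real n - 1) * p = \<theta>"
  using n theta by (auto simp: p_eq divide_le_eq)

abbreviation others :: "nat \<Rightarrow> nat set" where "others v \<equiv> {..<n} - {v}"

abbreviation graph_exp :: "(nat set set \<Rightarrow> real) \<Rightarrow> real" where
  "graph_exp \<equiv> subset_exp p (complete_edges n)"

abbreviation star :: "nat \<Rightarrow> nat set \<Rightarrow> nat set set" where
  "star v S \<equiv> (\<lambda>u. {v, u}) ` S"

text \<open>The exact probability that a given vertex has degree \<open>k\<close>: degrees are
  binomial with \<open>n - 1\<close> trials.\<close>

definition dprob :: "nat \<Rightarrow> real" where "dprob k = binom (n - 1) p k"

definition xi :: "nat \<Rightarrow> nat \<Rightarrow> nat set set \<Rightarrow> real" where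
  "xi k v E = of_bool (vertex_degree E v = k) - dprob k"

definition count_without :: "nat \<Rightarrow> nat \<Rightarrow> nat set set \<Rightarrow> real" where
  "count_without v k G = (\<Sum>u\<in>others v. of_bool (vertex_degree G u = k))"

text \<open>These are the vertices that reach degree \<open>k\<close> on gaining an edge. Writing
  \<open>+ 1 = k\<close> gives 0 for \<open>k = 0\<close>, where truncated subtraction would count
  degree 0.\<close>

definition count_below :: "nat \<Rightarrow> nat \<Rightarrow> nat set set \<Rightarrow> real" where
  "count_below v k G = (\<Sum>u\<in>others v. of_bool (vertex_degree G u + 1 = k))"

text \<open>The change of the count of degree \<open>l\<close> when \<open>v\<close> is joined to the vertices in \<open>S\<close>.\<close>

definition increment :: "nat \<Rightarrow> nat \<Rightarrow> nat set set \<Rightarrow> nat set \<Rightarrow> real" where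
  "increment v l G S = of_bool (card S = l) + (\<Sum>u\<in>others v. of_bool (u \<in> S) *
     (of_bool (vertex_degree G u + 1 = l) - of_bool (vertex_degree G u = l)))"

text \<open>\<open>slope k\<close> is the covariance of the events \<open>deg v = k\<close> and \<open>v\<close> adjacent to a given vertex \<open>u\<close>.\<close>

definition slope :: "nat \<Rightarrow> real" where
  "slope k = dprob k * (real k - \<theta>) / (real n - 1)"

text \<open>The conditional covariance of \<open>xi k v\<close> with the increment of the count of
  degree \<open>l\<close>, where \<open>G\<close> has \<open>x\<close> vertices of degree
  \<open>l - 1\<close> and \<open>y\<close> of degree \<open>l\<close>: a new edge moves the former
  into the count and the latter out of it.\<close>

definition kappa :: "nat \<Rightarrow> nat \<Rightarrow> real \<Rightarrow> real \<Rightarrow> real" where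
  "kappa k l x y = (if k = l then dprob k else 0) - dprob k * dprob l + slope k * (x - y)"

lemma dprob_bounds: "0 \<le> dprob k" "dprob k \<le> 1"
  unfolding dprob_def using binom_bounds p by auto

lemma graph_exp_split:
  "v < n \<Longrightarrow> graph_exp f = subset_exp p (edges_on (others v)) (\<lambda>G. subset_exp p (others v) (\<lambda>S. f (G \<union> star v S)))"
  by (rule subset_exp_split_vertex[OF _ p])

lemma num_degree_sum: "real (num_degree n k E) = (\<Sum>v<n. of_bool (vertex_degree E v = k))"
  by (simp add: num_degree_def of_bool_def sum.If_cases Int_def lessThan_def)

lemma num_degree_split:
  assumes "v < n" "G \<subseteq> edges_on (others v)" "S \<subseteq> others v"
  shows "real (num_degree n l (G \<union> star v S)) = count_without v l G + increment v l G S"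
proof -
  note deg = vertex_degree_split[OF assms(2,3)]
  have "real (num_degree n l (G \<union> star v S)) = of_bool (vertex_degree (G \<union> star v S) v = l)
      + (\<Sum>u\<in>others v. of_bool (vertex_degree (G \<union> star v S) u = l))"
    unfolding num_degree_sum using assms(1) by (intro sum.remove) auto
  also have "\<dots> = of_bool (card S = l)
      + (\<Sum>u\<in>others v. of_bool (vertex_degree G u + of_bool (u \<in> S) = l))"
    using deg by (intro arg_cong2[where f = "(+)"] sum.cong) simp_all
  also have "(\<Sum>u\<in>others v. of_bool (vertex_degree G u + of_bool (u \<in> S) = l)) = (\<Sum>u\<in>others v.
      of_bool (vertex_degree G u = l) + of_bool (u \<in> S) *
        (of_bool (vertex_degree G u + 1 = l) - of_bool (vertex_degree G u = l)) :: real)"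
    by (intro sum.cong refl) auto
  finally show ?thesis by (simp add: count_without_def increment_def sum.distrib)
qed

lemma increment_bound:
  assumes "S \<subseteq> others v"
  shows "\<bar>increment v l G S\<bar> \<le> 1 + real (card S)"
proof -
  have "\<bar>\<Sum>u\<in>others v. of_bool (u \<in> S) *
     (of_bool (vertex_degree G u + 1 = l) - of_bool (vertex_degree G u = l) :: real)\<bar>
    \<le> (\<Sum>u\<in>others v. of_bool (u \<in> S))"
    by (intro order_trans[OF sum_abs] sum_mono) auto
  also have "\<dots> = real (card S)"
    using assms by (simp add: of_bool_def sum.If_cases Int_absorb1)
  finally have "\<bar>\<Sum>u\<in>others v. of_bool (u \<in> S) *
     (of_bool (vertex_degree G u + 1 = l) - of_bool (vertex_degree G u = l) :: real)\<bar> \<le> real (card S)" .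
  moreover have "\<bar>of_bool (card S = l) :: real\<bar> \<le> 1" by simp
  ultimately show ?thesis unfolding increment_def by linarith
qed

text \<open>The mean degree is \<theta>, so the moment equals
  \<open>1 + 2 * \<theta> + \<theta> * (1 + \<theta> - p)\<close>, which is below 1 + 2 + 2
  uniformly in \<open>n\<close>.\<close>

lemma star_moment:
  assumes "v < n"
  shows "subset_exp p (others v) (\<lambda>S. (1 + real (card S))\<^sup>2) \<le> 5"
proof -
  have r: "real (n - 1) = real n - 1" using n by (simp add: of_nat_diff)
  have "subset_exp p (others v) (\<lambda>S. (1 + real (card S))\<^sup>2)
     = subset_exp p (others v) (\<lambda>S. 1 + 2 * real (card S) + (real (card S))\<^sup>2)"
    by (simp add: power2_sum)
  also have "\<dots> = 1 + 2 * \<theta> + \<theta> * (1 + (\<theta> - p))"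
    using subset_exp_size[of "others v", OF _ p] assms mean_degree
    by (simp add: r) (simp add: algebra_simps)
  also have "\<theta> * (1 + (\<theta> - p)) \<le> 1 * 2"
    using theta p by (intro mult_mono) auto
  finally show ?thesis using theta by simp
qed

text \<open>The centred indicator depends on \<open>S\<close> only through its size, so its
  covariance with the membership of \<open>u\<close> is the same number \<open>slope k\<close> for
  every \<open>u\<close>. The sum over vertices therefore collapses to a difference of two counts in
  \<open>G\<close>.\<close>

lemma xi_moments:
  assumes "v < n"
  shows "subset_exp p (others v) (\<lambda>S. of_bool (card S = k) - dprob k) = 0"
    and "subset_exp p (others v) (\<lambda>S. (of_bool (card S = k) - dprob k) * increment v l G S)
      = kappa k l (count_below v l G) (count_without v l G)"
proof -
  let ?E = "subset_exp p (others v)"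
  have r: "real (n - 1) = real n - 1" using n by (simp add: of_nat_diff)
  have card: "?E (\<lambda>S. of_bool (card S = k)) = dprob k" for k
    using subset_exp_card[of "others v", OF _ p] assms by (simp add: dprob_def)
  then show "?E (\<lambda>S. of_bool (card S = k) - dprob k) = 0" by simp
  have mem: "?E (\<lambda>S. of_bool (u \<in> S)) = p" if "u \<in> others v" for u
    using subset_exp_member[of "others v" u, OF _ that p, of "\<lambda>_. 1"] by simp
  have cm: "?E (\<lambda>S. of_bool (card S = k) * of_bool (u \<in> S)) = real k / (real n - 1) * dprob k"
    if "u \<in> others v" for u
    using subset_exp_card_member[of "others v" u, OF _ that p, of k] assms by (simp add: mult.commute r dprob_def)
  have cov_mem: "?E (\<lambda>S. (of_bool (card S = k) - dprob k) * of_bool (u \<in> S)) = slope k" if "u \<in> others v" for u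
  proof -
    have "?E (\<lambda>S. (of_bool (card S = k) - dprob k) * of_bool (u \<in> S))
       = ?E (\<lambda>S. of_bool (card S = k) * of_bool (u \<in> S)) - dprob k * ?E (\<lambda>S. of_bool (u \<in> S))"
      by (simp add: left_diff_distrib)
    also have "\<dots> = real k / (real n - 1) * dprob k - dprob k * p"
      unfolding mem[OF that] cm[OF that] ..
    also have "\<dots> = slope k"
    proof -
      have "real k / (real n - 1) * d - d * (\<theta> / (real n - 1)) = d * (real k - \<theta>) / (real n - 1)" for d
        by (simp add: diff_divide_distrib algebra_simps)
      from this[of "dprob k"] show ?thesis unfolding slope_def p_eq[symmetric] .
    qed
    finally show ?thesis .
  qed
  have cov_card: "?E (\<lambda>S. (of_bool (card S = k) - dprob k) * of_bool (card S = l))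
     = (if k = l then dprob k else 0) - dprob k * dprob l"
  proof -
    have "?E (\<lambda>S. (of_bool (card S = k) - dprob k) * of_bool (card S = l))
       = ?E (\<lambda>S. (if k = l then of_bool (card S = k) else 0) - dprob k * of_bool (card S = l))"
      by (intro Bochner_Integration.integral_cong) (auto simp: left_diff_distrib)
    also have "\<dots> = ?E (\<lambda>S. if k = l then of_bool (card S = k) else 0) - dprob k * ?E (\<lambda>S. of_bool (card S = l))"
      by simp
    finally show ?thesis by (simp add: card)
  qed
  let ?t = "\<lambda>u. of_bool (vertex_degree G u + 1 = l) - of_bool (vertex_degree G u = l) :: real"
  have "?E (\<lambda>S. (of_bool (card S = k) - dprob k) * increment v l G S)
     = ?E (\<lambda>S. (of_bool (card S = k) - dprob k) * of_bool (card S = l)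
         + (\<Sum>u\<in>others v. ?t u * ((of_bool (card S = k) - dprob k) * of_bool (u \<in> S))))"
    unfolding increment_def by (simp only: distrib_left sum_distrib_left mult_ac)
  also have "\<dots> = (if k = l then dprob k else 0) - dprob k * dprob l + (\<Sum>u\<in>others v. ?t u * slope k)"
    by (subst Bochner_Integration.integral_add, simp, simp, subst Bochner_Integration.integral_sum, simp)
      (simp add: cov_card cov_mem del: of_bool_eq_iff)
  also have "(\<Sum>u\<in>others v. ?t u * slope k) = slope k * (count_below v l G - count_without v l G)"
    by (simp add: count_below_def count_without_def sum_subtractf mult.commute flip: sum_distrib_left)
  finally show "?E (\<lambda>S. (of_bool (card S = k) - dprob k) * increment v l G S)
      = kappa k l (count_below v l G) (count_without v l G)"
    by (simp add: kappa_def)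
qed

lemma slope_bound: "\<bar>slope k\<bar> \<le> (real k + 1) / (real n - 1)"
proof -
  have "\<bar>dprob k * (real k - \<theta>)\<bar> \<le> 1 * (real k + 1)"
    unfolding abs_mult using dprob_bounds[of k] theta by (intro mult_mono) auto
  then show ?thesis
    unfolding slope_def using n by (simp add: abs_divide divide_right_mono)
qed

lemma slope_bound': "\<bar>slope k\<bar> \<le> 2 * (real k + 1) / real n"
proof -
  have "1 / (real n - 1) \<le> 2 / real n" using n by (simp add: field_simps)
  then have "(real k + 1) * (1 / (real n - 1)) \<le> (real k + 1) * (2 / real n)"
    by (rule mult_left_mono) simp
  then show ?thesis using slope_bound[of k] by (simp add: mult.commute)
qed

text \<open>The slope is of order \<open>1 / n\<close> while the counts differ by at most
  \<open>n - 1\<close>, so their product is bounded. The remaining covariance of indicators is at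
  most 1 in absolute value.\<close>

lemma kappa_bound:
  assumes "v < n"
  shows "\<bar>kappa k l (count_below v l G) (count_without v l G)\<bar> \<le> real k + 2"
proof -
  have c: "0 \<le> count_without v l G" "count_without v l G \<le> real n - 1"
    "0 \<le> count_below v l G" "count_below v l G \<le> real n - 1"
    using assms n sum_bounded_above[of "others v" "\<lambda>u. of_bool (vertex_degree G u = l)" "1::real"]
      sum_bounded_above[of "others v" "\<lambda>u. of_bool (vertex_degree G u + 1 = l)" "1::real"]
    by (auto simp: count_without_def count_below_def of_nat_diff intro!: sum_nonneg)
  have "\<bar>slope k * (count_below v l G - count_without v l G)\<bar> \<le> (real k + 1) / (real n - 1) * (real n - 1)"
    unfolding abs_mult using slope_bound[of k] c n by (intro mult_mono) auto
  also have "\<dots> = real k + 1" using n by simp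
  finally have s: "\<bar>slope k * (count_below v l G - count_without v l G)\<bar> \<le> real k + 1" .
  have "dprob k * dprob l \<le> 1 * 1" "0 \<le> dprob k * dprob l"
    using dprob_bounds by (intro mult_mono mult_nonneg_nonneg; simp)+
  then have d: "\<bar>(if k = l then dprob k else 0) - dprob k * dprob l\<bar> \<le> 1"
  proof -
    have "0 \<le> (if k = l then dprob k else 0)" "(if k = l then dprob k else 0) \<le> 1"
      using dprob_bounds by auto
    then show ?thesis
      using \<open>dprob k * dprob l \<le> 1 * 1\<close> \<open>0 \<le> dprob k * dprob l\<close> unfolding abs_le_iff by linarith
  qed
  show ?thesis using d s unfolding kappa_def by linarith
qed

section \<open>Mean and variance of the degree counts\<close>

lemma expected_xi: "v < n \<Longrightarrow> graph_exp (xi k v) = 0"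
proof -
  assume v: "v < n"
  have "graph_exp (xi k v) = subset_exp p (edges_on (others v)) (\<lambda>G. subset_exp p (others v)
      (\<lambda>S. of_bool (card S = k) - dprob k))"
    unfolding graph_exp_split[OF v] xi_def
    by (intro subset_exp_cong) (simp add: vertex_degree_split)
  also have "\<dots> = 0" using xi_moments(1)[OF v] by simp
  finally show ?thesis .
qed

lemma num_degree_centred: "real (num_degree n k E) - real n * dprob k = (\<Sum>v<n. xi k v E)"
  by (simp add: num_degree_sum xi_def sum_subtractf)

lemma expected_num_degree: "graph_exp (\<lambda>E. real (num_degree n k E)) = real n * dprob k"
proof -
  have "graph_exp (\<lambda>E. real (num_degree n k E) - real n * dprob k) = 0"
    unfolding num_degree_centred by (simp add: expected_xi)
  then show ?thesis by simp
qed

text \<open>For a linear function the expansion at \<open>v\<close> is exact: the part depending on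
  \<open>G\<close> alone is killed by the centring of \<open>xi\<close>, and only
  \<open>kappa\<close> survives, with a bound independent of \<open>n\<close>.\<close>

lemma variance_bound:
  shows "graph_exp (\<lambda>E. (real (num_degree n l E) - real n * dprob l)\<^sup>2) \<le> real n * (real l + 2)"
proof -
  let ?W = "\<lambda>E. real (num_degree n l E) - real n * dprob l"
  have "graph_exp (\<lambda>E. (?W E)\<^sup>2) = (\<Sum>v<n. graph_exp (\<lambda>E. xi l v E * ?W E))"
  proof -
    have "(?W E)\<^sup>2 = (\<Sum>v<n. xi l v E * ?W E)" for E
      unfolding power2_eq_square sum_distrib_right[symmetric] num_degree_centred[symmetric] ..
    then show ?thesis by simp
  qed
  also have "\<dots> \<le> (\<Sum>v<n. real l + 2)"
  proof (rule sum_mono)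
    fix v assume "v \<in> {..<n}"
    then have v: "v < n" by simp
    have "graph_exp (\<lambda>E. xi l v E * ?W E) = subset_exp p (edges_on (others v)) (\<lambda>G. subset_exp p (others v)
        (\<lambda>S. (of_bool (card S = l) - dprob l) * (count_without v l G - real n * dprob l)
           + (of_bool (card S = l) - dprob l) * increment v l G S))"
      unfolding graph_exp_split[OF v]
      by (intro subset_exp_cong) (simp add: xi_def num_degree_split[OF v] vertex_degree_split algebra_simps)
    also have "\<dots> = subset_exp p (edges_on (others v)) (\<lambda>G. kappa l l (count_below v l G) (count_without v l G))"
      using xi_moments[OF v] by simp
    also have "\<dots> \<le> subset_exp p (edges_on (others v)) (\<lambda>G. real l + 2)"
      by (rule subset_exp_mono[OF _ abs_le_D1[OF kappa_bound[OF v]]]) simp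
    finally show "graph_exp (\<lambda>E. xi l v E * ?W E) \<le> real l + 2" by simp
  qed
  finally show ?thesis by simp
qed

text \<open>From \<open>\<bar>w\<bar> \<le> w\<^sup>2 / (2 r) + r / 2\<close> with
  \<open>r = sqrt n\<close>, the choice that balances both terms against a variance of order
  \<open>n\<close>.\<close>

lemma absolute_deviation_bound:
  shows "graph_exp (\<lambda>E. \<bar>real (num_degree n l E) - real n * dprob l\<bar>) \<le> sqrt (real n) * (real l + 3) / 2"
proof -
  let ?W = "\<lambda>E. real (num_degree n l E) - real n * dprob l" and ?r = "sqrt (real n)"
  have r: "0 < ?r" using n by simp
  have "\<bar>w\<bar> \<le> w\<^sup>2 / (2 * ?r) + ?r / 2" for w
  proof -
    have "0 \<le> (\<bar>w\<bar> - ?r)\<^sup>2" by simp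
    then have "2 * ?r * \<bar>w\<bar> \<le> w\<^sup>2 + ?r * ?r" unfolding power2_diff by (simp add: power2_eq_square algebra_simps)
    then show ?thesis using r by (simp add: field_simps)
  qed
  then have "graph_exp (\<lambda>E. \<bar>?W E\<bar>) \<le> graph_exp (\<lambda>E. (?W E)\<^sup>2 / (2 * ?r) + ?r / 2)"
    by (intro subset_exp_mono) auto
  also have "\<dots> = graph_exp (\<lambda>E. (?W E)\<^sup>2) / (2 * ?r) + ?r / 2" by simp
  also have "\<dots> \<le> real n * (real l + 2) / (2 * ?r) + ?r / 2"
    using variance_bound[of l] r by (intro add_right_mono divide_right_mono) auto
  also have "real n * (real l + 2) / (2 * ?r) = ?r * (real l + 2) / 2"
  proof -
    have "real n * (real l + 2) / (2 * ?r) = real n / ?r * (real l + 2) / 2" by simp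
    then show ?thesis by (simp only: real_div_sqrt of_nat_0_le_iff)
  qed
  finally show ?thesis by (simp add: field_simps)
qed

section \<open>Expansion at one vertex and summation over vertices\<close>

lemma count_below_eq: "1 \<le> l \<Longrightarrow> count_below v l G = count_without v (l - 1) G"
  unfolding count_below_def count_without_def by (intro sum.cong) (auto simp: of_bool_def)

text \<open>The conditional covariance with the counts of the full graph put in place of those of
  the graph without \<open>v\<close>. It no longer mentions \<open>v\<close>, so the same term
  occurs for every vertex.\<close>

definition kappa_graph :: "nat \<Rightarrow> nat \<Rightarrow> nat set set \<Rightarrow> real" where
  "kappa_graph k l E = kappa k l (real (num_degree n (l - 1) E)) (real (num_degree n l E))"

lemma degree_vector_component:
  "degree_vector n p i E $ b = (real (num_degree n (i b) E) - real n * dprob (i b)) / sqrt (real n)"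
  by (simp add: degree_vector_def normalized_num_degree_def erdos_renyi_random_subset expected_num_degree)

text \<open>Both counts change by at most \<open>1 + card S\<close> when \<open>v\<close> is
  restored, and they enter with a slope of order \<open>1 / n\<close>.\<close>

lemma kappa_graph_bound:
  assumes v: "v < n" and G: "G \<subseteq> edges_on (others v)" and S: "S \<subseteq> others v" and l: "1 \<le> l"
  shows "\<bar>kappa_graph k l (G \<union> star v S) - kappa k l (count_below v l G) (count_without v l G)\<bar>
    \<le> 4 * (real k + 1) / real n * (1 + real (card S))"
proof -
  have "\<bar>kappa_graph k l (G \<union> star v S) - kappa k l (count_below v l G) (count_without v l G)\<bar>
    = \<bar>slope k * (increment v (l - 1) G S - increment v l G S)\<bar>"
    unfolding kappa_graph_def kappa_def num_degree_split[OF v G S] count_below_eq[OF l]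
    by (simp add: algebra_simps)
  also have "\<dots> \<le> 2 * (real k + 1) / real n * (2 * (1 + real (card S)))"
    unfolding abs_mult
  proof (rule mult_mono[OF slope_bound'])
    show "\<bar>increment v (l - 1) G S - increment v l G S\<bar> \<le> 2 * (1 + real (card S))"
      using order_trans[OF abs_triangle_ineq4 add_mono[OF increment_bound[OF S] increment_bound[OF S]]] by simp
  qed simp_all
  finally show ?thesis by (simp add: algebra_simps)
qed

text \<open>The variable \<open>Z\<close> collects the zeroth and first order terms of the
  expansion, with the conditional covariance subtracted, and so has mean 0 given \<open>G\<close>.
  The difference of \<open>Y\<close> and \<open>Z\<close> consists of the Taylor remainder and of
  the cost of re-expressing the covariance term in the full graph; both are at most a constant times
  \<open>(1 + card S)\<^sup>2 / n\<close>, and \<open>star_moment\<close> supplies the factor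
  5.\<close>

lemma vertex_step:
  fixes i :: "'d::finite \<Rightarrow> nat"
  assumes \<phi>: "C11 \<phi> \<phi>1" and v: "v < n" and i: "\<And>b. 1 \<le> i b"
  defines "d \<equiv> real CARD('d)"
  shows "\<bar>graph_exp (\<lambda>E. xi k v E * \<phi> (degree_vector n p i E))
      - (\<Sum>b\<in>UNIV. graph_exp (\<lambda>E. kappa_graph k (i b) E * \<phi>1 b (degree_vector n p i E))) / sqrt (real n)\<bar>
    \<le> 5 * (d\<^sup>2 + d * (d * (real k + 2) + 4 * (real k + 1))) / real n"
proof -
  define r where "r = sqrt (real n)"
  have r: "1 \<le> r" "r * r = real n" using n by (simp_all add: r_def)
  have r0: "0 \<le> r" using r(1) by simp
  define X where "X E = degree_vector n p i E" for E
  \<comment> \<open>Centred by the mean of the full count, although one vertex is missing; this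
    makes \<open>X = x + D\<close> exact.\<close>
  define x where "x G = (\<chi> b. (count_without v (i b) G - real n * dprob (i b)) / r)" for G
  define D where "D G S = (\<chi> b. increment v (i b) G S / r)" for G S
  define K where "K b G = kappa k (i b) (count_below v (i b) G) (count_without v (i b) G)" for b G
  define \<xi> where "\<xi> S = of_bool (card S = k) - dprob k" for S :: "nat set"
  define Y where "Y E = xi k v E * \<phi> (X E) - (\<Sum>b\<in>UNIV. kappa_graph k (i b) E * \<phi>1 b (X E)) / r" for E
  define Z where "Z G S = \<xi> S * \<phi> (x G) + (\<Sum>b\<in>UNIV. \<phi>1 b (x G) * (\<xi> S * increment v (i b) G S - K b G)) / r" for G S
  define c where "c = d\<^sup>2 + d * (d * (real k + 2) + 4 * (real k + 1))"
  have d0: "0 \<le> d" by (simp add: d_def)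
  have Z0: "subset_exp p (others v) (Z G) = 0" for G
    unfolding Z_def \<xi>_def using xi_moments[OF v] by (simp add: K_def)
  have YZ: "\<bar>Y (G \<union> star v S) - Z G S\<bar> \<le> c * (1 + real (card S))\<^sup>2 / real n"
    if G: "G \<subseteq> edges_on (others v)" and S: "S \<subseteq> others v" for G S
  proof -
    let ?E = "G \<union> star v S" and ?s = "1 + real (card S)"
    have XE: "X ?E = x G + D G S"
      by (simp add: vec_eq_iff X_def degree_vector_component num_degree_split[OF v G S] x_def D_def
          add_divide_distrib diff_divide_distrib flip: r_def)
    have xi: "xi k v ?E = \<xi> S"
      using vertex_degree_split(1)[OF G S] by (simp add: xi_def \<xi>_def)
    have xi1: "\<bar>\<xi> S\<bar> \<le> 1" using dprob_bounds[of k] by (auto simp: \<xi>_def)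
    have lD: "l1norm (D G S) \<le> d * (?s / r)"
      unfolding l1norm_def d_def
    proof (rule sum_bounded_above)
      fix b
      show "\<bar>D G S $ b\<bar> \<le> ?s / r"
        using increment_bound[OF S, of "i b" G] r by (simp add: D_def abs_divide divide_right_mono)
    qed
    have T1: "\<bar>\<xi> S * (\<phi> (x G + D G S) - \<phi> (x G) - (\<Sum>b\<in>UNIV. \<phi>1 b (x G) * D G S $ b))\<bar> \<le> d\<^sup>2 * ?s\<^sup>2 / real n"
    proof -
      have "\<bar>\<xi> S * (\<phi> (x G + D G S) - \<phi> (x G) - (\<Sum>b\<in>UNIV. \<phi>1 b (x G) * D G S $ b))\<bar> \<le> 1 * (l1norm (D G S))\<^sup>2"
        unfolding abs_mult using C11_taylor[OF \<phi>] xi1 by (intro mult_mono) auto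
      also have "\<dots> \<le> (d * (?s / r))\<^sup>2"
        using lD by (simp add: power_mono)
      also have "\<dots> = d\<^sup>2 * ?s\<^sup>2 / real n"
        using r by (simp add: power_mult_distrib power_divide power2_eq_square[of r])
      finally show ?thesis .
    qed
    \<comment> \<open>Two replacements: the covariance passes from \<open>G\<close> to the full
      graph at cost \<open>O(1/n)\<close>, and the argument of \<open>\<phi>1\<close> from
      \<open>x G\<close> to \<open>X\<close> at cost \<open>O(1/r)\<close> by the Lipschitz
      bound.\<close>
    have T2: "\<bar>kappa_graph k (i b) ?E * \<phi>1 b (X ?E) - \<phi>1 b (x G) * K b G\<bar>
        \<le> (d * (real k + 2) + 4 * (real k + 1)) * ?s / r" for b
    proof -
      have "\<bar>kappa_graph k (i b) ?E - K b G\<bar> * \<bar>\<phi>1 b (X ?E)\<bar> \<le> (4 * (real k + 1) / real n * ?s) * 1"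
        unfolding K_def by (intro mult_mono kappa_graph_bound[OF v G S i] C11_partial_bound[OF \<phi>]) auto
      also have "\<dots> \<le> 4 * (real k + 1) * ?s / r"
      proof -
        have "r \<le> real n" using r mult_left_mono[of 1 r r] by simp
        then have "4 * (real k + 1) * ?s / real n \<le> 4 * (real k + 1) * ?s / r"
          using r n by (intro divide_left_mono) auto
        then show ?thesis by simp
      qed
      finally have 1: "\<bar>(kappa_graph k (i b) ?E - K b G) * \<phi>1 b (X ?E)\<bar> \<le> 4 * (real k + 1) * ?s / r"
        by (simp add: abs_mult)
      have "\<bar>K b G\<bar> * \<bar>\<phi>1 b (x G + D G S) - \<phi>1 b (x G)\<bar> \<le> (real k + 2) * (d * (?s / r))"
        unfolding K_def
        by (intro mult_mono kappa_bound[OF v] order_trans[OF C11_partial_lipschitz[OF \<phi>] lD]) auto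
      then have 2: "\<bar>K b G * (\<phi>1 b (X ?E) - \<phi>1 b (x G))\<bar> \<le> d * (real k + 2) * ?s / r"
        unfolding XE abs_mult by (simp add: mult_ac)
      have "kappa_graph k (i b) ?E * \<phi>1 b (X ?E) - \<phi>1 b (x G) * K b G
        = (kappa_graph k (i b) ?E - K b G) * \<phi>1 b (X ?E) + K b G * (\<phi>1 b (X ?E) - \<phi>1 b (x G))"
        by (simp add: algebra_simps)
      also have "\<bar>\<dots>\<bar> \<le> 4 * (real k + 1) * ?s / r + d * (real k + 2) * ?s / r"
        using 1 2 by (rule order_trans[OF abs_triangle_ineq add_mono])
      also have "\<dots> = (d * (real k + 2) + 4 * (real k + 1)) * ?s / r"
        by (simp add: add_divide_distrib distrib_right)
      finally show ?thesis .
    qed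
    have T3: "\<bar>(\<Sum>b\<in>UNIV. kappa_graph k (i b) ?E * \<phi>1 b (X ?E) - \<phi>1 b (x G) * K b G) / r\<bar>
       \<le> d * (d * (real k + 2) + 4 * (real k + 1)) * ?s\<^sup>2 / real n"
    proof -
      have "\<bar>\<Sum>b\<in>UNIV. kappa_graph k (i b) ?E * \<phi>1 b (X ?E) - \<phi>1 b (x G) * K b G\<bar>
        \<le> d * ((d * (real k + 2) + 4 * (real k + 1)) * ?s / r)"
        unfolding d_def by (rule order_trans[OF sum_abs sum_bounded_above]) (use T2 in \<open>simp add: d_def\<close>)
      then have "\<bar>(\<Sum>b\<in>UNIV. kappa_graph k (i b) ?E * \<phi>1 b (X ?E) - \<phi>1 b (x G) * K b G) / r\<bar>
        \<le> d * ((d * (real k + 2) + 4 * (real k + 1)) * ?s / r) / r"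
        using r0 unfolding abs_divide abs_of_nonneg[OF r0] by (rule divide_right_mono)
      also have "\<dots> = d * (d * (real k + 2) + 4 * (real k + 1)) * ?s / real n"
        using r by simp
      also have "\<dots> \<le> d * (d * (real k + 2) + 4 * (real k + 1)) * ?s\<^sup>2 / real n"
      proof (intro divide_right_mono mult_left_mono)
        show "?s \<le> ?s\<^sup>2" by (simp add: power2_eq_square algebra_simps)
      qed (use d0 in simp_all)
      finally show ?thesis .
    qed
    have "Y ?E - Z G S = \<xi> S * (\<phi> (x G + D G S) - \<phi> (x G) - (\<Sum>b\<in>UNIV. \<phi>1 b (x G) * D G S $ b))
      - (\<Sum>b\<in>UNIV. kappa_graph k (i b) ?E * \<phi>1 b (X ?E) - \<phi>1 b (x G) * K b G) / r"
    proof -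
      define I where "I = (\<Sum>b\<in>UNIV. \<phi>1 b (x G) * increment v (i b) G S)"
      have "(\<Sum>b\<in>UNIV. \<phi>1 b (x G) * D G S $ b) = I / r"
        by (simp add: I_def D_def sum_divide_distrib)
      moreover have "(\<Sum>b\<in>UNIV. \<phi>1 b (x G) * (\<xi> S * increment v (i b) G S - K b G))
          = \<xi> S * I - (\<Sum>b\<in>UNIV. \<phi>1 b (x G) * K b G)"
        unfolding I_def sum_distrib_left sum_subtractf[symmetric] by (intro sum.cong) (simp_all add: algebra_simps)
      ultimately show ?thesis
        unfolding Y_def Z_def xi XE sum_subtractf
        by (simp only:) (simp add: diff_divide_distrib right_diff_distrib)
    qed
    then have "\<bar>Y ?E - Z G S\<bar> \<le> d\<^sup>2 * ?s\<^sup>2 / real n + d * (d * (real k + 2) + 4 * (real k + 1)) * ?s\<^sup>2 / real n"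
      using T1 T3 by linarith
    also have "\<dots> = c * ?s\<^sup>2 / real n" by (simp add: c_def add_divide_distrib distrib_right)
    finally show ?thesis .
  qed
  have c0: "0 \<le> c" using d0 by (simp add: c_def)
  have inner: "\<bar>subset_exp p (others v) (\<lambda>S. Y (G \<union> star v S))\<bar> \<le> 5 * c / real n"
    if G: "G \<subseteq> edges_on (others v)" for G
  proof -
    have "\<bar>subset_exp p (others v) (\<lambda>S. Y (G \<union> star v S))\<bar>
      = \<bar>subset_exp p (others v) (\<lambda>S. Y (G \<union> star v S) - Z G S)\<bar>"
      using Z0[of G] by simp
    also have "\<dots> \<le> subset_exp p (others v) (\<lambda>S. \<bar>Y (G \<union> star v S) - Z G S\<bar>)"
      by (rule integral_abs_bound)
    also have "\<dots> \<le> subset_exp p (others v) (\<lambda>S. c * (1 + real (card S))\<^sup>2 / real n)"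
      by (rule subset_exp_mono[OF _ YZ[OF G]]) simp_all
    also have "\<dots> = c * subset_exp p (others v) (\<lambda>S. (1 + real (card S))\<^sup>2) / real n" by simp
    also have "\<dots> \<le> c * 5 / real n"
      using star_moment[OF v] c0 by (intro divide_right_mono mult_left_mono) auto
    finally show ?thesis by (simp add: mult.commute)
  qed
  have "\<bar>graph_exp Y\<bar> \<le> subset_exp p (edges_on (others v)) (\<lambda>G. \<bar>subset_exp p (others v) (\<lambda>S. Y (G \<union> star v S))\<bar>)"
    unfolding graph_exp_split[OF v] by (rule integral_abs_bound)
  also have "\<dots> \<le> subset_exp p (edges_on (others v)) (\<lambda>G. 5 * c / real n)"
    by (rule subset_exp_mono[OF _ inner]) simp_all
  finally have "\<bar>graph_exp Y\<bar> \<le> 5 * c / real n" by simp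
  moreover have "graph_exp Y = graph_exp (\<lambda>E. xi k v E * \<phi> (X E))
      - (\<Sum>b\<in>UNIV. graph_exp (\<lambda>E. kappa_graph k (i b) E * \<phi>1 b (X E))) / r"
    unfolding Y_def by simp
  ultimately show ?thesis unfolding X_def r_def c_def by (simp only:)
qed

text \<open>The component \<open>a\<close> is the sum of the \<open>xi\<close> over all vertices
  divided by \<open>sqrt n\<close>. There are \<open>n\<close> errors of order \<open>1 / n\<close>,
  again divided by \<open>sqrt n\<close>.\<close>

lemma graph_stein_random_covariance:
  fixes i :: "'d::finite \<Rightarrow> nat"
  assumes \<phi>: "C11 \<phi> \<phi>1" and i: "\<And>b. 1 \<le> i b"
  defines "d \<equiv> real CARD('d)"
  shows "\<bar>graph_exp (\<lambda>E. degree_vector n p i E $ a * \<phi> (degree_vector n p i E))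
      - (\<Sum>b\<in>UNIV. graph_exp (\<lambda>E. kappa_graph (i a) (i b) E * \<phi>1 b (degree_vector n p i E)))\<bar>
    \<le> 5 * (d\<^sup>2 + d * (d * (real (i a) + 2) + 4 * (real (i a) + 1))) / sqrt (real n)"
proof -
  define r where "r = sqrt (real n)"
  have r: "1 \<le> r" "r * r = real n" using n by (simp_all add: r_def)
  define c where "c = 5 * (d\<^sup>2 + d * (d * (real (i a) + 2) + 4 * (real (i a) + 1)))"
  define e where "e v = graph_exp (\<lambda>E. xi (i a) v E * \<phi> (degree_vector n p i E))" for v
  define s where "s = (\<Sum>b\<in>UNIV. graph_exp (\<lambda>E. kappa_graph (i a) (i b) E * \<phi>1 b (degree_vector n p i E)))"
  have step: "\<bar>e v - s / r\<bar> \<le> c / real n" if "v < n" for v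
    using vertex_step[OF \<phi> that i, of "i a"] by (simp add: e_def s_def r_def c_def d_def)
  have "graph_exp (\<lambda>E. degree_vector n p i E $ a * \<phi> (degree_vector n p i E)) = (\<Sum>v<n. e v) / r"
    unfolding degree_vector_component num_degree_centred e_def r_def
    by (simp add: sum_distrib_right)
  \<comment> \<open>Since \<open>r * r = n\<close>, the covariance term can be spread evenly over
    the vertices and compared with \<open>e v\<close> one by one.\<close>
  moreover have "s = (\<Sum>v<n. s / r) / r" using r n by (simp add: field_simps)
  ultimately have "graph_exp (\<lambda>E. degree_vector n p i E $ a * \<phi> (degree_vector n p i E)) - s
     = (\<Sum>v<n. e v - s / r) / r"
    unfolding sum_subtractf diff_divide_distrib by (simp only:)
  then have "\<bar>graph_exp (\<lambda>E. degree_vector n p i E $ a * \<phi> (degree_vector n p i E)) - s\<bar>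
     = \<bar>\<Sum>v<n. e v - s / r\<bar> / r"
    using r(1) by (simp only: abs_divide)
  also have "\<dots> \<le> (\<Sum>v<n. c / real n) / r"
    using r step by (intro divide_right_mono order_trans[OF sum_abs] sum_mono) auto
  also have "\<dots> = c / r" using n by simp
  finally show ?thesis unfolding s_def c_def r_def .
qed

text \<open>The covariance is affine in the two counts with slope \<open>O(1/n)\<close>, and the
  counts deviate from their means by \<open>O(sqrt n)\<close> on average. The distance of its value
  at the mean counts from the target \<open>t\<close> is kept separate.\<close>

lemma kappa_graph_concentration:
  assumes l: "1 \<le> l"
  shows "graph_exp (\<lambda>E. \<bar>kappa_graph k l E - t\<bar>)
    \<le> \<bar>kappa k l (real n * dprob (l - 1)) (real n * dprob l) - t\<bar> + 2 * (real k + 1) * (real l + 3) / sqrt (real n)"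
proof -
  let ?W = "\<lambda>l E. real (num_degree n l E) - real n * dprob l" and ?r = "sqrt (real n)"
  let ?k = "kappa k l (real n * dprob (l - 1)) (real n * dprob l)"
  have r: "real n / ?r = ?r" by (rule real_div_sqrt) simp
  have "graph_exp (\<lambda>E. \<bar>kappa_graph k l E - t\<bar>)
    \<le> graph_exp (\<lambda>E. \<bar>?k - t\<bar> + \<bar>slope k\<bar> * (\<bar>?W (l - 1) E\<bar> + \<bar>?W l E\<bar>))"
  proof (rule subset_exp_mono)
    fix E
    have e: "kappa_graph k l E - t = (?k - t) + slope k * (?W (l - 1) E - ?W l E)"
      unfolding kappa_graph_def kappa_def right_diff_distrib by linarith
    have "\<bar>x + y * (z - w)\<bar> \<le> \<bar>x\<bar> + \<bar>y\<bar> * (\<bar>z\<bar> + \<bar>w\<bar>)" for x y z w :: real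
      unfolding abs_mult[of y, symmetric]
      by (rule order_trans[OF abs_triangle_ineq add_left_mono]) (simp add: abs_mult mult_left_mono)
    then show "\<bar>kappa_graph k l E - t\<bar> \<le> \<bar>?k - t\<bar> + \<bar>slope k\<bar> * (\<bar>?W (l - 1) E\<bar> + \<bar>?W l E\<bar>)"
      unfolding e .
  qed simp
  also have "\<dots> = \<bar>?k - t\<bar> + \<bar>slope k\<bar> * (graph_exp (\<lambda>E. \<bar>?W (l - 1) E\<bar>) + graph_exp (\<lambda>E. \<bar>?W l E\<bar>))"
    by (rule subset_exp_affine) simp
  also have "\<dots> \<le> \<bar>?k - t\<bar> + (2 * (real k + 1) / real n) * (?r * (real l + 3) / 2 + ?r * (real l + 3) / 2)"
  proof -
    have "?r * (real (l - 1) + 3) / 2 \<le> ?r * (real l + 3) / 2"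
      by (intro divide_right_mono mult_left_mono) auto
    with absolute_deviation_bound[of "l - 1"]
    have 1: "graph_exp (\<lambda>E. \<bar>?W (l - 1) E\<bar>) \<le> ?r * (real l + 3) / 2"
      by (rule order_trans)
    have 0: "0 \<le> graph_exp (\<lambda>E. \<bar>?W j E\<bar>)" for j
      by (rule Bochner_Integration.integral_nonneg) simp
    have "\<bar>slope k\<bar> * (graph_exp (\<lambda>E. \<bar>?W (l - 1) E\<bar>) + graph_exp (\<lambda>E. \<bar>?W l E\<bar>))
        \<le> (2 * (real k + 1) / real n) * (?r * (real l + 3) / 2 + ?r * (real l + 3) / 2)"
    proof (rule mult_mono[OF slope_bound'])
      show "graph_exp (\<lambda>E. \<bar>?W (l - 1) E\<bar>) + graph_exp (\<lambda>E. \<bar>?W l E\<bar>)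
        \<le> ?r * (real l + 3) / 2 + ?r * (real l + 3) / 2"
        using 1 absolute_deviation_bound[of l] by (rule add_mono)
      show "0 \<le> graph_exp (\<lambda>E. \<bar>?W (l - 1) E\<bar>) + graph_exp (\<lambda>E. \<bar>?W l E\<bar>)"
        using 0[of "l - 1"] 0[of l] by (rule add_nonneg_nonneg)
    qed simp
    then show ?thesis by (rule add_left_mono)
  qed
  also have "(2 * (real k + 1) / real n) * (?r * (real l + 3) / 2 + ?r * (real l + 3) / 2)
    = 2 * (real k + 1) * (real l + 3) / (real n / ?r)"
  proof -
    have "2 * x / N * (R * y / 2 + R * y / 2) = 2 * x * y / (N / R)" for x y N R :: real by simp
    then show ?thesis .
  qed
  finally show ?thesis unfolding r .
qed

text \<open>As the \<open>\<phi>1 b\<close> are bounded by 1, replacing the random covariance by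
  \<open>C\<close> costs only their mean absolute distance.\<close>

lemma graph_stein:
  fixes i :: "'d::finite \<Rightarrow> nat" and C :: "real ^ 'd ^ 'd"
  assumes \<phi>: "C11 \<phi> \<phi>1" and i: "\<And>b. 1 \<le> i b"
    and lim: "\<And>b. \<bar>kappa (i a) (i b) (real n * dprob (i b - 1)) (real n * dprob (i b)) - C $ a $ b\<bar> \<le> B / sqrt (real n)"
  defines "d \<equiv> real CARD('d)"
  shows "\<bar>graph_exp (\<lambda>E. degree_vector n p i E $ a * \<phi> (degree_vector n p i E))
      - (\<Sum>b\<in>UNIV. C $ a $ b * graph_exp (\<lambda>E. \<phi>1 b (degree_vector n p i E)))\<bar>
    \<le> (5 * (d\<^sup>2 + d * (d * (real (i a) + 2) + 4 * (real (i a) + 1)))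
        + (\<Sum>b\<in>UNIV. B + 2 * (real (i a) + 1) * (real (i b) + 3))) / sqrt (real n)"
proof -
  let ?X = "degree_vector n p i" and ?k = "\<lambda>b. kappa_graph (i a) (i b)"
  have "\<bar>graph_exp (\<lambda>E. ?k b E * \<phi>1 b (?X E)) - C $ a $ b * graph_exp (\<lambda>E. \<phi>1 b (?X E))\<bar>
    \<le> (B + 2 * (real (i a) + 1) * (real (i b) + 3)) / sqrt (real n)" for b
  proof -
    have "graph_exp (\<lambda>E. ?k b E * \<phi>1 b (?X E)) - C $ a $ b * graph_exp (\<lambda>E. \<phi>1 b (?X E))
       = graph_exp (\<lambda>E. (?k b E - C $ a $ b) * \<phi>1 b (?X E))"
      by (simp add: left_diff_distrib)
    also have "\<bar>\<dots>\<bar> \<le> graph_exp (\<lambda>E. \<bar>(?k b E - C $ a $ b) * \<phi>1 b (?X E)\<bar>)"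
      by (rule integral_abs_bound)
    also have "\<dots> \<le> graph_exp (\<lambda>E. \<bar>?k b E - C $ a $ b\<bar>)"
    proof (rule subset_exp_mono)
      show "\<bar>(?k b E - C $ a $ b) * \<phi>1 b (?X E)\<bar> \<le> \<bar>?k b E - C $ a $ b\<bar>" for E
        unfolding abs_mult by (rule mult_left_le[OF C11_partial_bound[OF \<phi>]]) simp
    qed simp
    also have "\<dots> \<le> B / sqrt (real n) + 2 * (real (i a) + 1) * (real (i b) + 3) / sqrt (real n)"
      by (rule order_trans[OF kappa_graph_concentration[OF i] add_right_mono[OF lim]])
    finally show ?thesis by (simp add: add_divide_distrib)
  qed
  then have "\<bar>\<Sum>b\<in>UNIV. graph_exp (\<lambda>E. ?k b E * \<phi>1 b (?X E)) - C $ a $ b * graph_exp (\<lambda>E. \<phi>1 b (?X E))\<bar>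
    \<le> (\<Sum>b\<in>UNIV. (B + 2 * (real (i a) + 1) * (real (i b) + 3)) / sqrt (real n))"
    by (intro order_trans[OF sum_abs] sum_mono)
  then show ?thesis
    using graph_stein_random_covariance[where a = a and i = i, OF \<phi> i]
    unfolding d_def sum_subtractf add_divide_distrib sum_divide_distrib by linarith
qed

end

section \<open>The limiting covariance\<close>

text \<open>Two linear errors plus a product of errors, which is even smaller. Together with the
  rules for sums and differences, this lets a limit with rate \<open>1 / n\<close> be read off from
  the shape of a formula.\<close>

lemma bigo_inverse_mult:
  assumes "(\<lambda>n. f n - a) \<in> O(\<lambda>n. 1 / real n)" "(\<lambda>n. g n - b) \<in> O(\<lambda>n. 1 / real n)"
  shows "(\<lambda>n. f n * g n - a * b :: real) \<in> O(\<lambda>n. 1 / real n)"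
proof -
  have "(\<lambda>n. (f n - a) * (g n - b)) \<in> O(\<lambda>n. 1 / real n * (1 / real n))"
    using assms by (rule landau_o.big.mult)
  also have "(\<lambda>n. 1 / real n * (1 / real n)) \<in> O(\<lambda>n. 1 / real n)"
    by real_asymp
  finally have "(\<lambda>n. (f n - a) * (g n - b) + a * (g n - b) + b * (f n - a)) \<in> O(\<lambda>n. 1 / real n)"
    using assms by (intro sum_in_bigo) (auto simp: landau_o.big.cmult_in_iff)
  moreover have "f n * g n - a * b = (f n - a) * (g n - b) + a * (g n - b) + b * (f n - a)" for n
    by (simp add: algebra_simps)
  ultimately show ?thesis by simp
qed

lemma bigo_inverse_diff:
  assumes "(\<lambda>n. f n - a) \<in> O(\<lambda>n. 1 / real n)" "(\<lambda>n. g n - b) \<in> O(\<lambda>n. 1 / real n)"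
  shows "(\<lambda>n. (f n - g n) - (a - b) :: real) \<in> O(\<lambda>n. 1 / real n)"
  using sum_in_bigo(2)[OF assms] by (simp add: algebra_simps)

lemma bigo_inverse_add:
  assumes "(\<lambda>n. f n - a) \<in> O(\<lambda>n. 1 / real n)" "(\<lambda>n. g n - b) \<in> O(\<lambda>n. 1 / real n)"
  shows "(\<lambda>n. (f n + g n) - (a + b) :: real) \<in> O(\<lambda>n. 1 / real n)"
  using sum_in_bigo(1)[OF assms] by (simp add: algebra_simps)

section \<open>Poisson limit of the degree probabilities and of the covariance\<close>

definition poisson_weight :: "real \<Rightarrow> nat \<Rightarrow> real" where
  "poisson_weight \<theta> k = \<theta> ^ k / fact k * exp (- \<theta>)"

text \<open>The ratio of successive binomial probabilities is
  \<open>(m - k) / (k + 1) * p / (1 - p)\<close>, here with \<open>p = \<theta> / m\<close>; the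
  condition \<open>\<theta> < m\<close> keeps \<open>1 - p\<close> positive.\<close>

lemma binom_Suc:
  assumes "k < m" "0 < \<theta>" "\<theta> < real m"
  shows "binom m (\<theta> / real m) (Suc k) =
    binom m (\<theta> / real m) k * (\<theta> / real (Suc k) * ((real m - real k) / (real m - \<theta>)))"
proof -
  define q where "q = 1 - \<theta> / real m"
  have m: "0 < real m" using assms by simp
  have q: "q * real m = real m - \<theta>" using m by (simp add: q_def field_simps)
  have "Suc k * (m choose Suc k) = (m - k) * (m choose k)"
    using assms(1) by (metis binomial_absorb_comp binomial_absorption diff_Suc_1 less_imp_le_nat)
  then have "real (Suc k) * real (m choose Suc k) = real (m - k) * real (m choose k)"
    by (simp only: flip: of_nat_mult)
  then have C: "real (m choose Suc k) = (real m - real k) * real (m choose k) / real (Suc k)"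
    using assms(1) by (simp add: field_simps of_nat_diff del: of_nat_Suc)
  have "m - k = Suc (m - Suc k)" using assms(1) by simp
  then have Q: "q ^ (m - k) = q * q ^ (m - Suc k)" by simp
  have "q * real m \<noteq> 0" using q assms by simp
  then show ?thesis
    unfolding binom_def C Q q_def[symmetric] q[symmetric] power_Suc
    using m by (simp add: field_simps del: of_nat_Suc)
qed

text \<open>Induction on \<open>k\<close>: the ratio of successive probabilities tends to
  \<open>\<theta> / (k + 1)\<close>, the Poisson ratio, with error \<open>O(1/n)\<close>, so only
  the case \<open>k = 0\<close> needs a genuine limit.\<close>

lemma binom_poisson:
  assumes \<theta>: "0 < \<theta>" "\<theta> < 1"
  shows "(\<lambda>n. binom (n - 1) (\<theta> / (real n - 1)) k - poisson_weight \<theta> k) \<in> O(\<lambda>n. 1 / real n)"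
proof (induction k)
  case 0
  \<comment> \<open>The natural power is written with a real exponent so that the asymptotics can be
    computed automatically.\<close>
  have "(\<lambda>n. (1 - \<theta> / (real n - 1)) powr (real n - 1) - exp (- \<theta>)) \<in> O(\<lambda>n. 1 / real n)"
    using \<theta> by real_asymp
  moreover have "\<forall>\<^sub>F n in sequentially. binom (n - 1) (\<theta> / (real n - 1)) 0 - poisson_weight \<theta> 0
      = (1 - \<theta> / (real n - 1)) powr (real n - 1) - exp (- \<theta>)"
    using eventually_ge_at_top[of 2]
  proof eventually_elim
    case (elim n)
    have "0 < 1 - \<theta> / (real n - 1)" using \<theta> elim by (simp add: field_simps)
    then have "(1 - \<theta> / (real n - 1)) powr real (n - 1) = (1 - \<theta> / (real n - 1)) ^ (n - 1)"
      by (rule powr_realpow)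
    then show ?case using elim by (simp add: binom_def poisson_weight_def of_nat_diff)
  qed
  ultimately show ?case by (simp cong: landau_o.big.in_cong)
next
  case (Suc k)
  have "(\<lambda>n. \<theta> / real (Suc k) * ((real n - 1 - real k) / (real n - 1 - \<theta>)) - \<theta> / real (Suc k)) \<in> O(\<lambda>n. 1 / real n)"
    using \<theta> by real_asymp
  from bigo_inverse_mult[OF Suc this]
  have "(\<lambda>n. binom (n - 1) (\<theta> / (real n - 1)) k * (\<theta> / real (Suc k) * ((real n - 1 - real k) / (real n - 1 - \<theta>)))
      - poisson_weight \<theta> (Suc k)) \<in> O(\<lambda>n. 1 / real n)"
    by (simp add: poisson_weight_def mult_ac)
  moreover have "\<forall>\<^sub>F n in sequentially. binom (n - 1) (\<theta> / (real n - 1)) (Suc k) - poisson_weight \<theta> (Suc k)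
      = binom (n - 1) (\<theta> / (real n - 1)) k * (\<theta> / real (Suc k) * ((real n - 1 - real k) / (real n - 1 - \<theta>)))
      - poisson_weight \<theta> (Suc k)"
    using eventually_ge_at_top[of "k + 3"]
  proof eventually_elim
    case (elim n)
    then have "real (n - 1) = real n - 1" by (simp add: of_nat_diff)
    then show ?case
      using binom_Suc[of k "n - 1" \<theta>] \<theta> elim by simp
  qed
  ultimately show ?case by (simp only: landau_o.big.in_cong)
qed

lemma poisson_weight_pred:
  assumes "0 < \<theta>" "1 \<le> l"
  shows "poisson_weight \<theta> (l - 1) = poisson_weight \<theta> l * real l / \<theta>"
  using assms by (cases l) (simp_all add: poisson_weight_def del: of_nat_Suc)

text \<open>The Poisson weights at \<open>l - 1\<close> and \<open>l\<close> differ by the weight at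
  \<open>l\<close> times \<open>(l - \<theta>) / \<theta>\<close>. This puts the limit into the
  shape of \<open>kappa\<close>; injectivity of \<open>i\<close> turns \<open>a = b\<close> into
  \<open>i a = i b\<close>.\<close>

lemma limit_cov_poisson:
  fixes i :: "'d::finite \<Rightarrow> nat"
  assumes "0 < \<theta>" "inj i" "1 \<le> i b"
  shows "limit_cov \<theta> i $ a $ b = (if i a = i b then poisson_weight \<theta> (i a) else 0)
    - poisson_weight \<theta> (i a) * poisson_weight \<theta> (i b)
    + poisson_weight \<theta> (i a) * (real (i a) - \<theta>) * (poisson_weight \<theta> (i b - 1) - poisson_weight \<theta> (i b))"
proof -
  let ?w = "\<lambda>a. poisson_weight \<theta> (i a)"
  have w: "\<theta> ^ (i a + i b) / (fact (i a) * fact (i b)) * exp (- 2 * \<theta>) = ?w a * ?w b"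
    by (simp add: poisson_weight_def power_add flip: exp_add)
  have "?w a * (real (i a) - \<theta>) * (poisson_weight \<theta> (i b - 1) - ?w b)
     = ?w a * ?w b * ((real (i a) - \<theta>) * (real (i b) - \<theta>) / \<theta>)"
    unfolding poisson_weight_pred[OF assms(1,3)] using assms(1) by (simp add: field_simps)
  moreover have "(a = b) = (i a = i b)" using assms(2) by (auto dest: injD)
  moreover have "limit_cov \<theta> i $ a $ b = ?w a * ?w b * ((real (i a) - \<theta>) * (real (i b) - \<theta>) / \<theta> - 1)
      + (if a = b then ?w a else 0)"
    unfolding limit_cov_def w[symmetric] by (simp add: poisson_weight_def)
  ultimately show ?thesis by (simp add: right_diff_distrib)
qed

lemma kappa_limit:
  fixes i :: "'d::finite \<Rightarrow> nat"
  assumes \<theta>: "0 < \<theta>" "\<theta> < 1" and i: "inj i" "1 \<le> i b"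
  shows "\<exists>B. \<forall>\<^sub>F n in sequentially.
    \<bar>sparse_graph.kappa n (\<theta> / (real n - 1)) \<theta> (i a) (i b)
       (real n * sparse_graph.dprob n (\<theta> / (real n - 1)) (i b - 1))
       (real n * sparse_graph.dprob n (\<theta> / (real n - 1)) (i b))
      - limit_cov \<theta> i $ a $ b\<bar> \<le> B / sqrt (real n)"
proof -
  define w where "w k = poisson_weight \<theta> k" for k
  define \<pi> where "\<pi> k n = binom (n - 1) (\<theta> / (real n - 1)) k" for k n
  note \<pi> = binom_poisson[OF \<theta>, folded w_def \<pi>_def]
  have c: "(\<lambda>n. real n / (real n - 1) - 1) \<in> O(\<lambda>n. 1 / real n)" by real_asymp
  have const: "(\<lambda>n. x - x) \<in> O(\<lambda>n. 1 / real n)" for x :: real by simp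
  have delta: "(\<lambda>n. (if i a = i b then \<pi> (i a) n else 0) - (if i a = i b then w (i a) else 0)) \<in> O(\<lambda>n. 1 / real n)"
    using \<pi> by simp
  \<comment> \<open>This is \<open>kappa\<close> at the mean counts, with their factor
    \<open>n\<close> moved next to the \<open>1 / (n - 1)\<close> of the slope; the quotient tends
    to 1 with error \<open>O(1/n)\<close>.\<close>
  define K where "K n = ((if i a = i b then \<pi> (i a) n else 0) - \<pi> (i a) n * \<pi> (i b) n)
     + \<pi> (i a) n * (real (i a) - \<theta>) * (real n / (real n - 1)) * (\<pi> (i b - 1) n - \<pi> (i b) n)" for n
  have "(\<lambda>n. K n - (((if i a = i b then w (i a) else 0) - w (i a) * w (i b))
     + w (i a) * (real (i a) - \<theta>) * 1 * (w (i b - 1) - w (i b)))) \<in> O(\<lambda>n. 1 / real n)"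
    unfolding K_def
    by (intro bigo_inverse_add bigo_inverse_diff bigo_inverse_mult delta \<pi> c const)
  then have "(\<lambda>n. K n - limit_cov \<theta> i $ a $ b) \<in> O(\<lambda>n. 1 / real n)"
    by (simp only: limit_cov_poisson[OF \<theta>(1) i] w_def mult_1_right)
  then obtain B where B: "0 < B" "\<forall>\<^sub>F n in sequentially. norm (K n - limit_cov \<theta> i $ a $ b) \<le> B * norm (1 / real n)"
    by (elim landau_o.bigE)
  have "\<forall>\<^sub>F n in sequentially. \<bar>sparse_graph.kappa n (\<theta> / (real n - 1)) \<theta> (i a) (i b)
       (real n * sparse_graph.dprob n (\<theta> / (real n - 1)) (i b - 1))
       (real n * sparse_graph.dprob n (\<theta> / (real n - 1)) (i b))
      - limit_cov \<theta> i $ a $ b\<bar> \<le> B / sqrt (real n)"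
    using B(2) eventually_ge_at_top[of 2]
  proof eventually_elim
    case (elim n)
    interpret sparse_graph n "\<theta> / (real n - 1)" \<theta>
      using \<theta> elim by unfold_locales auto
    have "kappa (i a) (i b) (real n * dprob (i b - 1)) (real n * dprob (i b)) = K n"
      unfolding kappa_def slope_def dprob_def K_def \<pi>_def by (simp add: algebra_simps diff_divide_distrib add_divide_distrib)
    \<comment> \<open>The faster rate \<open>1 / n\<close> is relaxed to the rate of the other
      errors.\<close>
    moreover have "B * norm (1 / real n) \<le> B / sqrt (real n)"
    proof -
      have "sqrt (real n) \<le> real n"
        using elim(2) by (intro real_le_lsqrt) (auto simp: power2_eq_square)
      then have "B / real n \<le> B / sqrt (real n)"
        using B(1) elim(2) by (intro divide_left_mono) auto
      then show ?thesis by simp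
    qed
    ultimately show ?case using elim(1) by simp
  qed
  then show ?thesis by blast
qed

text \<open>Projections, means and second moments depend only on the law, so an arbitrary underlying
  probability space can be replaced by the image measure.\<close>

lemma centred_gaussian_vector_law:
  assumes "centred_gaussian_vector M N C"
  shows "centred_gaussian_law (distr M borel N) C"
proof -
  have P: "prob_space M" and N [measurable]: "N \<in> borel_measurable M"
    and n: "normal_rv M (\<lambda>\<omega>. t \<bullet> N \<omega>)" for t
    using assms by (auto simp: centred_gaussian_vector_def gaussian_vector_def)
  interpret prob_space M by fact
  interpret L: prob_space "distr M borel N" by (rule prob_space_distr) simp
  have mean: "(\<integral>\<omega>. N \<omega> $ a \<partial>M) = 0" for a
    using assms by (simp add: centred_gaussian_vector_def)
  show ?thesis
  proof (unfold_locales)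
    have d: "distr (distr M borel N) borel (\<lambda>y. t \<bullet> y) = distr M borel (\<lambda>\<omega>. t \<bullet> N \<omega>)"
      "distr (distr M borel N) lborel (\<lambda>y. t \<bullet> y) = distr M lborel (\<lambda>\<omega>. t \<bullet> N \<omega>)" for t
      by (subst distr_distr; simp add: comp_def)+
    show "normal_rv (distr M borel N) (\<lambda>y. t \<bullet> y)" for t
      using n[of t] unfolding normal_rv_def distributed_def d by auto
    show "(\<integral>y. y $ a \<partial>distr M borel N) = 0" for a
      using mean by (subst integral_distr) auto
    show "(\<integral>y. y $ a * y $ b \<partial>distr M borel N) = C $ a $ b" for a b
    proof -
      have "covariance M (\<lambda>\<omega>. N \<omega> $ a) (\<lambda>\<omega>. N \<omega> $ b) = C $ a $ b"
        using assms unfolding centred_gaussian_vector_def by blast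
      then show ?thesis unfolding covariance_def mean by (subst integral_distr) simp_all
    qed
  qed simp
qed

theorem theorem4p5:
  fixes \<theta> :: real
    and i :: "'d::{finite, linorder} \<Rightarrow> nat"
  assumes "0 < \<theta>" and "\<theta> < 1"
    and "strict_mono i"
    and "\<And>a. 1 \<le> i a"
  shows "\<exists>c>0. \<forall>\<^sub>F n in sequentially.
    \<forall>(M :: 'b measure) N. centred_gaussian_vector M N (limit_cov \<theta> i) \<longrightarrow>
      d4 (measure_pmf (erdos_renyi n (\<theta> / (real n - 1))))
         (degree_vector n (\<theta> / (real n - 1)) i) M N
      \<le> ereal (c / sqrt (real n))"
proof -
  have inj: "inj i" using assms(3) by (rule strict_mono_imp_inj_on)
  \<comment> \<open>Pairs of indices form one finite type, so finitely many thresholds merge into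
    one. Constants and threshold are fixed before \<open>M\<close> and \<open>N\<close> appear,
    hence do not depend on them.\<close>
  have "\<forall>ab. \<exists>B. \<forall>\<^sub>F n in sequentially.
    \<bar>sparse_graph.kappa n (\<theta> / (real n - 1)) \<theta> (i (fst ab)) (i (snd ab))
       (real n * sparse_graph.dprob n (\<theta> / (real n - 1)) (i (snd ab) - 1))
       (real n * sparse_graph.dprob n (\<theta> / (real n - 1)) (i (snd ab)))
      - limit_cov \<theta> i $ fst ab $ snd ab\<bar> \<le> B / sqrt (real n)"
    by (rule allI) (rule kappa_limit[OF assms(1,2) inj assms(4)])
  from choice[OF this] obtain B where B: "\<forall>ab. \<forall>\<^sub>F n in sequentially.
    \<bar>sparse_graph.kappa n (\<theta> / (real n - 1)) \<theta> (i (fst ab)) (i (snd ab))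
       (real n * sparse_graph.dprob n (\<theta> / (real n - 1)) (i (snd ab) - 1))
       (real n * sparse_graph.dprob n (\<theta> / (real n - 1)) (i (snd ab)))
      - limit_cov \<theta> i $ fst ab $ snd ab\<bar> \<le> B ab / sqrt (real n)" ..
  define B' where "B' = (\<Sum>ab\<in>UNIV. \<bar>B ab\<bar>)"
  have B': "B ab \<le> B'" for ab
  proof -
    have "\<bar>B ab\<bar> \<le> B'" unfolding B'_def by (rule member_le_sum) simp_all
    then show ?thesis by linarith
  qed
  define d where "d = real CARD('d)"
  define K where "K a = 5 * (d\<^sup>2 + d * (d * (real (i a) + 2) + 4 * (real (i a) + 1)))
        + (\<Sum>b\<in>UNIV. B' + 2 * (real (i a) + 1) * (real (i b) + 3))" for a
  define c where "c = (\<Sum>a\<in>UNIV. K a)"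
  have K0: "0 \<le> K a" for a
    unfolding K_def d_def B'_def by (intro add_nonneg_nonneg mult_nonneg_nonneg sum_nonneg) auto
  have Kc: "K a \<le> c" for a unfolding c_def by (rule member_le_sum) (simp_all add: K0)
  have c0: "0 \<le> c" unfolding c_def by (rule sum_nonneg) (simp add: K0)
  have "\<forall>\<^sub>F n in sequentially. \<forall>ab. \<bar>sparse_graph.kappa n (\<theta> / (real n - 1)) \<theta> (i (fst ab)) (i (snd ab))
       (real n * sparse_graph.dprob n (\<theta> / (real n - 1)) (i (snd ab) - 1))
       (real n * sparse_graph.dprob n (\<theta> / (real n - 1)) (i (snd ab)))
      - limit_cov \<theta> i $ fst ab $ snd ab\<bar> \<le> B ab / sqrt (real n)"
    by (rule eventually_all_finite) (rule B[rule_format])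
  then have "\<forall>\<^sub>F n in sequentially.
    \<forall>(M :: 'b measure) N. centred_gaussian_vector M N (limit_cov \<theta> i) \<longrightarrow>
      d4 (measure_pmf (erdos_renyi n (\<theta> / (real n - 1))))
         (degree_vector n (\<theta> / (real n - 1)) i) M N
      \<le> ereal ((pi / 2 * d * c + 1) / sqrt (real n))"
    using eventually_ge_at_top[of 2]
  proof eventually_elim
    case (elim n)
    interpret sparse_graph n "\<theta> / (real n - 1)" \<theta>
      using assms elim by unfold_locales auto
    let ?P = "erdos_renyi n (\<theta> / (real n - 1))" and ?X = "degree_vector n (\<theta> / (real n - 1)) i"
    have lim: "\<bar>kappa (i a) (i b) (real n * dprob (i b - 1)) (real n * dprob (i b)) - limit_cov \<theta> i $ a $ b\<bar>
        \<le> B' / sqrt (real n)" for a b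
    proof (rule order_trans)
      show "\<bar>kappa (i a) (i b) (real n * dprob (i b - 1)) (real n * dprob (i b)) - limit_cov \<theta> i $ a $ b\<bar>
        \<le> B (a, b) / sqrt (real n)" using elim(1)[rule_format, of "(a, b)"] by simp
      show "B (a, b) / sqrt (real n) \<le> B' / sqrt (real n)"
        by (rule divide_right_mono[OF B']) simp
    qed
    have stein: "\<bar>measure_pmf.expectation ?P (\<lambda>E. ?X E $ a * \<phi> (?X E))
        - (\<Sum>b\<in>UNIV. limit_cov \<theta> i $ a $ b * measure_pmf.expectation ?P (\<lambda>E. \<phi>1 b (?X E)))\<bar> \<le> c / sqrt (real n)"
      if "C11 \<phi> \<phi>1" for a \<phi> \<phi>1
    proof (rule order_trans)
      show "\<bar>measure_pmf.expectation ?P (\<lambda>E. ?X E $ a * \<phi> (?X E))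
        - (\<Sum>b\<in>UNIV. limit_cov \<theta> i $ a $ b * measure_pmf.expectation ?P (\<lambda>E. \<phi>1 b (?X E)))\<bar> \<le> K a / sqrt (real n)"
        unfolding erdos_renyi_random_subset K_def d_def
        by (rule graph_stein[OF that assms(4) lim])
      show "K a / sqrt (real n) \<le> c / sqrt (real n)"
        by (rule divide_right_mono[OF Kc]) simp
    qed
    have fin: "finite (set_pmf ?P)"
      unfolding erdos_renyi_random_subset by (rule finite_set_random_subset) simp
    show ?case
    proof (intro allI impI)
      fix M :: "'b measure" and N
      assume N: "centred_gaussian_vector M N (limit_cov \<theta> i)"
      then have [measurable]: "N \<in> borel_measurable M"
        by (simp add: centred_gaussian_vector_def gaussian_vector_def)
      interpret L: centred_gaussian_law "distr M borel N" "limit_cov \<theta> i"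
        by (rule centred_gaussian_vector_law[OF N])
      show "d4 (measure_pmf ?P) ?X M N \<le> ereal ((pi / 2 * d * c + 1) / sqrt (real n))"
        unfolding d4_def
      proof (rule SUP_least)
        fix g :: "real ^ 'd::{finite, linorder} \<Rightarrow> real" assume "g \<in> d4_test_functions"
        note g = d4_test_functions_C11[OF this]
        have [measurable]: "g \<in> borel_measurable borel" by (rule C11_measurable(1)[OF g(1)])
        have "\<bar>measure_pmf.expectation ?P (\<lambda>E. g (?X E)) - (\<integral>y. g y \<partial>distr M borel N)\<bar>
            \<le> pi / 2 * real CARD('d) * (c / sqrt (real n))"
          by (rule L.smart_path_bound[OF fin g stein])
        also have "\<dots> = (pi / 2 * d * c) / sqrt (real n)"
          by (simp add: d_def)
        also have "\<dots> \<le> (pi / 2 * d * c + 1) / sqrt (real n)"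
          by (rule divide_right_mono) simp_all
        also have "(\<integral>y. g y \<partial>distr M borel N) = (\<integral>\<omega>. g (N \<omega>) \<partial>M)"
          by (rule integral_distr) simp_all
        finally show "ereal \<bar>measure_pmf.expectation ?P (\<lambda>E. g (?X E)) - (\<integral>\<omega>. g (N \<omega>) \<partial>M)\<bar>
            \<le> ereal ((pi / 2 * d * c + 1) / sqrt (real n))"
          by simp
      qed
    qed
  qed
  \<comment> \<open>The added 1 secures strict positivity, since \<open>c\<close> is only known to
    be nonnegative.\<close>
  moreover have "0 < pi / 2 * d * c + 1"
    using c0 by (simp add: d_def add_nonneg_pos)
  ultimately show ?thesis by blast
qed

end
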